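(* Let $0<q<1<p<\infty$, $r:=\frac{pq}{p-q}$, $p':=\frac{p}{p-1}$ and $0<\vartheta<\infty$. Let $v,w$ be weights and let $U$ be a $\vartheta$-regular kernel. Then the following assertions are equivalent: (i) There exists a constant $C\in(0,\infty)$ such that the inequality $$\left(\int_0^\infty\left(\int_t^\infty f(x)U(t,x)\,dx\right)^q w(t)\,dt\right)^{\frac1q}\le C\left(\int_0^\infty f^p(t)v(t)\,dt\right)^{\frac1p}\qquad( * )$$ holds for all $f\in\mathscr M_+$. (ii) Both conditions $$D_1:=\sup_{\{t_k\}_{k\in\mathbb I}}\ \sum_{k\in\mathbb I_0}\left(\int_{t_{k-1}}^{t_k}w(t)\,dt\right)^{\frac rq}\left(\int_{t_k}^{t_{k+1}}U^{p'}(t_k,x)v^{1-p'}(x)\,dx\right)^{\frac r{p'}}<\infty$$ and $$D_2:=\sup_{\{t_k\}_{k\in\mathbb I}}\ \sum_{k\in\mathbb I_0}\left(\int_{t_{k-1}}^{t_k}w(t)U^q(t,t_k)\,dt\right)^{\frac rq}\left(\int_{t_k}^{t_{k+1}}v^{1-p'}(x)\,dx\right)^{\frac r{p'}}<\infty$$ are satisfied, where both suprema are taken over all covering sequences $\{t_k\}_{k\in\mathbb I}$. (iii) Both conditions $$A_1:=\int_0^\infty\left(\int_0^t w(x)\,dx\right)^{\frac rp}w(t)\left(\int_t^\infty U^{p'}(t,z)v^{1-p'}(z)\,dz\right)^{\frac r{p'}}dt<\infty$$ and $$A_2:=\int_0^\infty\left(\int_0^t w(x)U^q(x,t)\,dx\right)^{\frac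 rp}w(t)\sup_{z\in[t,\infty)}U^q(t,z)\left(\int_z^\infty v^{1-p'}(s)\,ds\right)^{\frac r{p'}}dt<\infty$$ are satisfied. Moreover, if $C$ is the least constant such that $( * )$ holds for all $f\in\mathscr M_+$, then $$C^r\approx D_1+D_2\approx A_1+A_2.$$
   Context: $\mathscr M_+$ denotes the set of all nonnegative Lebesgue measurable functions on $(0,\infty)$. A weight is a function $w\in\mathscr M_+$ such that $0<\int_0^t w(s)\,ds<\infty$ for all $t>0$. For $\vartheta>0$, a $\vartheta$-regular kernel is a measurable function $U:[0,\infty)^2\to[0,\infty)$ such that: (a) $U(x,y)$ is nonincreasing in $x$ and nondecreasing in $y$; (b) $U(x,z)\le\vartheta\,(U(x,y)+U(y,z))$ for all $0\le x<y<z<\infty$; (c) $U(0,y)>0$ for all $y>0$. For an exponent $\alpha$, $U^\alpha(x,y)$ means $(U(x,y))^\alpha$. An index set is a set $\mathbb I=\{k\in\mathbb Z:\ k_{\min}\le k\le k_{\max}\}$ with $k_{\min}\le k_{\max}$ integers; $\mathbb I_0:=\mathbb I\setminus\{k_{\min},k_{\max}\}$. If $\mathbb I$ is an index set with at least three elements, a sequence $\{t_k\}_{k\in\mathbb I}$ is a covering sequence if $t_{k_{\min}}=0$, $t_{k_{\max}}=\infty$ and $t_k<t_{k+1}$ for all $k\in\mathbb I\setminus\{k_{\max}\}$. $A\lesssim B$ means $A\le cB$ with a constant $c$ depending only on $p,q,\vartheta$ (in particular not on $v,w$); $A\approx B$ means $A\lesssim B$ and $B\lesssim A$. Values in $[0,\infty]$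 are allowed, with the usual convention $0\cdot\infty=0$; $v^{1-p'}=\infty$ where $v=0$. *)

theory Defs
  imports "HOL-Analysis.Analysis"
begin

text \<open>
  Real powers on \<open>[0,\<infinity>]\<close>. For a negative exponent, \<open>0\<close> is sent to \<open>\<infinity>\<close> and \<open>\<infinity>\<close> to \<open>0\<close>; in
  particular \<open>v powe (1 - p') = \<infinity>\<close> where \<open>v = 0\<close>, as \<open>p' > 1\<close>. The convention \<open>0 \<cdot> \<infinity> = 0\<close> is
  the one built into multiplication on \<^typ>\<open>ennreal\<close>.
\<close>

definition ennreal_powr :: "ennreal \<Rightarrow> real \<Rightarrow> ennreal" (infixr \<open>powe\<close> 80) where
  "x powe a =
     (if a = 0 then 1
      else if x = 0 then (if a > 0 then 0 else \<infinity>)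
      else if x = \<infinity> then (if a > 0 then \<infinity> else 0)
      else ennreal (enn2real x powr a))"

text \<open>
  Functions on \<open>(0,\<infinity>)\<close> are total functions on \<^typ>\<open>real\<close> of which only the restriction to
  \<^term>\<open>{0<..} :: real set\<close> is ever used.
\<close>

definition nonneg_measurable :: "(real \<Rightarrow> ennreal) set" where
  "nonneg_measurable = borel_measurable (lebesgue_on {0<..})"

definition weight :: "(real \<Rightarrow> ennreal) \<Rightarrow> bool" where
  "weight w \<longleftrightarrow> w \<in> nonneg_measurable \<and>
     (\<forall>t>0. 0 < (\<integral>\<^sup>+s\<in>{0<..<t}. w s \<partial>lebesgue) \<and> (\<integral>\<^sup>+s\<in>{0<..<t}. w s \<partial>lebesgue) < \<infinity>)"

definition regular_kernel :: "real \<Rightarrow> (real \<Rightarrow> real \<Rightarrow> real) \<Rightarrow> bool" where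
  "regular_kernel \<theta> U \<longleftrightarrow>
     (\<lambda>(x, y). U x y) \<in> borel_measurable (lebesgue_on ({0..} \<times> {0..})) \<and>
     (\<forall>x\<ge>0. \<forall>y\<ge>0. 0 \<le> U x y) \<and>
     (\<forall>y\<ge>0. antimono_on {0..} (\<lambda>x. U x y)) \<and>
     (\<forall>x\<ge>0. mono_on {0..} (\<lambda>y. U x y)) \<and>
     (\<forall>x y z. 0 \<le> x \<and> x < y \<and> y < z \<longrightarrow> U x z \<le> \<theta> * (U x y + U y z)) \<and>
     (\<forall>y>0. 0 < U 0 y)"

text \<open>
  A covering sequence is given by the two ends of its index set \<open>{kmin..kmax}\<close> and a function whose
  values outside that set are irrelevant. The points with index in \<open>{kmin<..<kmax}\<close> are finite and
  positive, so that \<^const>\<open>real_of_ereal\<close> loses nothing there.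
\<close>

definition covering_sequence :: "int \<Rightarrow> int \<Rightarrow> (int \<Rightarrow> ereal) \<Rightarrow> bool" where
  "covering_sequence kmin kmax t \<longleftrightarrow>
     kmin + 2 \<le> kmax \<and> t kmin = 0 \<and> t kmax = \<infinity> \<and> (\<forall>k\<in>{kmin..<kmax}. t k < t (k + 1))"

definition hardy_inequality ::
  "real \<Rightarrow> real \<Rightarrow> (real \<Rightarrow> ennreal) \<Rightarrow> (real \<Rightarrow> ennreal) \<Rightarrow> (real \<Rightarrow> real \<Rightarrow> real) \<Rightarrow> ennreal \<Rightarrow> bool"
where
  "hardy_inequality p q v w U C \<longleftrightarrow>
     (\<forall>f \<in> nonneg_measurable.
        (\<integral>\<^sup>+t\<in>{0<..}. (\<integral>\<^sup>+x\<in>{t<..}. f x * ennreal (U t x) \<partial>lebesgue) powe q * w t \<partial>lebesgue) powe (1 / q)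
        \<le> C * (\<integral>\<^sup>+t\<in>{0<..}. f t powe p * v t \<partial>lebesgue) powe (1 / p))"

text \<open>
  The least constant, as an infimum over the finite positive constants. It is \<open>\<infinity>\<close> if there is no
  such constant, and it may be \<open>0\<close>, since \<open>U\<close> may vanish on \<open>(0,\<infinity>) \<times> (0,\<infinity>)\<close>.
\<close>

definition best_constant ::
  "real \<Rightarrow> real \<Rightarrow> (real \<Rightarrow> ennreal) \<Rightarrow> (real \<Rightarrow> ennreal) \<Rightarrow> (real \<Rightarrow> real \<Rightarrow> real) \<Rightarrow> ennreal"
where
  "best_constant p q v w U = Inf {C. 0 < C \<and> C < \<infinity> \<and> hardy_inequality p q v w U C}"

definition D1 ::
  "real \<Rightarrow> real \<Rightarrow> real \<Rightarrow> (real \<Rightarrow> ennreal) \<Rightarrow> (real \<Rightarrow> ennreal) \<Rightarrow> (real \<Rightarrow> real \<Rightarrow> real) \<Rightarrow> ennreal"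
where
  "D1 q r p' v w U =
     (SUP (kmin, kmax, t) \<in> {(kmin, kmax, t). covering_sequence kmin kmax t}.
        \<Sum>k\<in>{kmin<..<kmax}.
          (\<integral>\<^sup>+s\<in>einterval (t (k - 1)) (t k). w s \<partial>lebesgue) powe (r / q) *
          (\<integral>\<^sup>+x\<in>einterval (t k) (t (k + 1)).
             ennreal (U (real_of_ereal (t k)) x) powe p' * v x powe (1 - p') \<partial>lebesgue) powe (r / p'))"

definition D2 ::
  "real \<Rightarrow> real \<Rightarrow> real \<Rightarrow> (real \<Rightarrow> ennreal) \<Rightarrow> (real \<Rightarrow> ennreal) \<Rightarrow> (real \<Rightarrow> real \<Rightarrow> real) \<Rightarrow> ennreal"
where
  "D2 q r p' v w U =
     (SUP (kmin, kmax, t) \<in> {(kmin, kmax, t). covering_sequence kmin kmax t}.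
        \<Sum>k\<in>{kmin<..<kmax}.
          (\<integral>\<^sup>+s\<in>einterval (t (k - 1)) (t k).
             w s * ennreal (U s (real_of_ereal (t k))) powe q \<partial>lebesgue) powe (r / q) *
          (\<integral>\<^sup>+x\<in>einterval (t k) (t (k + 1)). v x powe (1 - p') \<partial>lebesgue) powe (r / p'))"

definition A1 ::
  "real \<Rightarrow> real \<Rightarrow> real \<Rightarrow> (real \<Rightarrow> ennreal) \<Rightarrow> (real \<Rightarrow> ennreal) \<Rightarrow> (real \<Rightarrow> real \<Rightarrow> real) \<Rightarrow> ennreal"
where
  "A1 p r p' v w U =
     (\<integral>\<^sup>+t\<in>{0<..}.
        (\<integral>\<^sup>+x\<in>{0<..<t}. w x \<partial>lebesgue) powe (r / p) * w t *
        (\<integral>\<^sup>+z\<in>{t<..}. ennreal (U t z) powe p' * v z powe (1 - p') \<partial>lebesgue) powe (r / p') \<partial>lebesgue)"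

definition A2 ::
  "real \<Rightarrow> real \<Rightarrow> real \<Rightarrow> real \<Rightarrow> (real \<Rightarrow> ennreal) \<Rightarrow> (real \<Rightarrow> ennreal) \<Rightarrow> (real \<Rightarrow> real \<Rightarrow> real) \<Rightarrow> ennreal"
where
  "A2 p q r p' v w U =
     (\<integral>\<^sup>+t\<in>{0<..}.
        (\<integral>\<^sup>+x\<in>{0<..<t}. w x * ennreal (U x t) powe q \<partial>lebesgue) powe (r / p) * w t *
        (SUP z\<in>{t..}. ennreal (U t z) powe q *
           (\<integral>\<^sup>+s\<in>{z<..}. v s powe (1 - p') \<partial>lebesgue) powe (r / p')) \<partial>lebesgue)"

end

theory Submission
  imports Defs
begin

text \<open>
  All four quantities are compared through the points at which the primitive of \<open>w\<close> takes the values of a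
  geometric progression with a large ratio. At such points a recursive estimate coming from
  \<open>U x z \<le> \<theta> * (U x y + U y z)\<close>, with \<open>y\<close> the next point, can be summed and its last term absorbed, which leaves
  local terms and terms \<open>U y z\<close> times a tail integral. The tails are localised by grouping the points by the dyadic
  level of the tail; only the last point of each level is kept, and these points form covering sequences.
  The same estimate, applied to \<open>f\<close> with exponents \<open>1\<close> and \<open>q\<close> instead of to \<open>v powe (1 - p')\<close>, followed by
  Hoelder's inequality, shows that \<open>D1\<close> and \<open>D2\<close> imply the inequality. For the converse directions, test functions
  are supported on the right-hand intervals of a covering sequence, and each power \<open>(\<integral> g) powe s\<close> is bounded by
  the integral of the (\<open>s - 1\<close>)th power of the primitive of \<open>g\<close> against \<open>g\<close>.
\<close>

subsection \<open>Powers of extended nonnegative reals\<close>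

text \<open>Absorbing a recursive term means cancelling it, which is legitimate only for finite
  sums, while the tails of \<open>v powe (1 - p')\<close> may be infinite. The estimates are
  therefore proved for \<open>trunc m \<phi>\<close>, bounded and zero beyond \<open>m\<close>, with
  constants independent of \<open>m\<close>. The points start at \<open>m\<close> and descend to
  \<open>0\<close>, so the recursion starts with the value zero; monotone convergence removes the
  truncation. The general estimates have exponents \<alpha>, \<beta>, \<open>a\<close> tied by
  \<open>a * \<beta> = \<alpha> * q\<close>. This identity makes the power
  \<open>a * \<beta>\<close> of the kernel equal to the \<alpha>th power of
  \<open>\<kappa> powe q\<close>, so that a jump of the kernel can join the mass of \<open>w\<close>
  under one power and become a term of the second kind. The instances used are
  \<open>(1, q, 1)\<close> and \<open>(r / q, r / p', p')\<close>. Since \<alpha> is at least 1,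
  sums of \<alpha>th powers over disjoint intervals merge into one interval. The supremal integral
  \<open>A2\<close> is harder: the ratio of \<open>W\<close> at consecutive points is prescribed,
  that of its weight \<open>G\<close> is not. A second recursion, running upwards over the
  representatives of levels, gains from the decay of the tails instead of the decay of
  \<open>W\<close>.\<close>

lemma powe_zero [simp]: "x powe 0 = 1"
  by (simp add: ennreal_powr_def)

lemma zero_powe [simp]: "0 < a \<Longrightarrow> 0 powe a = 0"
  by (simp add: ennreal_powr_def)

lemma top_powe [simp]: "0 < a \<Longrightarrow> top powe a = top"
  by (simp add: ennreal_powr_def)

lemma ennreal_powe: "0 \<le> x \<Longrightarrow> 0 < a \<Longrightarrow> ennreal x powe a = ennreal (x powr a)"
  by (auto simp: ennreal_powr_def)

lemma powe_one [simp]: "x powe 1 = x"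
  by (cases x) (auto simp: ennreal_powe)

lemma one_powe [simp]: "1 powe a = 1"
  by (simp add: ennreal_powr_def)

lemma powe_mono:
  assumes "x \<le> y" "0 \<le> a"
  shows "x powe a \<le> y powe a"
proof (cases "a = 0")
  case False
  then show ?thesis
    using assms by (cases x; cases y) (auto simp: ennreal_powe top_unique intro!: ennreal_leI powr_mono2)
qed simp

lemma powe_powe: "0 < a \<Longrightarrow> 0 < b \<Longrightarrow> (x powe a) powe b = x powe (a * b)"
  by (cases x) (auto simp: ennreal_powe powr_powr)

lemma powe_mult:
  assumes "0 \<le> a"
  shows "(x * y) powe a = x powe a * y powe a"
proof (cases "a = 0")
  case False
  with assms show ?thesis
    by (cases x; cases y; cases "x = 0"; cases "y = 0")
       (auto simp: ennreal_powe powr_mult ennreal_mult[symmetric] ennreal_top_mult ennreal_mult_top)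
qed simp

lemma powe_add:
  assumes "0 \<le> a" "0 \<le> b"
  shows "x powe (a + b) = x powe a * x powe b"
proof (cases "a = 0 \<or> b = 0")
  case False
  with assms show ?thesis
    by (cases x) (auto simp: ennreal_powe powr_add ennreal_mult)
qed auto

lemma powe_inverse: "0 < a \<Longrightarrow> (x powe (1 / a)) powe a = x" "0 < a \<Longrightarrow> (x powe a) powe (1 / a) = x"
  by (simp_all add: powe_powe)

lemma powe_le_iff: "0 < a \<Longrightarrow> x powe a \<le> y \<longleftrightarrow> x \<le> y powe (1 / a)"
  by (metis less_eq_real_def powe_inverse powe_mono zero_less_divide_1_iff)

lemma powe_le_cancel: "0 < a \<Longrightarrow> x powe a \<le> y powe a \<longleftrightarrow> x \<le> y"
  by (simp add: powe_le_iff powe_inverse)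

lemma powe_SUP:
  assumes "0 < a"
  shows "(SUP i\<in>I. f i) powe a = (SUP i\<in>I. f i powe a)"
proof (rule antisym)
  show "(SUP i\<in>I. f i) powe a \<le> (SUP i\<in>I. f i powe a)"
    unfolding powe_le_iff[OF assms]
    by (rule SUP_least) (simp only: powe_le_iff[OF assms, symmetric], rule SUP_upper)
  show "(SUP i\<in>I. f i powe a) \<le> (SUP i\<in>I. f i) powe a"
    by (rule SUP_least, rule powe_mono) (use assms in \<open>auto intro: SUP_upper\<close>)
qed

lemma powe_eq_0_iff: "0 < a \<Longrightarrow> x powe a = 0 \<longleftrightarrow> x = 0"
  by (metis powe_inverse(2) zero_powe zero_less_divide_1_iff)

lemma powe_less_top: "x < top \<Longrightarrow> 0 \<le> a \<Longrightarrow> x powe a < top"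
  by (cases "a = 0"; cases x) (auto simp: ennreal_powe)

text \<open>The sum is at most twice the maximum. The resulting constant is crude but serves
  exponents below and above 1 alike.\<close>

lemma powe_add_le:
  assumes "0 \<le> a"
  shows "(x + y) powe a \<le> 2 powe a * (x powe a + y powe a)"
proof -
  have "x + y \<le> 2 * max x y"
    by (simp add: mult_2 add_mono)
  then have "(x + y) powe a \<le> 2 powe a * max x y powe a"
    using powe_mono[OF _ assms] by (simp add: powe_mult[OF assms, symmetric])
  also have "\<dots> \<le> 2 powe a * (x powe a + y powe a)"
    by (intro mult_left_mono) (auto simp: max_def)
  finally show ?thesis .
qed

lemma powe_superadd:
  assumes "1 \<le> a"
  shows "x powe a + y powe a \<le> (x + y) powe a"
proof -
  have *: "z powe a = z * z powe (a - 1)" for z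
    using powe_add[of 1 "a - 1" z] assms by simp
  have "x * x powe (a - 1) + y * y powe (a - 1) \<le> x * (x + y) powe (a - 1) + y * (x + y) powe (a - 1)"
    using assms by (intro add_mono mult_left_mono powe_mono) auto
  then show ?thesis
    by (simp add: * distrib_right)
qed

lemma powe_sum_superadd:
  assumes "1 \<le> a"
  shows "(\<Sum>i\<in>S. f i powe a) \<le> (\<Sum>i\<in>S. f i) powe a"
proof (induction S rule: infinite_finite_induct)
  case (insert i S)
  then have "(\<Sum>i\<in>insert i S. f i powe a) \<le> f i powe a + (\<Sum>i\<in>S. f i) powe a"
    by simp
  also have "\<dots> \<le> (f i + (\<Sum>i\<in>S. f i)) powe a"
    by (rule powe_superadd[OF assms])
  finally show ?case using insert by simp
qed (use assms in auto)

lemma measurable_powe [measurable (raw)]: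
  assumes f [measurable]: "f \<in> borel_measurable M"
  shows "(\<lambda>x. f x powe a) \<in> borel_measurable M"
proof -
  have [measurable]: "Measurable.pred M (\<lambda>x. f x = 0)" "Measurable.pred M (\<lambda>x. f x = top)"
    using f by measurable
  have "(\<lambda>x. ennreal (enn2real (f x) powr a)) \<in> borel_measurable M"
    by measurable
  then show ?thesis
    unfolding ennreal_powr_def infinity_ennreal_def
    by (cases "a = 0"; cases "a > 0") (simp_all add: measurable_If)
qed

text \<open>Cancellation of \<open>X\<close> in \<open>X + X \<le> X + Y\<close>. It fails for
  infinite \<open>X\<close>, so each use comes with a finiteness argument.\<close>

lemma ennreal_absorb:
  fixes X Y :: ennreal
  assumes "X < top" "2 * X \<le> Y + X"
  shows "X \<le> Y"
proof -
  have "X + X \<le> X + Y"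
    using assms(2) by (simp add: mult_2 add.commute)
  then show ?thesis
    using assms(1) by (auto simp: ennreal_add_left_cancel_le)
qed

lemma incseq_SUP_mult:
  fixes f g :: "nat \<Rightarrow> ennreal"
  assumes "incseq f" "incseq g"
  shows "(SUP n. f n) * (SUP n. g n) = (SUP n. f n * g n)"
proof (rule antisym)
  have "f m * g n \<le> (SUP n. f n * g n)" for m n
  proof -
    have "f m * g n \<le> f (max m n) * g (max m n)"
      using assms by (intro mult_mono) (auto simp: incseq_def)
    also have "\<dots> \<le> (SUP n. f n * g n)" by (rule SUP_upper) simp
    finally show ?thesis .
  qed
  then show "(SUP n. f n) * (SUP n. g n) \<le> (SUP n. f n * g n)"
    by (simp add: SUP_mult_left_ennreal SUP_mult_right_ennreal SUP_le_iff)
qed (auto intro!: SUP_least mult_mono SUP_upper)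

subsection \<open>Set integrals\<close>

abbreviation sint :: "real set \<Rightarrow> (real \<Rightarrow> ennreal) \<Rightarrow> ennreal" where
  "sint A g \<equiv> \<integral>\<^sup>+x\<in>A. g x \<partial>lebesgue"

lemma sint_mono:
  assumes "A \<subseteq> B" "\<And>x. x \<in> A \<Longrightarrow> f x \<le> g x"
  shows "sint A f \<le> sint B g"
  by (intro nn_integral_mono) (use assms in \<open>auto split: split_indicator\<close>)

lemma sint_cong: "(\<And>x. x \<in> A \<Longrightarrow> f x = g x) \<Longrightarrow> sint A f = sint A g"
  by (intro nn_integral_cong) (auto split: split_indicator)

lemma sint_cmult:
  "f \<in> borel_measurable lebesgue \<Longrightarrow> A \<in> sets lebesgue \<Longrightarrow> sint A (\<lambda>x. c * f x) = c * sint A f"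
  by (simp add: mult.assoc nn_integral_cmult)

lemma sint_add:
  "f \<in> borel_measurable lebesgue \<Longrightarrow> g \<in> borel_measurable lebesgue \<Longrightarrow> A \<in> sets lebesgue \<Longrightarrow>
   sint A (\<lambda>x. f x + g x) = sint A f + sint A g"
  by (simp add: distrib_right nn_integral_add)

lemma sint_Un_le:
  assumes [measurable]: "f \<in> borel_measurable lebesgue" "A \<in> sets lebesgue" "B \<in> sets lebesgue"
    and "C \<subseteq> A \<union> B"
  shows "sint C f \<le> sint A f + sint B f"
proof -
  have "sint C f \<le> (\<integral>\<^sup>+x. f x * indicator A x + f x * indicator B x \<partial>lebesgue)"
    using assms(4) by (intro nn_integral_mono) (auto split: split_indicator)
  then show ?thesis by (simp add: nn_integral_add)
qed

lemma sint_sum_disjoint_le: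
  assumes [measurable]: "f \<in> borel_measurable lebesgue" and "finite I"
    and "\<And>i. i \<in> I \<Longrightarrow> A i \<in> sets lebesgue" "disjoint_family_on A I" "(\<Union>i\<in>I. A i) \<subseteq> B"
  shows "(\<Sum>i\<in>I. sint (A i) f) \<le> sint B f"
proof -
  have "(\<Sum>i\<in>I. sint (A i) f) = (\<integral>\<^sup>+x. (\<Sum>i\<in>I. f x * indicator (A i) x) \<partial>lebesgue)"
    using assms by (subst nn_integral_sum) auto
  also have "\<dots> \<le> sint B f"
  proof (rule nn_integral_mono)
    fix x
    show "(\<Sum>i\<in>I. f x * indicator (A i) x) \<le> f x * indicator B x"
    proof (cases "\<exists>i\<in>I. x \<in> A i")
      case True
      then obtain i where i: "i \<in> I" "x \<in> A i" by auto
      then have "indicator (A j) x = (if j = i then 1 else 0::ennreal)" if "j \<in> I" for j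
        using assms(4) that by (auto simp: disjoint_family_on_def split: split_indicator)
      then have "(\<Sum>i\<in>I. f x * indicator (A i) x) = (\<Sum>j\<in>I. if j = i then f x else 0)"
        by (intro sum.cong) auto
      also have "\<dots> = f x"
        using i \<open>finite I\<close> by simp
      finally show ?thesis
        using i assms(5) by auto
    qed (auto simp: sum_nonneg_eq_0_iff)
  qed
  finally show ?thesis .
qed

lemma sint_cong_points:
  assumes "A - {a, b} = B - {a, b :: real}"
  shows "sint A f = sint B f"
proof -
  have ae: "AE x in lebesgue. x \<notin> {a, b}"
    by (rule AE_I'[of "{a, b}"]) auto
  have "x \<in> A \<longleftrightarrow> x \<in> B" if "x \<notin> {a, b}" for x
    using assms that by blast
  then have "f x * indicator A x = f x * indicator B x" if "x \<notin> {a, b}" for x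
    using that by (simp add: indicator_def)
  then show ?thesis
    by (intro nn_integral_cong_AE eventually_mono[OF ae])
qed

lemma sint_remove_endpoints:
  fixes a b :: real
  shows "sint {a<..b} f = sint {a<..<b} f" "sint {a..<b} f = sint {a<..<b} f"
    "sint {a..b} f = sint {a<..<b} f" "sint {a..} f = sint {a<..} f"
  by (rule sint_cong_points[of _ a b], auto)+

text \<open>The primitive is continuous. Finiteness of the integral makes \<open>g\<close> finite
  almost everywhere on the interval, so \<open>g\<close> can be replaced there by a real-valued
  function, for which continuity of the indefinite integral and the intermediate value theorem are
  available.\<close>

lemma sint_IVT:
  assumes [measurable]: "g \<in> borel_measurable lebesgue"
    and "a \<le> b" and fin: "sint {a<..<b} g < top" and c: "c \<le> sint {a<..<b} g"
  obtains m where "a \<le> m" "m \<le> b" "sint {a<..<m} g = c"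
proof -
  define h where "h = (\<lambda>x. enn2real (g x * indicator {a<..<b} x))"
  have [measurable]: "{a<..<b} \<in> sets lebesgue" "{a..b} \<in> sets lebesgue" by auto
  have [measurable]: "(\<lambda>x. g x * indicator {a<..<b} x) \<in> borel_measurable lebesgue" by measurable
  have ae: "AE x in lebesgue. g x * indicator {a<..<b} x \<noteq> top"
    using nn_integral_PInf_AE[of "\<lambda>x. g x * indicator {a<..<b} x" lebesgue] fin by auto
  have eq: "(\<integral>\<^sup>+x. ennreal (h x) * indicator {a<..<m} x \<partial>lebesgue) = sint {a<..<m} g" if "m \<le> b" for m
    by (rule nn_integral_cong_AE, rule AE_mp[OF ae])
       (use that in \<open>auto simp: h_def ennreal_enn2real_if split: split_indicator\<close>)
  have int: "set_integrable lebesgue {a..b} h"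
    unfolding set_integrable_def
  proof (rule integrableI_bounded)
    have "(\<integral>\<^sup>+x. ennreal (norm (indicator {a..b} x *\<^sub>R h x)) \<partial>lebesgue) \<le> sint {a<..<b} g"
      unfolding h_def
      by (rule nn_integral_mono) (auto split: split_indicator simp: ennreal_enn2real_if)
    then show "(\<integral>\<^sup>+x. ennreal (norm (indicator {a..b} x *\<^sub>R h x)) \<partial>lebesgue) < \<infinity>"
      using fin by auto
  qed (unfold h_def, measurable)
  then have io: "h integrable_on {a..b}"
    using set_borel_integral_eq_integral set_lebesgue_integral_eq_integral(1) by blast
  have cont: "continuous_on {a..b} (\<lambda>x. integral {a..x} h)"
    by (rule indefinite_integral_continuous_1[OF io])
  have val: "ennreal (integral {a..m} h) = sint {a<..<m} g" if m: "a \<le> m" "m \<le> b" for m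
  proof -
    have im: "set_integrable lebesgue {a..m} h"
      by (rule set_integrable_subset[OF int]) (use m in auto)
    have "integral {a..m} h = (LINT x:{a..m}|lebesgue. h x)"
      using set_lebesgue_integral_eq_integral(2)[OF im] by simp
    also have "ennreal \<dots> = (\<integral>\<^sup>+x. ennreal (indicator {a..m} x *\<^sub>R h x) \<partial>lebesgue)"
      unfolding set_lebesgue_integral_def
      by (rule nn_integral_eq_integral[symmetric])
         (use im in \<open>auto simp: set_integrable_def h_def split: split_indicator\<close>)
    also have "\<dots> = sint {a..m} (\<lambda>x. ennreal (h x))"
      by (rule nn_integral_cong) (auto split: split_indicator)
    finally show ?thesis
      using eq[OF m(2)] by (simp add: sint_remove_endpoints)
  qed
  have cfin: "c < top" using c fin by auto
  then obtain r where r: "c = ennreal r" "0 \<le> r" by (cases c) auto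
  have rb: "r \<le> integral {a..b} h"
  proof -
    have "0 \<le> integral {a..b} h"
      by (rule integral_nonneg[OF io]) (auto simp: h_def)
    moreover have "ennreal r \<le> ennreal (integral {a..b} h)"
      unfolding val[OF \<open>a \<le> b\<close> order_refl] r(1)[symmetric] by (rule c)
    ultimately show ?thesis
      by (simp only: ennreal_le_iff)
  qed
  obtain m where "a \<le> m" "m \<le> b" "integral {a..m} h = r"
    using IVT'[of "\<lambda>x. integral {a..x} h" a r b] rb r \<open>a \<le> b\<close> cont by auto
  then show thesis
    using that[of m] val[of m] r by auto
qed

text \<open>Cut at the point \<open>m\<close> where half of the mass has been collected. To the
  right of \<open>m\<close> the primitive is at least \<open>G / 2\<close>, and the mass left there
  is at least \<open>G / 2\<close> as well, so the right-hand integral is at least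
  \<open>(G / 2) powe s\<close>. No chain rule for the primitive enters.\<close>

lemma sint_powe_le:
  assumes [measurable]: "g \<in> borel_measurable lebesgue" and "a \<le> b" and fin: "sint {a<..<b} g < top"
    and s: "1 \<le> s"
  shows "sint {a<..<b} g powe s \<le> 2 powe s * sint {a<..<b} (\<lambda>t. sint {a<..<t} g powe (s - 1) * g t)"
proof -
  define G where "G = sint {a<..<b} g"
  have half: "G / 2 \<le> G"
    using fin unfolding G_def[symmetric] by (cases G) (auto simp: divide_ennreal simp flip: ennreal_numeral)
  obtain m where m: "a \<le> m" "m \<le> b" "sint {a<..<m} g = G / 2"
    using sint_IVT[OF assms(1-3), of "G / 2"] half G_def by metis
  have "G \<le> sint {a<..m} g + sint {m<..<b} g"
    unfolding G_def by (rule sint_Un_le) auto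
  then have "G / 2 \<le> sint {m<..<b} g"
    using m(3) fin unfolding sint_remove_endpoints G_def[symmetric]
    by (cases G; cases "sint {m<..<b} g") (auto simp: divide_ennreal simp flip: ennreal_numeral ennreal_plus)
  then have "(G / 2) powe (s - 1) * (G / 2) \<le> (G / 2) powe (s - 1) * sint {m<..<b} g"
    by (rule mult_left_mono) auto
  also have "\<dots> = sint {m<..<b} (\<lambda>t. (G / 2) powe (s - 1) * g t)"
    by (rule sint_cmult[symmetric]) auto
  also have "\<dots> \<le> sint {a<..<b} (\<lambda>t. sint {a<..<t} g powe (s - 1) * g t)"
    using m s by (intro sint_mono mult_right_mono powe_mono) (auto simp flip: m(3) intro!: sint_mono)
  finally have *: "(G / 2) powe s \<le> sint {a<..<b} (\<lambda>t. sint {a<..<t} g powe (s - 1) * g t)"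
    using powe_add[of "s - 1" 1 "G/2"] s by simp
  have "G = 2 * (G / 2)"
    by (cases G) (auto simp: divide_ennreal ennreal_top_divide ennreal_mult_top ennreal_mult[symmetric] simp flip: ennreal_numeral)
  then have "G powe s = 2 powe s * (G / 2) powe s"
    using s by (metis powe_mult order_trans zero_le_one)
  with * show ?thesis
    unfolding G_def[symmetric] by (simp add: mult_left_mono)
qed

text \<open>Primitives, tails and suprema of the kernel are monotone in the variable of integration;
  their measurability is obtained from this.\<close>

lemma interval_measurable_ennreal:
  fixes g :: "real \<Rightarrow> ennreal"
  assumes "\<And>y. is_interval {x. g x < y}"
  shows "g \<in> borel_measurable borel"
  by (rule borel_measurableI_less) (use assms real_interval_borel_measurable in auto)

lemma mono_measurable_ennreal:
  fixes g :: "real \<Rightarrow> ennreal"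
  assumes "\<And>x y. x \<le> y \<Longrightarrow> g x \<le> g y"
  shows "g \<in> borel_measurable borel"
  by (rule interval_measurable_ennreal) (auto simp: is_interval_1 intro: le_less_trans[OF assms])

lemma antimono_measurable_ennreal:
  fixes g :: "real \<Rightarrow> ennreal"
  assumes "\<And>x y. x \<le> y \<Longrightarrow> g y \<le> g x"
  shows "g \<in> borel_measurable borel"
  by (rule interval_measurable_ennreal) (auto simp: is_interval_1 intro: le_less_trans[OF assms])

lemma borel_lebesgue_measurable: "g \<in> borel_measurable borel \<Longrightarrow> g \<in> borel_measurable lebesgue"
  by (simp add: measurable_completion)

subsection \<open>Covering sequences and finite sets of points\<close>

text \<open>The common shape of \<open>D1\<close> and \<open>D2\<close>: \<Psi> receives the
  interval to the left of a point, the point itself, and the interval to its right.\<close>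

definition covering_sup :: "(real set \<Rightarrow> real \<Rightarrow> real set \<Rightarrow> ennreal) \<Rightarrow> ennreal" where
  "covering_sup \<Psi> =
     (SUP (kmin, kmax, t) \<in> {(kmin, kmax, t). covering_sequence kmin kmax t}.
        \<Sum>k\<in>{kmin<..<kmax}.
          \<Psi> (einterval (t (k - 1)) (t k)) (real_of_ereal (t k)) (einterval (t k) (t (k + 1))))"

lemma covering_sup_upper:
  "covering_sequence kmin kmax t \<Longrightarrow>
   (\<Sum>k\<in>{kmin<..<kmax}.
      \<Psi> (einterval (t (k - 1)) (t k)) (real_of_ereal (t k)) (einterval (t k) (t (k + 1)))) \<le> covering_sup \<Psi>"
  unfolding covering_sup_def by (rule SUP_upper2[of "(kmin, kmax, t)"]) auto

lemma covering_sup_least: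
  assumes "\<And>kmin kmax t. covering_sequence kmin kmax t \<Longrightarrow>
   (\<Sum>k\<in>{kmin<..<kmax}.
      \<Psi> (einterval (t (k - 1)) (t k)) (real_of_ereal (t k)) (einterval (t k) (t (k + 1)))) \<le> X"
  shows "covering_sup \<Psi> \<le> X"
  unfolding covering_sup_def by (rule SUP_least) (use assms in auto)

text \<open>Sorted and completed by \<open>0\<close> and \<infinity>, the set \<open>S\<close>
  becomes a covering sequence. The hypotheses \<open>sep\<close> say that the prescribed intervals
  do not reach past neighbouring points; they therefore lie in the gaps, and \<Psi> only grows when
  they are enlarged to the gaps.\<close>

lemma covering_sum_le:
  fixes a :: "real \<Rightarrow> real" and b :: "real \<Rightarrow> ereal"
  assumes fin: "finite S" and pos: "\<And>x. x \<in> S \<Longrightarrow> 0 < x" and a: "\<And>x. x \<in> S \<Longrightarrow> 0 \<le> a x"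
    and sep: "\<And>x y. x \<in> S \<Longrightarrow> y \<in> S \<Longrightarrow> x < y \<Longrightarrow> x \<le> a y"
      "\<And>x y. x \<in> S \<Longrightarrow> y \<in> S \<Longrightarrow> x < y \<Longrightarrow> b x \<le> ereal y"
    and mono: "\<And>A A' x B B'. A \<subseteq> A' \<Longrightarrow> B \<subseteq> B' \<Longrightarrow> \<Psi> A x B \<le> \<Psi> A' x B'"
  shows "(\<Sum>x\<in>S. \<Psi> {a x<..<x} x (einterval x (b x))) \<le> covering_sup \<Psi>"
proof (cases "S = {}")
  case False
  define l where "l = sorted_list_of_set S"
  define n where "n = card S"
  have n: "1 \<le> n" using False fin by (simp add: n_def Suc_le_eq card_gt_0_iff)
  have len: "length l = n" by (simp add: l_def n_def)
  have setl: "set l = S" using fin by (simp add: l_def)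
  have strict: "l ! i < l ! j" if "i < j" "j < n" for i j
    using that len strict_sorted_list_of_set[of S] by (auto simp: l_def sorted_wrt_iff_nth_less)
  have lS: "l ! i \<in> S" if "i < n" for i using that len setl by (metis nth_mem)
  \<comment> \<open>Index 0 is occupied by the added point \<open>0\<close>, so entry
    \<open>i\<close> of the list has index \<open>i + 1\<close>.\<close>
  define t where "t = (\<lambda>i::int. if i \<le> 0 then 0 else if int n < i then \<infinity> else ereal (l ! nat (i - 1)))"
  have t_mid: "t (int i + 1) = ereal (l ! i)" if "i < n" for i
    using that by (auto simp: t_def)
  have cov: "covering_sequence 0 (int n + 1) t"
    unfolding covering_sequence_def
  proof (intro conjI ballI)
    fix k assume k: "k \<in> {0..<int n + 1}"
    then obtain i where i: "k = int i" "i \<le> n" by (metis atLeastLessThan_iff nonneg_int_cases zle_add1_eq_le of_nat_le_iff)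
    show "t k < t (k + 1)"
    proof (cases i)
      case 0
      then show ?thesis using t_mid[of 0] n i pos[OF lS[of 0]] by (auto simp: t_def)
    next
      case (Suc j)
      have "t k = ereal (l ! j)" using t_mid[of j] i Suc by (simp add: add.commute)
      moreover have "t (k + 1) = (if i < n then ereal (l ! i) else \<infinity>)"
        using t_mid[of i] i by (auto simp: t_def)
      ultimately show ?thesis using strict[of j i] Suc by auto
    qed
  qed (use n in \<open>auto simp: t_def\<close>)
  have bij: "bij_betw (\<lambda>i. l ! i) {..<n} S"
    by (rule bij_betw_nth) (simp_all add: len setl, simp add: l_def)
  have "(\<Sum>x\<in>S. \<Psi> {a x<..<x} x (einterval x (b x)))
      = (\<Sum>i<n. \<Psi> {a (l ! i)<..<l ! i} (l ! i) (einterval (l ! i) (b (l ! i))))"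
    by (rule sum.reindex_bij_betw[OF bij, symmetric])
  also have "\<dots> \<le> (\<Sum>i<n. \<Psi> (einterval (t (int i + 1 - 1)) (t (int i + 1))) (real_of_ereal (t (int i + 1)))
                      (einterval (t (int i + 1)) (t (int i + 1 + 1))))"
  proof (rule sum_mono)
    fix i assume "i \<in> {..<n}"
    then have i: "i < n" by simp
    have "t (int i) \<le> ereal (a (l ! i))"
    proof (cases i)
      case 0
      then show ?thesis using a[OF lS[OF i]] by (simp add: t_def)
    next
      case (Suc j)
      then have "t (int i) = ereal (l ! j)" using t_mid[of j] i by (simp add: add.commute)
      moreover have "l ! j \<le> a (l ! i)"
        using Suc i by (intro sep(1) lS strict) auto
      ultimately show ?thesis by simp
    qed
    moreover have "b (l ! i) \<le> t (int i + 1 + 1)"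
    proof (cases "i + 1 < n")
      case True
      then have "t (int i + 1 + 1) = ereal (l ! (i + 1))" using t_mid[of "i + 1"] by (simp add: add.commute)
      moreover have "b (l ! i) \<le> ereal (l ! (i + 1))"
        using True by (intro sep(2) lS strict) auto
      ultimately show ?thesis by simp
    qed (auto simp: t_def)
    ultimately show "\<Psi> {a (l ! i)<..<l ! i} (l ! i) (einterval (l ! i) (b (l ! i)))
      \<le> \<Psi> (einterval (t (int i + 1 - 1)) (t (int i + 1))) (real_of_ereal (t (int i + 1)))
                      (einterval (t (int i + 1)) (t (int i + 1 + 1)))"
      unfolding t_mid[OF i]
      by (auto intro!: mono simp: einterval_def intro: le_less_trans less_le_trans)
  qed
  also have "\<dots> = (\<Sum>k\<in>{0<..<int n + 1}.
        \<Psi> (einterval (t (k - 1)) (t k)) (real_of_ereal (t k)) (einterval (t k) (t (k + 1))))"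
    by (rule sum.reindex_bij_witness[where i = "\<lambda>k. nat (k - 1)" and j = "\<lambda>i. int i + 1"]) auto
  also have "\<dots> \<le> covering_sup \<Psi>"
    by (rule covering_sup_upper[OF cov])
  finally show ?thesis .
qed simp

lemma covering_sequence_strict:
  assumes "covering_sequence kmin kmax t" "kmin \<le> i" "i < j" "j \<le> kmax"
  shows "t i < t j"
proof -
  have "j \<le> kmax \<longrightarrow> t i < t j"
    using \<open>i < j\<close>
  proof (induction j rule: int_gr_induct)
    case base
    then show ?case using assms by (auto simp: covering_sequence_def)
  next
    case (step j)
    have "t j < t (j + 1)" if "j + 1 \<le> kmax"
      using that assms step(1) by (auto simp: covering_sequence_def)
    then show ?case using step(2) by (auto intro: less_trans)
  qed
  then show ?thesis using assms by simp
qed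

lemma covering_sequence_real:
  assumes "covering_sequence kmin kmax t" "kmin < k" "k < kmax"
  shows "t k = ereal (real_of_ereal (t k))" "0 < real_of_ereal (t k)"
proof -
  have "0 < t k" "t k < \<infinity>"
    using covering_sequence_strict[OF assms(1), of kmin k] covering_sequence_strict[OF assms(1), of k kmax] assms
    by (auto simp: covering_sequence_def)
  then show "t k = ereal (real_of_ereal (t k))" "0 < real_of_ereal (t k)"
    by (cases "t k"; auto)+
qed

subsection \<open>Grouping points by the level of a nonincreasing function\<close>

text \<open>The value \<open>e x\<close> is the last point on the level of \<open>x\<close>. Keeping only every second level makes
  the values at different representatives decrease by the full factor \<open>\<rho>\<close>.\<close>

definition level_reps :: "(real \<Rightarrow> ennreal) \<Rightarrow> real \<Rightarrow> real set \<Rightarrow> (real \<Rightarrow> real) \<Rightarrow> bool" where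
  "level_reps Q \<rho> T e \<longleftrightarrow> e ` T \<subseteq> T \<and> (\<forall>x\<in>T. x \<le> e x \<and> Q x \<le> ennreal \<rho> * Q (e x)) \<and>
     (\<forall>x\<in>T. \<forall>y\<in>T. e x < e y \<longrightarrow> e x < y \<and> ennreal \<rho> * Q (e y) \<le> Q (e x))"

lemma level_grouping:
  fixes S :: "real set" and Q :: "real \<Rightarrow> ennreal"
  assumes fin: "finite S" and lam: "1 < \<rho>" and Q: "\<And>x. x \<in> S \<Longrightarrow> 0 < Q x \<and> Q x < top"
    and anti: "\<And>x y. x \<in> S \<Longrightarrow> y \<in> S \<Longrightarrow> x \<le> y \<Longrightarrow> Q y \<le> Q x"
  obtains A B e where "S = A \<union> B" "A \<inter> B = {}" "level_reps Q \<rho> A e" "level_reps Q \<rho> B e"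
proof -
  define l where "l = (\<lambda>x. \<lfloor>log \<rho> (enn2real (Q x))\<rfloor>)"
  define e where "e = (\<lambda>x. Max {y \<in> S. l y = l x})"
  have qpos: "0 < enn2real (Q x)" and qe: "Q x = ennreal (enn2real (Q x))" if "x \<in> S" for x
    using Q[OF that] by (auto simp: enn2real_positive_iff)
  have low: "\<rho> powr l x \<le> enn2real (Q x)" if "x \<in> S" for x
    using lam qpos[OF that] by (simp add: l_def flip: le_log_iff)
  have up: "enn2real (Q x) < \<rho> powr (l x + 1)" if "x \<in> S" for x
    using lam qpos[OF that] by (simp add: l_def flip: log_less_iff)
  have lanti: "l y \<le> l x" if "x \<in> S" "y \<in> S" "x \<le> y" for x y
    unfolding l_def using lam qpos[OF that(1)] qpos[OF that(2)] anti[OF that] Q[OF that(1)]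
    by (intro floor_mono) (simp add: enn2real_mono)
  have e: "e x \<in> S \<and> l (e x) = l x \<and> x \<le> e x" if "x \<in> S" for x
    using Max_in[of "{y \<in> S. l y = l x}"] Max_ge[of "{y \<in> S. l y = l x}" x] fin that by (auto simp: e_def)
  have e_cong: "e x = e y" if "l x = l y" for x y using that by (simp add: e_def)
  have reps: "level_reps Q \<rho> {x \<in> S. l x mod 2 = c} e" for c
    unfolding level_reps_def
  proof (intro conjI ballI impI)
    show "e ` {x \<in> S. l x mod 2 = c} \<subseteq> {x \<in> S. l x mod 2 = c}" using e by auto
    fix x assume "x \<in> {x \<in> S. l x mod 2 = c}"
    then have x: "x \<in> S" "l x mod 2 = c" by auto
    show "x \<le> e x" using e[OF x(1)] by simp
    have "enn2real (Q x) \<le> \<rho> * enn2real (Q (e x))"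
    proof -
      have "enn2real (Q x) \<le> \<rho> * \<rho> powr l x"
        using up[OF x(1)] lam by (simp add: powr_add mult.commute)
      also have "\<dots> \<le> \<rho> * enn2real (Q (e x))"
        using low[of "e x"] e[OF x(1)] lam by (intro mult_left_mono) auto
      finally show ?thesis .
    qed
    then have "ennreal (enn2real (Q x)) \<le> ennreal (\<rho> * enn2real (Q (e x)))" by (rule ennreal_leI)
    then show "Q x \<le> ennreal \<rho> * Q (e x)"
      using qe[OF x(1)] qe[of "e x"] e[OF x(1)] lam by (simp add: ennreal_mult)
    fix y assume "y \<in> {x \<in> S. l x mod 2 = c}"
    then have y: "y \<in> S" "l y mod 2 = c" by auto
    assume less: "e x < e y"
    have "l (e y) \<le> l (e x)" using lanti[of "e x" "e y"] less e[OF x(1)] e[OF y(1)] by simp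
    then have "l y \<le> l x" using e[OF x(1)] e[OF y(1)] by simp
    moreover have "l y \<noteq> l x" using e_cong[of x y] less by auto
    \<comment> \<open>Distinct levels of equal parity differ by at least two. One level may be lost
      because \<open>Q\<close> varies by a factor up to \<rho> inside a level; the other leaves the
      full factor \<rho>.\<close>
    ultimately have l2: "l y + 2 \<le> l x" using x(2) y(2) by presburger
    show "e x < y"
    proof (rule ccontr)
      assume "\<not> e x < y"
      then have "l (e x) \<le> l y" using lanti[of y "e x"] e[OF x(1)] y by simp
      then show False using e[OF x(1)] l2 by simp
    qed
    have "\<rho> * enn2real (Q (e y)) \<le> \<rho> * \<rho> powr (l y + 1)"
      using up[of "e y"] e[OF y(1)] lam by (intro mult_left_mono) auto
    also have "\<dots> = \<rho> powr (l y + 2)" using lam by (simp add: powr_add mult_ac power2_eq_square)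
    also have "\<dots> \<le> \<rho> powr l x" using l2 lam by (intro powr_mono) auto
    also have "\<dots> \<le> enn2real (Q (e x))" using low[of "e x"] e[OF x(1)] by simp
    finally have "ennreal (\<rho> * enn2real (Q (e y))) \<le> ennreal (enn2real (Q (e x)))" by (rule ennreal_leI)
    then show "ennreal \<rho> * Q (e y) \<le> Q (e x)"
      using qe[of "e x"] qe[of "e y"] e[OF x(1)] e[OF y(1)] lam by (simp add: ennreal_mult)
  qed
  have "S = {x \<in> S. l x mod 2 = 0} \<union> {x \<in> S. l x mod 2 = 1}" by auto
  then show thesis
    by (rule that[OF _ _ reps reps]) auto
qed

lemma sum_level_reps:
  "finite T \<Longrightarrow> (\<Sum>x\<in>T. h x) = (\<Sum>y\<in>e ` T. \<Sum>x\<in>{x \<in> T. e x = y}. h x :: ennreal)"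
  by (rule sum.image_gen)

subsection \<open>Regular kernels\<close>

text \<open>For points listed by an index, such as a decreasing sequence, whose neighbours are
  described by shifting the index. The inverse of \<open>s\<close> turns such data into functions of
  the point.\<close>

lemma covering_sum_le_indexed:
  fixes s a :: "'i \<Rightarrow> real" and b :: "'i \<Rightarrow> ereal"
  assumes fin: "finite I" and inj: "inj_on s I" and pos: "\<And>i. i \<in> I \<Longrightarrow> 0 < s i" and a: "\<And>i. i \<in> I \<Longrightarrow> 0 \<le> a i"
    and sep: "\<And>i j. i \<in> I \<Longrightarrow> j \<in> I \<Longrightarrow> s i < s j \<Longrightarrow> s i \<le> a j"
      "\<And>i j. i \<in> I \<Longrightarrow> j \<in> I \<Longrightarrow> s i < s j \<Longrightarrow> b i \<le> ereal (s j)"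
    and mono: "\<And>A A' x B B'. A \<subseteq> A' \<Longrightarrow> B \<subseteq> B' \<Longrightarrow> \<Psi> A x B \<le> \<Psi> A' x B'"
  shows "(\<Sum>i\<in>I. \<Psi> {a i<..<s i} (s i) (einterval (s i) (b i))) \<le> covering_sup \<Psi>"
proof -
  define f where "f = the_inv_into I s"
  have f: "f (s i) = i" if "i \<in> I" for i using inj that by (simp add: f_def the_inv_into_f_f)
  have "(\<Sum>i\<in>I. \<Psi> {a i<..<s i} (s i) (einterval (s i) (b i)))
      = (\<Sum>x\<in>s ` I. \<Psi> {(a \<circ> f) x<..<x} x (einterval x ((b \<circ> f) x)))"
    by (subst sum.reindex[OF inj]) (auto simp: f)
  also have "\<dots> \<le> covering_sup \<Psi>"
    by (rule covering_sum_le) (use assms f in auto)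
  finally show ?thesis .
qed

text \<open>The triangle inequality is required for coinciding points too, which is where a constant
  of at least 1 comes in. The kernel is total on the line, so monotonicity carries no side
  conditions.\<close>

locale kernel =
  fixes \<kappa> :: "real \<Rightarrow> real \<Rightarrow> ennreal" and \<theta> :: real
  assumes theta: "1 \<le> \<theta>"
    and antimono: "x \<le> y \<Longrightarrow> \<kappa> y z \<le> \<kappa> x z"
    and mono: "y \<le> z \<Longrightarrow> \<kappa> x y \<le> \<kappa> x z"
    and finite: "\<kappa> x y < top"
    and triangle: "x \<le> y \<Longrightarrow> y \<le> z \<Longrightarrow> \<kappa> x z \<le> ennreal \<theta> * (\<kappa> x y + \<kappa> y z)"

text \<open>The constant of the triangle inequality for the \<open>s\<close>th power of the kernel:
  \<theta> from the kernel, 2 from \<open>powe_add_le\<close>.\<close>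

definition tri :: "real \<Rightarrow> real \<Rightarrow> ennreal" where
  "tri \<theta> s = (2 * ennreal \<theta>) powe s"

lemma one_le_powe: "1 \<le> x \<Longrightarrow> 0 \<le> a \<Longrightarrow> 1 \<le> x powe a"
  using powe_mono[of 1 x a] by simp

lemma tri_less_top: "0 \<le> s \<Longrightarrow> tri \<theta> s < top"
  by (auto simp: tri_def ennreal_mult_less_top intro!: powe_less_top)

lemma one_le_tri:
  assumes "1 \<le> \<theta>" "0 \<le> s"
  shows "1 \<le> tri \<theta> s"
proof -
  have "1 * 1 \<le> 2 * ennreal \<theta>"
    using assms by (intro mult_mono) (auto simp: one_le_numeral)
  then show ?thesis using assms by (simp add: tri_def one_le_powe)
qed

context kernel
begin

lemma triangle_powe:
  assumes "x \<le> y" "y \<le> z" "0 \<le> s"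
  shows "\<kappa> x z powe s \<le> tri \<theta> s * (\<kappa> x y powe s + \<kappa> y z powe s)"
proof -
  have "\<kappa> x z powe s \<le> (ennreal \<theta> * (\<kappa> x y + \<kappa> y z)) powe s"
    by (intro powe_mono triangle assms)
  also have "\<dots> \<le> ennreal \<theta> powe s * (2 powe s * (\<kappa> x y powe s + \<kappa> y z powe s))"
    by (simp add: powe_mult powe_add_le assms mult_left_mono)
  also have "\<dots> = tri \<theta> s * (\<kappa> x y powe s + \<kappa> y z powe s)"
    by (simp add: tri_def powe_mult assms mult_ac)
  finally show ?thesis .
qed

lemma kernel_measurable [measurable]:
  "(\<lambda>x. \<kappa> x y) \<in> borel_measurable lebesgue" "\<kappa> x \<in> borel_measurable lebesgue"
  by (intro borel_lebesgue_measurable antimono_measurable_ennreal mono_measurable_ennreal antimono mono; assumption)+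

end

section \<open>Weighted kernels, kernel tails and the two local functionals\<close>

locale weighted_kernel = kernel +
  fixes w :: "real \<Rightarrow> ennreal" and q :: real
  assumes w_measurable [measurable]: "w \<in> borel_measurable lebesgue"
    and W_finite: "sint {0<..<t} w < top"
    and W_pos: "0 < t \<Longrightarrow> 0 < sint {0<..<t} w"
    and q_pos: "0 < q"
begin

definition W :: "real \<Rightarrow> ennreal" where "W t = sint {0<..<t} w"

definition wk :: "real set \<Rightarrow> real \<Rightarrow> ennreal" where
  "wk A x = sint A (\<lambda>t. w t * \<kappa> t x powe q)"

definition ktail :: "real \<Rightarrow> (real \<Rightarrow> ennreal) \<Rightarrow> real \<Rightarrow> ennreal" where
  "ktail a \<phi> t = sint {t<..} (\<lambda>y. \<kappa> t y powe a * \<phi> y)"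

text \<open>At \<open>\<alpha> = r / q\<close>, \<open>\<beta> = r / p'\<close>,
  \<open>a = p'\<close> and \<open>\<phi> = v powe (1 - p')\<close> these are the terms of
  \<open>D1\<close>, and those of \<open>\<Psi>2\<close> the terms of \<open>D2\<close>. At
  \<open>\<alpha> = 1\<close>, \<open>\<beta> = q\<close>, \<open>a = 1\<close> and
  \<open>\<phi> = f\<close> both discretise the left-hand side of the Hardy inequality.\<close>

definition \<Psi>1 :: "real \<Rightarrow> real \<Rightarrow> real \<Rightarrow> (real \<Rightarrow> ennreal) \<Rightarrow> real set \<Rightarrow> real \<Rightarrow> real set \<Rightarrow> ennreal" where
  "\<Psi>1 \<alpha> \<beta> a \<phi> A x B = sint A w powe \<alpha> * sint B (\<lambda>y. \<kappa> x y powe a * \<phi> y) powe \<beta>"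

definition \<Psi>2 :: "real \<Rightarrow> real \<Rightarrow> (real \<Rightarrow> ennreal) \<Rightarrow> real set \<Rightarrow> real \<Rightarrow> real set \<Rightarrow> ennreal" where
  "\<Psi>2 \<alpha> \<beta> \<phi> A x B = wk A x powe \<alpha> * sint B \<phi> powe \<beta>"

lemma W_mono: "s \<le> t \<Longrightarrow> W s \<le> W t"
  unfolding W_def by (rule sint_mono) auto

lemma W_less_top: "W t < top"
  unfolding W_def by (rule W_finite)

lemma W_measurable [measurable]: "W \<in> borel_measurable lebesgue"
  by (intro borel_lebesgue_measurable mono_measurable_ennreal W_mono)

lemma wk_mono:
  assumes "A \<subseteq> B" "x \<le> y"
  shows "wk A x \<le> wk B y"
  unfolding wk_def by (rule sint_mono) (use assms q_pos in \<open>auto intro!: mult_left_mono powe_mono mono\<close>)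

lemma wk_less_top: "wk {0<..<t} x < top"
proof -
  have "wk {0<..<t} x \<le> sint {0<..<t} (\<lambda>s. \<kappa> 0 x powe q * w s)"
    unfolding wk_def using q_pos
    by (intro sint_mono) (auto simp: mult.commute[of "w _"] intro!: mult_right_mono powe_mono antimono)
  also have "\<dots> = \<kappa> 0 x powe q * sint {0<..<t} w"
    by (rule sint_cmult) auto
  also have "\<dots> < top"
    using W_finite[of t] finite[of 0 x] q_pos by (auto simp: ennreal_mult_less_top intro!: powe_less_top)
  finally show ?thesis .
qed

lemma wk_Un_le:
  "A \<in> sets lebesgue \<Longrightarrow> B \<in> sets lebesgue \<Longrightarrow> C \<subseteq> A \<union> B \<Longrightarrow> wk C x \<le> wk A x + wk B x"
  unfolding wk_def by (rule sint_Un_le) auto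

lemma wk_triangle:
  assumes [measurable]: "A \<in> sets lebesgue" and "\<And>t. t \<in> A \<Longrightarrow> t \<le> y" "y \<le> z"
  shows "wk A z \<le> tri \<theta> q * (wk A y + sint A w * \<kappa> y z powe q)"
proof -
  have "wk A z \<le> sint A (\<lambda>t. tri \<theta> q * (w t * \<kappa> t y powe q + \<kappa> y z powe q * w t))"
    unfolding wk_def
  proof (rule sint_mono)
    fix t assume "t \<in> A"
    then have "w t * \<kappa> t z powe q \<le> w t * (tri \<theta> q * (\<kappa> t y powe q + \<kappa> y z powe q))"
      using assms q_pos by (intro mult_left_mono triangle_powe) auto
    then show "w t * \<kappa> t z powe q \<le> tri \<theta> q * (w t * \<kappa> t y powe q + \<kappa> y z powe q * w t)"
      by (simp add: algebra_simps)
  qed simp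
  also have "\<dots> = tri \<theta> q * (wk A y + \<kappa> y z powe q * sint A w)"
    unfolding wk_def by (simp add: sint_cmult sint_add)
  finally show ?thesis by (simp add: mult.commute)
qed

text \<open>\<open>A\<close> lies to the left of \<open>y\<close>, where the kernel is larger. This
  turns a product of mass and kernel jump back into an integral of the kind that occurs in
  \<open>\<Psi>2\<close>.\<close>

lemma sint_w_kernel_le_wk:
  assumes [measurable]: "A \<in> sets lebesgue" and "\<And>t. t \<in> A \<Longrightarrow> t \<le> y"
  shows "sint A w * \<kappa> y z powe q \<le> wk A z"
proof -
  have "sint A w * \<kappa> y z powe q = sint A (\<lambda>t. \<kappa> y z powe q * w t)"
    by (subst sint_cmult) (auto simp: mult.commute)
  also have "\<dots> \<le> wk A z"
    unfolding wk_def using assms q_pos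
    by (intro sint_mono) (auto simp: mult.commute[of "w _"] intro!: mult_right_mono powe_mono antimono)
  finally show ?thesis .
qed

lemma \<Psi>1_mono: "A \<subseteq> A' \<Longrightarrow> B \<subseteq> B' \<Longrightarrow> 0 \<le> \<alpha> \<Longrightarrow> 0 \<le> \<beta> \<Longrightarrow> \<Psi>1 \<alpha> \<beta> a \<phi> A x B \<le> \<Psi>1 \<alpha> \<beta> a \<phi> A' x B'"
  unfolding \<Psi>1_def by (intro mult_mono powe_mono; (rule sint_mono)?; simp)

lemma \<Psi>2_mono: "A \<subseteq> A' \<Longrightarrow> B \<subseteq> B' \<Longrightarrow> 0 \<le> \<alpha> \<Longrightarrow> 0 \<le> \<beta> \<Longrightarrow> \<Psi>2 \<alpha> \<beta> \<phi> A x B \<le> \<Psi>2 \<alpha> \<beta> \<phi> A' x B'"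
  unfolding \<Psi>2_def by (intro mult_mono powe_mono sint_mono wk_mono) auto

lemma ktail_antimono:
  assumes "s \<le> t" "0 \<le> a"
  shows "ktail a \<phi> t \<le> ktail a \<phi> s"
  unfolding ktail_def by (rule sint_mono) (use assms in \<open>auto intro!: mult_right_mono powe_mono antimono\<close>)

lemma ktail_measurable [measurable]: "0 \<le> a \<Longrightarrow> ktail a \<phi> \<in> borel_measurable lebesgue"
  by (intro borel_lebesgue_measurable antimono_measurable_ennreal ktail_antimono)

text \<open>Beyond \<open>z\<close> the kernel is split at \<open>z\<close> by the triangle
  inequality. The tail at \<open>z\<close> reappears on the right; this is the recursion used along
  the dyadic points.\<close>

lemma ktail_split:
  assumes [measurable]: "\<phi> \<in> borel_measurable lebesgue" and "x \<le> z" "0 \<le> a"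
  shows "ktail a \<phi> x \<le> sint {x<..<z} (\<lambda>y. \<kappa> x y powe a * \<phi> y)
           + tri \<theta> a * (\<kappa> x z powe a * sint {z<..} \<phi> + ktail a \<phi> z)"
proof -
  have "ktail a \<phi> x \<le> sint {x<..<z} (\<lambda>y. \<kappa> x y powe a * \<phi> y) + sint {z..} (\<lambda>y. \<kappa> x y powe a * \<phi> y)"
    unfolding ktail_def by (rule sint_Un_le) auto
  also have "sint {z..} (\<lambda>y. \<kappa> x y powe a * \<phi> y) = sint {z<..} (\<lambda>y. \<kappa> x y powe a * \<phi> y)"
    by (rule sint_remove_endpoints)
  also have "\<dots> \<le> sint {z<..} (\<lambda>y. tri \<theta> a * (\<kappa> x z powe a * \<phi> y + \<kappa> z y powe a * \<phi> y))"
  proof (rule sint_mono)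
    fix y assume "y \<in> {z<..}"
    then have "\<kappa> x y powe a * \<phi> y \<le> (tri \<theta> a * (\<kappa> x z powe a + \<kappa> z y powe a)) * \<phi> y"
      using assms by (intro mult_right_mono triangle_powe) auto
    then show "\<kappa> x y powe a * \<phi> y \<le> tri \<theta> a * (\<kappa> x z powe a * \<phi> y + \<kappa> z y powe a * \<phi> y)"
      by (simp add: algebra_simps)
  qed simp
  also have "\<dots> = tri \<theta> a * (\<kappa> x z powe a * sint {z<..} \<phi> + ktail a \<phi> z)"
    unfolding ktail_def by (simp add: sint_cmult sint_add)
  finally show ?thesis by simp
qed

lemma kernel_tail_le_ktail:
  assumes [measurable]: "\<phi> \<in> borel_measurable lebesgue" and "x \<le> z" "0 \<le> a"
  shows "\<kappa> x z powe a * sint {z<..} \<phi> \<le> ktail a \<phi> x"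
proof -
  have "\<kappa> x z powe a * sint {z<..} \<phi> = sint {z<..} (\<lambda>y. \<kappa> x z powe a * \<phi> y)"
    by (simp add: sint_cmult)
  also have "\<dots> \<le> ktail a \<phi> x"
    unfolding ktail_def using assms by (intro sint_mono) (auto intro!: mult_right_mono powe_mono mono)
  finally show ?thesis .
qed

text \<open>From one kept point to the next the tail at least halves, so at least half of it lives
  between them and the full tail can be replaced by a local integral. The other points of a level
  are not lost: their left-hand intervals are disjoint, and as \<alpha> is at least 1 their
  \<alpha>th powers are dominated by that of one interval reaching back to the previous kept
  point.\<close>

lemma sum_wk_tail_le:
  fixes a :: "real \<Rightarrow> real"
  assumes [measurable]: "\<phi> \<in> borel_measurable lebesgue" and \<alpha>: "1 \<le> \<alpha>" and \<beta>: "0 < \<beta>"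
    and fin: "finite S" and pos: "\<And>x. x \<in> S \<Longrightarrow> 0 < x" and a: "\<And>x. x \<in> S \<Longrightarrow> 0 \<le> a x"
    and sep: "\<And>x y. x \<in> S \<Longrightarrow> y \<in> S \<Longrightarrow> x < y \<Longrightarrow> x \<le> a y"
    and tail: "\<And>x. x \<in> S \<Longrightarrow> sint {x<..} \<phi> < top"
  shows "(\<Sum>x\<in>S. wk {a x<..<x} x powe \<alpha> * sint {x<..} \<phi> powe \<beta>) \<le> 2 * 4 powe \<beta> * covering_sup (\<Psi>2 \<alpha> \<beta> \<phi>)"
proof -
  define T where "T = (\<lambda>x. sint {x<..} \<phi>)"
  define h where "h = (\<lambda>x. wk {a x<..<x} x powe \<alpha> * T x powe \<beta>)"
  \<comment> \<open>Levels are defined by logarithms, so points with zero tail are set aside; their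
    terms vanish because \<beta> is positive.\<close>
  define S' where "S' = {x \<in> S. 0 < T x}"
  have T_anti: "T y \<le> T x" if "x \<le> y" for x y
    unfolding T_def by (rule sint_mono) (use that in auto)
  have finS': "finite S'" using fin by (simp add: S'_def)
  obtain A B e where AB: "S' = A \<union> B" "A \<inter> B = {}" "level_reps T 2 A e" "level_reps T 2 B e"
    using level_grouping[OF finS', of 2 T] T_anti tail unfolding S'_def T_def by auto
  have part: "(\<Sum>x\<in>R. h x) \<le> 4 powe \<beta> * covering_sup (\<Psi>2 \<alpha> \<beta> \<phi>)" if R: "level_reps T 2 R e" "R \<subseteq> S'" for R
  proof -
    \<comment> \<open>Previous and next kept point. Before the first one the default is 0; after the
      last one the infimum over the empty set gives \<infinity>.\<close>
    define a' where "a' = (\<lambda>y. Max (insert 0 {z \<in> e ` R. z < y}))"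
    define b where "b = (\<lambda>y. INF z\<in>{z \<in> e ` R. y < z}. ereal z)"
    have finR: "finite R" and RS: "R \<subseteq> S" using R(2) fin by (auto simp: S'_def intro: finite_subset)
    have eR: "e ` R \<subseteq> R" using R(1) by (auto simp: level_reps_def)
    have a'_ge: "0 \<le> a' y" "z \<in> e ` R \<Longrightarrow> z < y \<Longrightarrow> z \<le> a' y" for y z
      unfolding a'_def using finR by (auto intro!: Max_ge)
    have fibre: "(\<Sum>x\<in>{x \<in> R. e x = y}. h x) \<le> 4 powe \<beta> * \<Psi>2 \<alpha> \<beta> \<phi> {a' y<..<y} y (einterval y (b y))"
      if y: "y \<in> e ` R" for y
    proof -
      let ?F = "{x \<in> R. e x = y}"
      have F: "x \<le> y" "T x \<le> 2 * T y" "a' y \<le> a x" if "x \<in> ?F" for x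
      proof -
        show "x \<le> y" "T x \<le> 2 * T y" using that R(1) by (auto simp: level_reps_def)
        have "z \<le> a x" if "z \<in> e ` R" "z < y" for z
        proof -
          obtain z' where z': "z' \<in> R" "z = e z'" using \<open>z \<in> e ` R\<close> by auto
          then have "z < x" using R(1) \<open>x \<in> ?F\<close> \<open>z < y\<close> unfolding level_reps_def by blast
          then show ?thesis using sep[of z x] z' \<open>x \<in> ?F\<close> eR RS by auto
        qed
        then show "a' y \<le> a x"
          unfolding a'_def using a[of x] that RS finR by (subst Max_le_iff) auto
      qed
      have Ty: "T y \<le> 2 * sint (einterval y (b y)) \<phi>"
      proof (cases "{z \<in> e ` R. y < z} = {}")
        case True
        have "b y = \<infinity>" unfolding b_def True by (simp add: top_ereal_def)
        then show ?thesis by (simp add: T_def einterval_def greaterThan_def mult_2)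
      next
        case False
        define z where "z = Min {z \<in> e ` R. y < z}"
        have z: "z \<in> e ` R" "y < z" using Min_in[of "{z \<in> e ` R. y < z}"] False finR by (auto simp: z_def)
        have "ereal z \<le> b y"
          unfolding b_def using finR by (auto intro!: INF_greatest Min_le simp: z_def)
        then have sub: "{y<..<z} \<subseteq> einterval y (b y)" 
          by (auto simp: einterval_def intro: order.strict_trans2[where b = "ereal z"])
        have Tz: "2 * T z \<le> T y"
        proof -
          obtain y0 z0 where "y0 \<in> R" "z0 \<in> R" "y = e y0" "z = e z0" using y z by auto
          then show ?thesis using R(1) z(2) unfolding level_reps_def by auto
        qed
        have "T y \<le> sint {y<..<z} \<phi> + T z"
          unfolding T_def sint_remove_endpoints(4)[where a = z, symmetric] by (rule sint_Un_le) auto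
        then have "2 * T y \<le> 2 * (sint {y<..<z} \<phi> + T z)" by (rule mult_left_mono) simp
        also have "\<dots> = 2 * sint {y<..<z} \<phi> + 2 * T z" by (simp add: distrib_left)
        also have "\<dots> \<le> 2 * sint {y<..<z} \<phi> + T y" using Tz by (intro add_left_mono)
        finally have "2 * T y \<le> 2 * sint {y<..<z} \<phi> + T y" .
        moreover have "T y < top" using y eR RS tail by (auto simp: T_def)
        ultimately have "T y \<le> 2 * sint {y<..<z} \<phi>" by (rule ennreal_absorb[rotated])
        also have "\<dots> \<le> 2 * sint (einterval y (b y)) \<phi>" by (intro mult_left_mono sint_mono sub) auto
        finally show ?thesis .
      qed
      have "(\<Sum>x\<in>?F. h x) \<le> (\<Sum>x\<in>?F. wk {a x<..<x} y powe \<alpha> * (2 * T y) powe \<beta>)"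
        unfolding h_def using F \<alpha> \<beta> by (intro sum_mono mult_mono powe_mono wk_mono) auto
      also have "\<dots> = (\<Sum>x\<in>?F. wk {a x<..<x} y powe \<alpha>) * (2 * T y) powe \<beta>"
        by (simp add: sum_distrib_right)
      also have "\<dots> \<le> (\<Sum>x\<in>?F. wk {a x<..<x} y) powe \<alpha> * (2 * T y) powe \<beta>"
        by (intro mult_right_mono powe_sum_superadd \<alpha>) simp
      also have "\<dots> \<le> wk {a' y<..<y} y powe \<alpha> * (4 * sint (einterval y (b y)) \<phi>) powe \<beta>"
      proof (rule mult_mono; (rule powe_mono)?)
        show "(\<Sum>x\<in>?F. wk {a x<..<x} y) \<le> wk {a' y<..<y} y"
          unfolding wk_def
        proof (rule sint_sum_disjoint_le)
          show "disjoint_family_on (\<lambda>x. {a x<..<x}) ?F"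
            unfolding disjoint_family_on_def
          proof (intro ballI impI)
            fix x x' assume xx: "x \<in> ?F" "x' \<in> ?F" "x \<noteq> x'"
            then have "x \<le> a x' \<or> x' \<le> a x" using sep[of x x'] sep[of x' x] RS by (cases "x < x'") auto
            then show "{a x<..<x} \<inter> {a x'<..<x'} = {}" by auto
          qed
          show "(\<Union>x\<in>?F. {a x<..<x}) \<subseteq> {a' y<..<y}" using F by force
        qed (use finR in auto)
        \<comment> \<open>The factor 4 collects a 2 from the variation of the tail within a level
          and a 2 from keeping only the part before the next kept point.\<close>
        have "2 * T y \<le> 2 * (2 * sint (einterval y (b y)) \<phi>)" using Ty by (rule mult_left_mono) simp
        then show "2 * T y \<le> 4 * sint (einterval y (b y)) \<phi>" by (simp add: mult.assoc[symmetric])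
      qed (use \<alpha> \<beta> in auto)
      also have "\<dots> = 4 powe \<beta> * \<Psi>2 \<alpha> \<beta> \<phi> {a' y<..<y} y (einterval y (b y))"
        using \<beta> by (simp add: \<Psi>2_def powe_mult mult_ac)
      finally show ?thesis .
    qed
    have "(\<Sum>x\<in>R. h x) = (\<Sum>y\<in>e ` R. \<Sum>x\<in>{x \<in> R. e x = y}. h x)"
      by (rule sum_level_reps[OF finR])
    also have "\<dots> \<le> (\<Sum>y\<in>e ` R. 4 powe \<beta> * \<Psi>2 \<alpha> \<beta> \<phi> {a' y<..<y} y (einterval y (b y)))"
      by (intro sum_mono fibre)
    also have "\<dots> = 4 powe \<beta> * (\<Sum>y\<in>e ` R. \<Psi>2 \<alpha> \<beta> \<phi> {a' y<..<y} y (einterval y (b y)))"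
      by (simp add: sum_distrib_left)
    also have "\<dots> \<le> 4 powe \<beta> * covering_sup (\<Psi>2 \<alpha> \<beta> \<phi>)"
    proof (intro mult_left_mono covering_sum_le)
      show "b x \<le> ereal y" if "x \<in> e ` R" "y \<in> e ` R" "x < y" for x y
        unfolding b_def using that by (intro INF_lower) auto
    qed (use finR eR RS pos a'_ge \<alpha> \<beta> in \<open>auto intro!: \<Psi>2_mono\<close>)
    finally show ?thesis .
  qed
  have "(\<Sum>x\<in>S. h x) = (\<Sum>x\<in>S'. h x)"
    by (rule sum.mono_neutral_right[OF fin]) (use \<beta> in \<open>auto simp: S'_def h_def\<close>)
  also have "\<dots> = (\<Sum>x\<in>A. h x) + (\<Sum>x\<in>B. h x)"
    unfolding AB(1) using finS' AB by (intro sum.union_disjoint) auto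
  also have "\<dots> \<le> 4 powe \<beta> * covering_sup (\<Psi>2 \<alpha> \<beta> \<phi>) + 4 powe \<beta> * covering_sup (\<Psi>2 \<alpha> \<beta> \<phi>)"
    by (intro add_mono part AB) (use AB in auto)
  finally show ?thesis
    unfolding h_def T_def by (simp add: mult_2 distrib_right)
qed

lemma sum_wk_tail_le_indexed:
  fixes s a :: "'i \<Rightarrow> real"
  assumes "\<phi> \<in> borel_measurable lebesgue" "1 \<le> \<alpha>" "0 < \<beta>"
    and fin: "finite I" and inj: "inj_on s I" and pos: "\<And>i. i \<in> I \<Longrightarrow> 0 < s i" and a: "\<And>i. i \<in> I \<Longrightarrow> 0 \<le> a i"
    and sep: "\<And>i j. i \<in> I \<Longrightarrow> j \<in> I \<Longrightarrow> s i < s j \<Longrightarrow> s i \<le> a j"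
    and tail: "\<And>i. i \<in> I \<Longrightarrow> sint {s i<..} \<phi> < top"
  shows "(\<Sum>i\<in>I. wk {a i<..<s i} (s i) powe \<alpha> * sint {s i<..} \<phi> powe \<beta>)
           \<le> 2 * 4 powe \<beta> * covering_sup (\<Psi>2 \<alpha> \<beta> \<phi>)"
proof -
  define f where "f = the_inv_into I s"
  have f: "f (s i) = i" if "i \<in> I" for i using inj that by (simp add: f_def the_inv_into_f_f)
  have "(\<Sum>i\<in>I. wk {a i<..<s i} (s i) powe \<alpha> * sint {s i<..} \<phi> powe \<beta>)
      = (\<Sum>x\<in>s ` I. wk {(a \<circ> f) x<..<x} x powe \<alpha> * sint {x<..} \<phi> powe \<beta>)"
    by (subst sum.reindex[OF inj]) (auto simp: f)
  also have "\<dots> \<le> 2 * 4 powe \<beta> * covering_sup (\<Psi>2 \<alpha> \<beta> \<phi>)"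
    by (rule sum_wk_tail_le) (use assms f in auto)
  finally show ?thesis .
qed

end

subsection \<open>Discretising the Hardy integral\<close>

text \<open>The weights \<open>u\<close> decay so fast along the sequence that the recursive term of the bound for \<open>h\<close>
  is absorbed into the left-hand side.\<close>

lemma sum_absorb:
  fixes u h r :: "nat \<Rightarrow> ennreal"
  assumes step: "\<And>k. h (Suc k) \<le> c * (r k + h k)" and decay: "\<And>k. 2 * c * u (Suc k) \<le> u k"
    and zero: "h 0 = 0" and fin: "\<And>k. u k * h k < top"
  shows "(\<Sum>k<N. u (Suc k) * h (Suc k)) \<le> 2 * c * (\<Sum>k<N. u (Suc k) * r k)"
proof (rule ennreal_absorb)
  show "(\<Sum>k<N. u (Suc k) * h (Suc k)) < top" using fin by simp
  have "2 * (u (Suc k) * h (Suc k)) \<le> 2 * c * (u (Suc k) * r k) + u k * h k" for k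
  proof -
    have "2 * (u (Suc k) * h (Suc k)) \<le> 2 * (u (Suc k) * (c * (r k + h k)))"
      by (intro mult_left_mono step) auto
    also have "\<dots> = 2 * c * (u (Suc k) * r k) + (2 * c * u (Suc k)) * h k"
      by (simp add: algebra_simps)
    also have "\<dots> \<le> 2 * c * (u (Suc k) * r k) + u k * h k"
      by (intro add_left_mono mult_right_mono decay) auto
    finally show ?thesis .
  qed
  then have "2 * (\<Sum>k<N. u (Suc k) * h (Suc k)) \<le> (\<Sum>k<N. 2 * c * (u (Suc k) * r k) + u k * h k)"
    unfolding sum_distrib_left by (rule sum_mono)
  also have "\<dots> = 2 * c * (\<Sum>k<N. u (Suc k) * r k) + (\<Sum>k<N. u k * h k)"
    by (simp add: sum.distrib sum_distrib_left)
  \<comment> \<open>One more term is added at the top; as the term with index 0 vanishes, shifting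
    the index gives back exactly the left-hand side.\<close>
  also have "(\<Sum>k<N. u k * h k) \<le> (\<Sum>k<Suc N. u k * h k)"
    by simp
  also have "\<dots> = (\<Sum>k<N. u (Suc k) * h (Suc k))"
    by (subst sum.lessThan_Suc_shift) (simp add: zero)
  finally show "2 * (\<Sum>k<N. u (Suc k) * h (Suc k))
      \<le> 2 * c * (\<Sum>k<N. u (Suc k) * r k) + (\<Sum>k<N. u (Suc k) * h (Suc k))"
    by (simp add: add_left_mono)
qed

text \<open>\<open>4 powe \<beta>\<close> pays for distributing the power over three summands, by
  two uses of \<open>powe_add_le\<close>.\<close>

definition split_const :: "real \<Rightarrow> real \<Rightarrow> real \<Rightarrow> ennreal" where
  "split_const \<theta> a \<beta> = 4 powe \<beta> * tri \<theta> a powe \<beta>"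

lemma split_const_less_top: "0 \<le> a \<Longrightarrow> 0 \<le> \<beta> \<Longrightarrow> split_const \<theta> a \<beta> < top"
  by (auto simp: split_const_def ennreal_mult_less_top intro!: powe_less_top tri_less_top)

lemma split_const_le:
  assumes "1 \<le> \<theta>" "0 \<le> a" "0 \<le> \<beta>" "X \<le> A + tri \<theta> a * (B + C)"
  shows "X powe \<beta> \<le> split_const \<theta> a \<beta> * ((A powe \<beta> + B powe \<beta>) + C powe \<beta>)"
proof -
  have 1: "1 \<le> tri \<theta> a" using assms one_le_tri by blast
  have "X \<le> tri \<theta> a * (A + (B + C))"
    using assms(4) mult_right_mono[OF 1, of A] by (simp add: distrib_left add_mono order_trans)
  then have "X powe \<beta> \<le> tri \<theta> a powe \<beta> * (A + (B + C)) powe \<beta>"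
    using powe_mono[OF _ assms(3)] by (simp add: powe_mult[OF assms(3), symmetric])
  moreover have "(A + (B + C)) powe \<beta> \<le> 4 powe \<beta> * (A powe \<beta> + B powe \<beta> + C powe \<beta>)"
  proof -
    have "(A + (B + C)) powe \<beta> \<le> 2 powe \<beta> * (A powe \<beta> + 2 powe \<beta> * (B powe \<beta> + C powe \<beta>))"
      by (intro order_trans[OF powe_add_le[OF assms(3)]] mult_left_mono add_left_mono powe_add_le assms) auto
    also have "\<dots> \<le> 2 powe \<beta> * (2 powe \<beta> * A powe \<beta> + 2 powe \<beta> * (B powe \<beta> + C powe \<beta>))"
      using mult_right_mono[OF one_le_powe[of 2 \<beta>], of "A powe \<beta>"] assms
      by (intro mult_left_mono add_right_mono) (auto simp: one_le_numeral)
    also have "\<dots> = (2 * 2) powe \<beta> * (A powe \<beta> + B powe \<beta> + C powe \<beta>)"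
      unfolding powe_mult[OF assms(3)] by (simp only: algebra_simps)
    finally show ?thesis by simp
  qed
  ultimately have "X powe \<beta> \<le> tri \<theta> a powe \<beta> * (4 powe \<beta> * (A powe \<beta> + B powe \<beta> + C powe \<beta>))"
    by (meson mult_left_mono order_trans zero_le)
  then show ?thesis
    by (simp only: split_const_def mult_ac)
qed

text \<open>\<open>2 * split_const\<close> comes from the absorption and
  \<open>2 powe \<alpha>\<close> from replacing \<open>W\<close> by the mass of the last interval.
  In \<open>4 * 4 powe \<beta>\<close>, one factor 2 counts the parity classes of indices and
  \<open>2 * 4 powe \<beta>\<close> is the constant of \<open>sum_wk_tail_le\<close>.\<close>

definition hardy_sum_const :: "real \<Rightarrow> real \<Rightarrow> real \<Rightarrow> real \<Rightarrow> ennreal" where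
  "hardy_sum_const \<theta> \<alpha> \<beta> a = 2 * split_const \<theta> a \<beta> * (2 powe \<alpha> * (4 * 4 powe \<beta>))"

section \<open>Points at which the primitive of the weight is geometric\<close>

context weighted_kernel
begin

text \<open>The sequence is one-sided: it is used for \<phi> vanishing beyond \<open>n\<close>,
  where the tail is zero, so the recursion has a starting point. Below, the points approach
  0.\<close>

definition dyadic :: "real \<Rightarrow> real \<Rightarrow> (nat \<Rightarrow> real) \<Rightarrow> bool" where
  "dyadic \<Lambda> n x \<longleftrightarrow> x 0 = n \<and> (\<forall>k. 0 < x k \<and> x (Suc k) < x k \<and> W (x k) = ennreal \<Lambda> * W (x (Suc k))) \<and>
     (\<forall>t>0. \<exists>k. x k < t)"

lemma dyadic_exists:
  assumes "1 < \<Lambda>" "0 < n"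
  obtains x where "dyadic \<Lambda> n x"
proof -
  define V where "V = enn2real (W n)"
  have V: "0 < V" "W n = ennreal V"
    using W_pos[OF \<open>0 < n\<close>] W_less_top[of n] by (auto simp: V_def enn2real_positive_iff W_def)
  have "\<exists>m. 0 \<le> m \<and> m \<le> n \<and> W m = ennreal (V / \<Lambda> ^ k)" for k
  proof (rule sint_IVT[of w 0 n "ennreal (V / \<Lambda> ^ k)"])
    have "1 \<le> \<Lambda> ^ k" using assms by (simp add: one_le_power)
    then show "ennreal (V / \<Lambda> ^ k) \<le> sint {0<..<n} w"
      using V assms unfolding W_def[symmetric] by (auto intro!: ennreal_leI simp: divide_le_eq)
  qed (use assms W_finite in \<open>auto simp: W_def\<close>)
  then obtain y where y: "0 \<le> y k" "W (y k) = ennreal (V / \<Lambda> ^ k)" for k by metis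
  \<comment> \<open>\<open>W\<close> may be constant to the left of \<open>n\<close>, so the point
    chosen for \<open>k = 0\<close> by the intermediate value theorem could lie below
    \<open>n\<close>; the start is set to \<open>n\<close> itself.\<close>
  define x where "x k = (if k = 0 then n else y k)" for k
  have Wx: "W (x k) = ennreal (V / \<Lambda> ^ k)" for k using y V by (simp add: x_def)
  have less: "s < t" if "W s < W t" for s t
    using that W_mono[of t s] by (meson leD not_le)
  have pos: "0 < x k" for k
  proof -
    have "0 < W (x k)" using V assms by (simp add: Wx)
    then show ?thesis using W_mono[of "x k" 0] by (cases "0 < x k") (auto simp: W_def)
  qed
  have "x (Suc k) < x k" for k
    by (rule less) (use V assms in \<open>auto simp: Wx ennreal_less_iff divide_simps intro!: mult_strict_left_mono\<close>)
  moreover have "W (x k) = ennreal \<Lambda> * W (x (Suc k))" for k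
    unfolding Wx using V assms by (simp add: ennreal_mult[symmetric])
  \<comment> \<open>Positivity of \<open>W t\<close> is decisive here: the values of
    \<open>W\<close> at the points tend to 0 and eventually drop below it.\<close>
  moreover have "\<exists>k. x k < t" if "0 < t" for t
  proof -
    have Wt: "0 < W t" using W_pos[OF that] by (simp add: W_def)
    obtain r where r: "W t = ennreal r" "0 < r" using Wt W_less_top[of t] by (cases "W t") auto
    obtain k where "V / r < \<Lambda> ^ k" using real_arch_pow[OF assms(1)] by blast
    then have "V / \<Lambda> ^ k < r" using r assms V by (simp add: divide_simps mult.commute)
    then have "W (x k) < W t" using r V assms by (simp add: Wx ennreal_less_iff)
    then show ?thesis using less by blast
  qed
  ultimately have "dyadic \<Lambda> n x" using pos by (auto simp: dyadic_def x_def)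
  then show thesis by (rule that)
qed

lemma dyadicD:
  assumes "dyadic \<Lambda> n x"
  shows "x 0 = n" "0 < x k" "x (Suc k) < x k" "W (x k) = ennreal \<Lambda> * W (x (Suc k))" "0 < t \<Longrightarrow> \<exists>k. x k < t"
  using assms unfolding dyadic_def by blast+

lemma dyadic_antimono: "dyadic \<Lambda> n x \<Longrightarrow> i \<le> j \<Longrightarrow> x j \<le> x i"
  by (rule lift_Suc_antimono_le) (auto intro: less_imp_le dyadicD(3))

lemma dyadic_strict:
  assumes "dyadic \<Lambda> n x" "i < j"
  shows "x j < x i"
proof -
  have "x j \<le> x (Suc i)" using assms by (intro dyadic_antimono) auto
  also have "\<dots> < x i" using assms(1) by (rule dyadicD)
  finally show ?thesis .
qed

lemma dyadic_less_iff: "dyadic \<Lambda> n x \<Longrightarrow> x i < x j \<longleftrightarrow> j < i"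
  using dyadic_strict dyadic_antimono by (meson leD not_le)

lemma dyadic_inj: "dyadic \<Lambda> n x \<Longrightarrow> inj x"
  by (metis dyadic_less_iff injI less_irrefl linorder_neqE_nat)

text \<open>With a ratio of at least 2, at most half of the mass up to \<open>x k\<close> lies below
  the next point, so the last interval carries at least half of it.\<close>

lemma dyadic_W_le:
  assumes x: "dyadic \<Lambda> n x" and "2 \<le> \<Lambda>"
  shows "W (x k) \<le> 2 * sint {x (Suc k)<..<x k} w"
proof (rule ennreal_absorb)
  have "W (x k) \<le> sint {0<..x (Suc k)} w + sint {x (Suc k)<..<x k} w"
    unfolding W_def by (rule sint_Un_le) auto
  then have "W (x k) \<le> W (x (Suc k)) + sint {x (Suc k)<..<x k} w"
    by (simp add: sint_remove_endpoints W_def)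
  then have *: "2 * W (x k) \<le> 2 * W (x (Suc k)) + 2 * sint {x (Suc k)<..<x k} w"
    by (metis distrib_left mult_left_mono zero_le)
  have "2 * W (x (Suc k)) \<le> W (x k)"
  proof -
    have "(2::ennreal) \<le> ennreal \<Lambda>" using ennreal_leI[OF assms(2)] by simp
    then have "2 * W (x (Suc k)) \<le> ennreal \<Lambda> * W (x (Suc k))" by (rule mult_right_mono) simp
    then show ?thesis using dyadicD(4)[OF x, of k] by simp
  qed
  then show "2 * W (x k) \<le> 2 * sint {x (Suc k)<..<x k} w + W (x k)"
    by (subst add.commute) (rule order_trans[OF * add_right_mono])
qed (rule W_less_top)

lemma dyadic_W_powe:
  "dyadic \<Lambda> n x \<Longrightarrow> 0 \<le> \<alpha> \<Longrightarrow> W (x k) powe \<alpha> = ennreal \<Lambda> powe \<alpha> * W (x (Suc k)) powe \<alpha>"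
  by (metis dyadicD(4) powe_mult)

text \<open>The intervals between the points exhaust the half-line below \<open>n\<close> up to a
  null set, because the points tend to 0.\<close>

lemma dyadic_integral_le:
  assumes x: "dyadic \<Lambda> n x" and [measurable]: "g \<in> borel_measurable lebesgue"
    and step: "\<And>k. sint {x (Suc k)<..<x k} g \<le> y k" and sum: "\<And>N. (\<Sum>k<N. y k) \<le> X"
  shows "sint {0<..<n} g \<le> X"
proof -
  have [measurable]: "{x N<..<n} \<in> sets lebesgue" for N by auto
  have part: "sint {x N<..<n} g \<le> (\<Sum>k<N. y k)" for N
  proof (induction N)
    case 0
    then show ?case using dyadicD(1)[OF x] by simp
  next
    case (Suc N)
    have "sint {x (Suc N)<..<n} g \<le> sint {x (Suc N)<..x N} g + sint {x N<..<n} g"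
      by (rule sint_Un_le) auto
    also have "\<dots> \<le> y N + (\<Sum>k<N. y k)"
      unfolding sint_remove_endpoints by (intro add_mono step Suc)
    finally show ?case by (simp add: add.commute)
  qed
  have "sint {0<..<n} g = (\<integral>\<^sup>+t. (SUP N. g t * indicator {x N<..<n} t) \<partial>lebesgue)"
  proof (rule nn_integral_cong)
    fix t
    show "g t * indicator {0<..<n} t = (SUP N. g t * indicator {x N<..<n} t)"
    proof (rule antisym)
      show "(SUP N. g t * indicator {x N<..<n} t) \<le> g t * indicator {0<..<n} t"
        using dyadicD(2)[OF x] by (intro SUP_least mult_left_mono) (auto split: split_indicator intro: less_trans)
      show "g t * indicator {0<..<n} t \<le> (SUP N. g t * indicator {x N<..<n} t)"
      proof (cases "t \<in> {0<..<n}")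
        case True
        then obtain N where "x N < t" using dyadicD(5)[OF x, of t] by auto
        then show ?thesis using True by (intro SUP_upper2[of N]) auto
      qed simp
    qed
  qed
  also have "\<dots> = (SUP N. sint {x N<..<n} g)"
  proof (rule nn_integral_monotone_convergence_SUP)
    show "incseq (\<lambda>N t. g t * indicator {x N<..<n} t)"
      using dyadic_antimono[OF x]
      by (auto simp: incseq_def le_fun_def split: split_indicator intro!: mult_left_mono dest: le_less_trans)
  qed measurable
  also have "\<dots> \<le> X"
    by (intro SUP_least order_trans[OF part sum])
  finally show ?thesis .
qed

text \<open>The recursion is that of \<open>ktail_split\<close> with the weights
  \<open>W powe \<alpha>\<close>, whose decay \<open>L\<close> beats the constant of the splitting.
  What remains after absorption is a local part, which is a \<open>\<Psi>1\<close> sum over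
  consecutive dyadic points, and a part made of kernel jumps times full tails, which is treated by
  \<open>sum_wk_tail_le\<close>.\<close>

lemma dyadic_sum_ktail_le:
  assumes [measurable]: "\<phi> \<in> borel_measurable lebesgue" and \<alpha>: "1 \<le> \<alpha>" and \<beta>: "0 < \<beta>" and a: "0 < a" "a * \<beta> = \<alpha> * q"
    and x: "dyadic \<Lambda> n x" and L2: "2 \<le> \<Lambda>" and L: "2 * split_const \<theta> a \<beta> \<le> ennreal \<Lambda> powe \<alpha>"
    and supp: "\<And>y. n < y \<Longrightarrow> \<phi> y = 0" and fin: "\<And>t. ktail a \<phi> t < top" "\<And>t. 0 < t \<Longrightarrow> sint {t<..} \<phi> < top"
  shows "(\<Sum>k<N. W (x (Suc k)) powe \<alpha> * ktail a \<phi> (x (Suc k)) powe \<beta>)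
           \<le> hardy_sum_const \<theta> \<alpha> \<beta> a * (covering_sup (\<Psi>1 \<alpha> \<beta> a \<phi>) + covering_sup (\<Psi>2 \<alpha> \<beta> \<phi>))"
proof -
  define loc where "loc k = sint {x (Suc k)<..<x k} (\<lambda>y. \<kappa> (x (Suc k)) y powe a * \<phi> y)" for k
  define jmp where "jmp k = \<kappa> (x (Suc k)) (x k) powe a * sint {x k<..} \<phi>" for k
  let ?h = "\<lambda>k. ktail a \<phi> (x k) powe \<beta>" and ?u = "\<lambda>k. W (x k) powe \<alpha>"
  let ?D1 = "covering_sup (\<Psi>1 \<alpha> \<beta> a \<phi>)" and ?D2 = "covering_sup (\<Psi>2 \<alpha> \<beta> \<phi>)"
  have xpos: "0 < x k" and xs: "x (Suc k) < x k" and x0: "x 0 = n" for k using dyadicD(1-3)[OF x] by auto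
  have bound: "(\<Sum>k<N. ?u (Suc k) * ?h (Suc k))
      \<le> 2 * split_const \<theta> a \<beta> * (\<Sum>k<N. ?u (Suc k) * (loc k powe \<beta> + jmp k powe \<beta>))"
  proof (rule sum_absorb)
    fix k
    show "?h (Suc k) \<le> split_const \<theta> a \<beta> * ((loc k powe \<beta> + jmp k powe \<beta>) + ?h k)"
      unfolding loc_def jmp_def using theta a \<beta> xs by (intro split_const_le ktail_split) (auto simp: less_imp_le)
    show "2 * split_const \<theta> a \<beta> * ?u (Suc k) \<le> ?u k"
      using dyadic_W_powe[OF x, of \<alpha> k] \<alpha> by (simp add: mult_right_mono L)
    show "?u k * ?h k < top"
      using \<alpha> \<beta> fin W_less_top by (auto simp: ennreal_mult_less_top intro!: powe_less_top)
  next
    have "ktail a \<phi> n = sint {n<..} (\<lambda>_. 0)"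
      unfolding ktail_def by (rule sint_cong) (use supp in auto)
    then show "?h 0 = 0" using \<beta> by (simp add: x0)
  qed
  have u_le: "?u k \<le> 2 powe \<alpha> * sint {x (Suc k)<..<x k} w powe \<alpha>" for k
    using powe_mono[OF dyadic_W_le[OF x L2], of \<alpha> k] \<alpha> by (simp add: powe_mult)
  have first: "(\<Sum>k<N. ?u (Suc k) * loc k powe \<beta>) \<le> 2 powe \<alpha> * ?D1"
  proof -
    have "(\<Sum>k<N. ?u (Suc k) * loc k powe \<beta>)
        \<le> (\<Sum>k<N. 2 powe \<alpha> * \<Psi>1 \<alpha> \<beta> a \<phi> {x (Suc (Suc k))<..<x (Suc k)} (x (Suc k)) (einterval (x (Suc k)) (ereal (x k))))"
    proof (rule sum_mono)
      fix k
      have "einterval (x (Suc k)) (ereal (x k)) = {x (Suc k)<..<x k}" by (auto simp: einterval_def)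
      then show "?u (Suc k) * loc k powe \<beta>
        \<le> 2 powe \<alpha> * \<Psi>1 \<alpha> \<beta> a \<phi> {x (Suc (Suc k))<..<x (Suc k)} (x (Suc k)) (einterval (x (Suc k)) (ereal (x k)))"
        using mult_right_mono[OF u_le[of "Suc k"], of "loc k powe \<beta>"] by (simp add: \<Psi>1_def loc_def mult.assoc)
    qed
    also have "\<dots> = 2 powe \<alpha> * (\<Sum>k<N. \<Psi>1 \<alpha> \<beta> a \<phi> {x (Suc (Suc k))<..<x (Suc k)} (x (Suc k)) (einterval (x (Suc k)) (ereal (x k))))"
      by (simp add: sum_distrib_left)
    also have "\<dots> \<le> 2 powe \<alpha> * ?D1"
    proof (intro mult_left_mono covering_sum_le_indexed[where s = "\<lambda>k. x (Suc k)"])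
      show "inj_on (\<lambda>k. x (Suc k)) {..<N}" using dyadic_inj[OF x] by (auto simp: inj_def inj_on_def)
    qed (use xpos \<alpha> \<beta> in \<open>auto simp: dyadic_less_iff[OF x] less_imp_le intro!: dyadic_antimono[OF x] \<Psi>1_mono\<close>)
    finally show ?thesis .
  qed
  have second: "(\<Sum>k<N. ?u (Suc k) * jmp k powe \<beta>) \<le> 2 powe \<alpha> * (4 * 4 powe \<beta> * ?D2)"
  proof -
    \<comment> \<open>Since \<open>a * \<beta> = \<alpha> * q\<close>, mass and jump stand under a
      common \<alpha>th power. The mass lies on the interval below \<open>x (Suc k)\<close> but is
      tested at \<open>x k\<close>, so the left-hand interval spans two dyadic steps.\<close>
    define z where "z k = wk {x (Suc (Suc k))<..<x k} (x k) powe \<alpha> * sint {x k<..} \<phi> powe \<beta>" for k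
    have term_le: "?u (Suc k) * jmp k powe \<beta> \<le> 2 powe \<alpha> * z k" for k
    proof -
      have "jmp k powe \<beta> = (\<kappa> (x (Suc k)) (x k) powe q) powe \<alpha> * sint {x k<..} \<phi> powe \<beta>"
        using a \<alpha> \<beta> q_pos by (simp add: jmp_def powe_mult powe_powe mult.commute)
      then have "?u (Suc k) * jmp k powe \<beta>
        \<le> 2 powe \<alpha> * ((sint {x (Suc (Suc k))<..<x (Suc k)} w * \<kappa> (x (Suc k)) (x k) powe q) powe \<alpha> * sint {x k<..} \<phi> powe \<beta>)"
        using mult_right_mono[OF u_le[of "Suc k"], of "jmp k powe \<beta>"] \<alpha> by (simp add: powe_mult mult_ac)
      also have "\<dots> \<le> 2 powe \<alpha> * z k"
        unfolding z_def using \<alpha> xs[of k]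
        by (intro mult_left_mono mult_right_mono powe_mono order_trans[OF sint_w_kernel_le_wk wk_mono]) auto
      finally show ?thesis .
    qed
    \<comment> \<open>Intervals spanning two steps overlap for consecutive indices; within one
      parity class they are disjoint.\<close>
    have par: "(\<Sum>k\<in>{k. k < N \<and> k mod 2 = c}. z k) \<le> 2 * 4 powe \<beta> * ?D2" for c
      unfolding z_def
    proof (rule sum_wk_tail_le_indexed)
      show "inj_on x {k. k < N \<and> k mod 2 = c}" using dyadic_inj[OF x] by (auto simp: inj_def inj_on_def)
      fix i j assume ij: "i \<in> {k. k < N \<and> k mod 2 = c}" "j \<in> {k. k < N \<and> k mod 2 = c}" "x i < x j"
      then have "j < i" by (simp add: dyadic_less_iff[OF x])
      moreover have "i \<noteq> Suc j"
      proof
        assume "i = Suc j"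
        moreover have "i mod 2 = j mod 2" using ij by simp
        ultimately show False by presburger
      qed
      ultimately show "x i \<le> x (Suc (Suc j))" by (intro dyadic_antimono[OF x]) auto
    qed (use xpos \<alpha> \<beta> fin in \<open>auto simp: less_imp_le\<close>)
    have "(\<Sum>k<N. ?u (Suc k) * jmp k powe \<beta>) \<le> (\<Sum>k<N. 2 powe \<alpha> * z k)"
      by (intro sum_mono term_le)
    also have "\<dots> = 2 powe \<alpha> * (\<Sum>k<N. z k)" by (simp add: sum_distrib_left)
    also have "(\<Sum>k<N. z k) = (\<Sum>k\<in>{k. k < N \<and> k mod 2 = 0}. z k) + (\<Sum>k\<in>{k. k < N \<and> k mod 2 = 1}. z k)"
      by (subst sum.union_disjoint[symmetric]) (auto intro!: sum.cong)
    also have "\<dots> \<le> 2 * 4 powe \<beta> * ?D2 + 2 * 4 powe \<beta> * ?D2" by (intro add_mono par)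
    also have "\<dots> = 4 * 4 powe \<beta> * ?D2"
      by (simp add: distrib_right[symmetric])
    finally show ?thesis by (simp add: mult_left_mono)
  qed
  have "2 powe \<alpha> * ?D1 \<le> 2 powe \<alpha> * (4 * 4 powe \<beta> * ?D1)"
  proof (rule mult_left_mono)
    have "1 * 1 \<le> 4 * (4::ennreal) powe \<beta>"
      using \<beta> by (intro mult_mono one_le_powe) (auto simp: one_le_numeral)
    then show "?D1 \<le> 4 * 4 powe \<beta> * ?D1"
      using mult_right_mono[of 1 "4 * 4 powe \<beta>" ?D1] by simp
  qed simp
  then have "(\<Sum>k<N. ?u (Suc k) * (loc k powe \<beta> + jmp k powe \<beta>))
      \<le> 2 powe \<alpha> * (4 * 4 powe \<beta> * ?D1) + 2 powe \<alpha> * (4 * 4 powe \<beta> * ?D2)"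
    using first second by (simp add: distrib_left sum.distrib add_mono order_trans)
  then have "2 * split_const \<theta> a \<beta> * (\<Sum>k<N. ?u (Suc k) * (loc k powe \<beta> + jmp k powe \<beta>))
      \<le> 2 * split_const \<theta> a \<beta> * (2 powe \<alpha> * (4 * 4 powe \<beta> * ?D1) + 2 powe \<alpha> * (4 * 4 powe \<beta> * ?D2))"
    by (rule mult_left_mono) simp
  with bound show ?thesis
    unfolding hardy_sum_const_def by (simp add: algebra_simps)
qed

end

section \<open>Truncation and passage to the limit\<close>

definition trunc :: "nat \<Rightarrow> (real \<Rightarrow> ennreal) \<Rightarrow> real \<Rightarrow> ennreal" where
  "trunc m \<phi> y = min (\<phi> y) (of_nat m) * indicator {..real m} y"

lemma trunc_measurable [measurable]:
  assumes [measurable]: "\<phi> \<in> borel_measurable lebesgue"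
  shows "trunc m \<phi> \<in> borel_measurable lebesgue"
proof -
  have [measurable]: "{..real m} \<in> sets lebesgue" by simp
  show ?thesis unfolding trunc_def by measurable
qed

lemma trunc_eq_0: "real m < y \<Longrightarrow> trunc m \<phi> y = 0"
  by (simp add: trunc_def)

lemma trunc_le: "trunc m \<phi> y \<le> \<phi> y"
  by (simp add: trunc_def split: split_indicator)

lemma incseq_trunc: "incseq (\<lambda>m. trunc m \<phi> y)"
  unfolding incseq_def trunc_def
  by (auto split: split_indicator simp: min_le_iff_disj)

lemma SUP_trunc: "(SUP m. trunc m \<phi> y) = \<phi> y"
proof -
  have 1: "(SUP m. indicator {..real m} y) = (1::ennreal)"
  proof (rule antisym)
    obtain m where "y \<le> real m" using real_arch_simple by blast
    then show "1 \<le> (SUP m. indicator {..real m} y :: ennreal)" by (intro SUP_upper2[of m]) auto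
  qed (auto intro!: SUP_least split: split_indicator)
  have 2: "(SUP m::nat. min (\<phi> y) (of_nat m)) = \<phi> y"
    by (simp flip: inf_min inf_SUP add: ennreal_SUP_of_nat_eq_top)
  have "incseq (\<lambda>m. min (\<phi> y) (of_nat m))" "incseq (\<lambda>m. indicator {..real m} y :: ennreal)"
    by (auto simp: incseq_def min_le_iff_disj split: split_indicator)
  from incseq_SUP_mult[OF this] show ?thesis
    unfolding trunc_def 1 2 by simp
qed

text \<open>The function and the domain of integration are exhausted simultaneously: the bound for
  the \<open>m\<close>th truncation is available only below \<open>m\<close>, and a product of
  increasing sequences may be evaluated along the diagonal.\<close>

lemma trunc_limit_integral_le:
  assumes [measurable]: "c \<in> borel_measurable lebesgue" "\<And>m. F m \<in> borel_measurable lebesgue"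
    and inc: "\<And>t. incseq (\<lambda>m. F m t)"
    and le: "\<And>m::nat. 0 < m \<Longrightarrow> sint {0<..<real m} (\<lambda>t. c t * F m t) \<le> X"
  shows "sint {0<..} (\<lambda>t. c t * (SUP m. F m t)) \<le> X"
proof -
  have [measurable]: "{0<..<real m} \<in> sets lebesgue" for m by simp
  have inc': "incseq (\<lambda>m. F m t * indicator {0<..<real m} t)" for t
    using inc[of t] by (auto simp: incseq_def split: split_indicator)
  have *: "(SUP m. F m t) * indicator {0<..} t = (SUP m. F m t * indicator {0<..<real m} t)" for t
  proof -
    have "(SUP m. indicator {0<..<real m} t) = (indicator {0<..} t :: ennreal)"
    proof (rule antisym)
      obtain m where "t < real m" using reals_Archimedean2 by blast
      then show "indicator {0<..} t \<le> (SUP m. indicator {0<..<real m} t :: ennreal)"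
        by (intro SUP_upper2[of m]) (auto split: split_indicator)
    qed (auto intro!: SUP_least split: split_indicator)
    moreover have "incseq (\<lambda>m. indicator {0<..<real m} t :: ennreal)"
      by (auto simp: incseq_def split: split_indicator)
    ultimately show ?thesis
      using incseq_SUP_mult[OF inc[of t], of "\<lambda>m. indicator {0<..<real m} t"] by simp
  qed
  have "sint {0<..} (\<lambda>t. c t * (SUP m. F m t))
      = (\<integral>\<^sup>+t. (SUP m. c t * F m t * indicator {0<..<real m} t) \<partial>lebesgue)"
    by (simp only: mult.assoc SUP_mult_left_ennreal[symmetric] *)
  also have "\<dots> = (SUP m. sint {0<..<real m} (\<lambda>t. c t * F m t))"
  proof (rule nn_integral_monotone_convergence_SUP)
    show "incseq (\<lambda>m t. c t * F m t * indicator {0<..<real m} t)"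
      using inc' by (auto simp: incseq_def le_fun_def mult.assoc intro!: mult_left_mono)
  qed measurable
  also have "\<dots> \<le> X"
  proof (rule SUP_least)
    fix m show "sint {0<..<real m} (\<lambda>t. c t * F m t) \<le> X" using le[of m] by (cases "m = 0") auto
  qed
  finally show ?thesis .
qed

text \<open>At least 2, so that half of the mass lies in the last interval, and at least
  \<open>2 * c\<close>, so that a recursion with constant \<open>c\<close> can be absorbed.\<close>

definition ratio :: "ennreal \<Rightarrow> real" where
  "ratio c = max 2 (2 * enn2real c)"

lemma ratio_ge: "2 \<le> ratio c" "c < top \<Longrightarrow> 2 * c \<le> ennreal (ratio c)"
proof -
  show "2 \<le> ratio c" by (simp add: ratio_def)
  assume "c < top"
  then obtain r where "c = ennreal r" "0 \<le> r" by (cases c) auto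
  then have "2 * c = ennreal (2 * enn2real c)" by (simp add: ennreal_mult)
  also have "\<dots> \<le> ennreal (ratio c)" by (rule ennreal_leI) (simp add: ratio_def)
  finally show "2 * c \<le> ennreal (ratio c)" .
qed

lemma le_powe: "1 \<le> x \<Longrightarrow> 1 \<le> a \<Longrightarrow> x \<le> x powe a"
  using powe_add[of 1 "a - 1" x] mult_left_mono[OF one_le_powe[of x "a - 1"], of x] by simp

definition hardy_const :: "real \<Rightarrow> real \<Rightarrow> real \<Rightarrow> real \<Rightarrow> ennreal" where
  "hardy_const \<theta> \<alpha> \<beta> a = ennreal (ratio (split_const \<theta> a \<beta>)) powe \<alpha> * hardy_sum_const \<theta> \<alpha> \<beta> a"

context weighted_kernel
begin

lemma ktail_mono_fun: "(\<And>y. \<phi> y \<le> \<psi> y) \<Longrightarrow> ktail a \<phi> t \<le> ktail a \<psi> t"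
  unfolding ktail_def by (rule sint_mono) (auto intro!: mult_left_mono)

lemma \<Psi>1_sup_mono_fun: "(\<And>y. \<phi> y \<le> \<psi> y) \<Longrightarrow> 0 \<le> \<beta> \<Longrightarrow> covering_sup (\<Psi>1 \<alpha> \<beta> a \<phi>) \<le> covering_sup (\<Psi>1 \<alpha> \<beta> a \<psi>)"
  by (rule covering_sup_least, rule order_trans[OF _ covering_sup_upper])
     (auto simp: \<Psi>1_def intro!: sum_mono mult_left_mono powe_mono nn_integral_mono mult_right_mono)

lemma \<Psi>2_sup_mono_fun: "(\<And>y. \<phi> y \<le> \<psi> y) \<Longrightarrow> 0 \<le> \<beta> \<Longrightarrow> covering_sup (\<Psi>2 \<alpha> \<beta> \<phi>) \<le> covering_sup (\<Psi>2 \<alpha> \<beta> \<psi>)"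
  by (rule covering_sup_least, rule order_trans[OF _ covering_sup_upper])
     (auto simp: \<Psi>2_def intro!: sum_mono mult_left_mono powe_mono nn_integral_mono mult_right_mono)

lemma sint_trunc_less_top: "sint {t<..} (trunc m \<phi>) < top"
proof -
  have "sint {t<..} (trunc m \<phi>) \<le> (\<integral>\<^sup>+y. of_nat m * indicator {t..real m} y \<partial>lebesgue)"
    by (rule nn_integral_mono) (auto simp: trunc_def split: split_indicator)
  also have "\<dots> = of_nat m * emeasure lebesgue {t..real m}"
    by (rule nn_integral_cmult_indicator) simp
  also have "\<dots> < top"
    by (cases "t \<le> real m") (simp_all add: ennreal_mult_less_top ennreal_of_nat_eq_real_of_nat)
  finally show ?thesis .
qed

lemma ktail_trunc_less_top:
  assumes [measurable]: "\<phi> \<in> borel_measurable lebesgue" and "0 \<le> a"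
  shows "ktail a (trunc m \<phi>) t < top"
proof -
  have "ktail a (trunc m \<phi>) t \<le> sint {t<..} (\<lambda>y. \<kappa> t (real m) powe a * trunc m \<phi> y)"
    unfolding ktail_def
  proof (rule sint_mono)
    fix y show "\<kappa> t y powe a * trunc m \<phi> y \<le> \<kappa> t (real m) powe a * trunc m \<phi> y"
      using assms(2) by (cases "y \<le> real m") (auto simp: trunc_def intro!: mult_right_mono powe_mono mono)
  qed simp
  also have "\<dots> = \<kappa> t (real m) powe a * sint {t<..} (trunc m \<phi>)" by (rule sint_cmult) auto
  also have "\<dots> < top"
    using sint_trunc_less_top finite assms(2) by (auto simp: ennreal_mult_less_top intro!: powe_less_top)
  finally show ?thesis .
qed

lemma ktail_SUP_trunc:
  assumes [measurable]: "\<phi> \<in> borel_measurable lebesgue"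
  shows "(SUP m. ktail a (trunc m \<phi>) t) = ktail a \<phi> t"
proof -
  have [measurable]: "{t<..} \<in> sets lebesgue" by simp
  have "(SUP m. ktail a (trunc m \<phi>) t) = (\<integral>\<^sup>+y. (SUP m. \<kappa> t y powe a * trunc m \<phi> y * indicator {t<..} y) \<partial>lebesgue)"
    unfolding ktail_def
  proof (rule nn_integral_monotone_convergence_SUP[symmetric])
    show "incseq (\<lambda>m y. \<kappa> t y powe a * trunc m \<phi> y * indicator {t<..} y)"
      using incseq_trunc by (auto simp: incseq_def le_fun_def intro!: mult_left_mono mult_right_mono)
  qed measurable
  also have "\<dots> = ktail a \<phi> t"
    unfolding ktail_def SUP_mult_right_ennreal[symmetric] SUP_mult_left_ennreal[symmetric] SUP_trunc ..
  finally show ?thesis .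
qed

text \<open>On each interval \<open>W\<close> is bounded by its value at the right end and the tail
  by its value at the left end. Moving \<open>W\<close> to the left end costs the factor
  \<open>\<Lambda> powe \<alpha>\<close>, and a term of the preceding sum appears.\<close>

lemma dyadic_hardy_integral_le:
  assumes [measurable]: "\<phi> \<in> borel_measurable lebesgue" and \<alpha>: "1 \<le> \<alpha>" and \<beta>: "0 < \<beta>" and a: "0 < a" "a * \<beta> = \<alpha> * q"
    and x: "dyadic \<Lambda> n x" and L2: "2 \<le> \<Lambda>" and L: "2 * split_const \<theta> a \<beta> \<le> ennreal \<Lambda> powe \<alpha>"
    and supp: "\<And>y. n < y \<Longrightarrow> \<phi> y = 0" and fin: "\<And>t. ktail a \<phi> t < top" "\<And>t. 0 < t \<Longrightarrow> sint {t<..} \<phi> < top"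
  shows "sint {0<..<n} (\<lambda>t. W t powe (\<alpha> - 1) * w t * ktail a \<phi> t powe \<beta>)
           \<le> ennreal \<Lambda> powe \<alpha> * hardy_sum_const \<theta> \<alpha> \<beta> a * (covering_sup (\<Psi>1 \<alpha> \<beta> a \<phi>) + covering_sup (\<Psi>2 \<alpha> \<beta> \<phi>))"
proof (rule dyadic_integral_le[OF x])
  show "(\<lambda>t. W t powe (\<alpha> - 1) * w t * ktail a \<phi> t powe \<beta>) \<in> borel_measurable lebesgue"
    using ktail_measurable[OF less_imp_le[OF a(1)]] by measurable
  fix k
  have xs: "x (Suc k) < x k" "0 < x (Suc k)" using dyadicD[OF x] by auto
  have "sint {x (Suc k)<..<x k} (\<lambda>t. W t powe (\<alpha> - 1) * w t * ktail a \<phi> t powe \<beta>)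
     \<le> sint {x (Suc k)<..<x k} (\<lambda>t. (W (x k) powe (\<alpha> - 1) * ktail a \<phi> (x (Suc k)) powe \<beta>) * w t)"
  proof (rule sint_mono)
    fix t assume t: "t \<in> {x (Suc k)<..<x k}"
    have *: "W t powe (\<alpha> - 1) * ktail a \<phi> t powe \<beta> \<le> W (x k) powe (\<alpha> - 1) * ktail a \<phi> (x (Suc k)) powe \<beta>"
      using t a \<alpha> \<beta> by (intro mult_mono powe_mono W_mono ktail_antimono) auto
    show "W t powe (\<alpha> - 1) * w t * ktail a \<phi> t powe \<beta>
        \<le> (W (x k) powe (\<alpha> - 1) * ktail a \<phi> (x (Suc k)) powe \<beta>) * w t"
      using mult_right_mono[OF *, of "w t"] by (simp add: mult_ac)
  qed simp
  also have "\<dots> = (W (x k) powe (\<alpha> - 1) * ktail a \<phi> (x (Suc k)) powe \<beta>) * sint {x (Suc k)<..<x k} w"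
    by (rule sint_cmult) auto
  also have "\<dots> \<le> (W (x k) powe (\<alpha> - 1) * ktail a \<phi> (x (Suc k)) powe \<beta>) * W (x k)"
    unfolding W_def using xs by (intro mult_left_mono sint_mono) auto
  also have "\<dots> = W (x k) powe \<alpha> * ktail a \<phi> (x (Suc k)) powe \<beta>"
    using powe_add[of "\<alpha> - 1" 1 "W (x k)"] \<alpha> by (simp add: mult_ac)
  also have "\<dots> = ennreal \<Lambda> powe \<alpha> * (W (x (Suc k)) powe \<alpha> * ktail a \<phi> (x (Suc k)) powe \<beta>)"
    using dyadic_W_powe[OF x, of \<alpha> k] \<alpha> by (simp add: mult.assoc)
  finally show "sint {x (Suc k)<..<x k} (\<lambda>t. W t powe (\<alpha> - 1) * w t * ktail a \<phi> t powe \<beta>)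
     \<le> ennreal \<Lambda> powe \<alpha> * (W (x (Suc k)) powe \<alpha> * ktail a \<phi> (x (Suc k)) powe \<beta>)" .
next
  fix N
  show "(\<Sum>k<N. ennreal \<Lambda> powe \<alpha> * (W (x (Suc k)) powe \<alpha> * ktail a \<phi> (x (Suc k)) powe \<beta>))
      \<le> ennreal \<Lambda> powe \<alpha> * hardy_sum_const \<theta> \<alpha> \<beta> a * (covering_sup (\<Psi>1 \<alpha> \<beta> a \<phi>) + covering_sup (\<Psi>2 \<alpha> \<beta> \<phi>))"
    unfolding sum_distrib_left[symmetric] mult.assoc
    by (intro mult_left_mono dyadic_sum_ktail_le[OF assms(1) \<alpha> \<beta> a x L2 L]) (use supp fin in auto)
qed

text \<open>The constant depends neither on \<phi> nor on the truncation, and truncating only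
  decreases the right-hand side, so the bound survives monotone convergence.\<close>

lemma hardy_integral_le:
  assumes [measurable]: "\<phi> \<in> borel_measurable lebesgue" and \<alpha>: "1 \<le> \<alpha>" and \<beta>: "0 < \<beta>" and a: "0 < a" "a * \<beta> = \<alpha> * q"
  shows "sint {0<..} (\<lambda>t. W t powe (\<alpha> - 1) * w t * ktail a \<phi> t powe \<beta>)
           \<le> hardy_const \<theta> \<alpha> \<beta> a * (covering_sup (\<Psi>1 \<alpha> \<beta> a \<phi>) + covering_sup (\<Psi>2 \<alpha> \<beta> \<phi>))"
proof -
  let ?L = "ratio (split_const \<theta> a \<beta>)"
  have L: "2 \<le> ?L" "2 * split_const \<theta> a \<beta> \<le> ennreal ?L powe \<alpha>"
  proof -
    show "2 \<le> ?L" by (rule ratio_ge)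
    then have "1 \<le> ennreal ?L" using ennreal_leI[of 1 ?L] by simp
    then have "ennreal ?L \<le> ennreal ?L powe \<alpha>" by (rule le_powe[OF _ \<alpha>])
    moreover have "2 * split_const \<theta> a \<beta> \<le> ennreal ?L"
      using a \<beta> by (intro ratio_ge split_const_less_top) auto
    ultimately show "2 * split_const \<theta> a \<beta> \<le> ennreal ?L powe \<alpha>" by (rule order_trans[rotated])
  qed
  have a0: "0 \<le> a" using a by simp
  have "sint {0<..} (\<lambda>t. (W t powe (\<alpha> - 1) * w t) * (SUP m. ktail a (trunc m \<phi>) t powe \<beta>))
    \<le> hardy_const \<theta> \<alpha> \<beta> a * (covering_sup (\<Psi>1 \<alpha> \<beta> a \<phi>) + covering_sup (\<Psi>2 \<alpha> \<beta> \<phi>))"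
  proof (rule trunc_limit_integral_le)
    show "(\<lambda>t. ktail a (trunc m \<phi>) t powe \<beta>) \<in> borel_measurable lebesgue" for m
      using ktail_measurable[OF a0] by measurable
    show "incseq (\<lambda>m. ktail a (trunc m \<phi>) t powe \<beta>)" for t
      using incseq_trunc[of \<phi>] \<beta> by (auto simp: incseq_def intro!: powe_mono ktail_mono_fun)
    fix m :: nat assume "0 < m"
    obtain x where x: "dyadic ?L (real m) x"
      by (rule dyadic_exists[of ?L "real m"]) (use L(1) \<open>0 < m\<close> in auto)
    have "sint {0<..<real m} (\<lambda>t. W t powe (\<alpha> - 1) * w t * ktail a (trunc m \<phi>) t powe \<beta>)
      \<le> hardy_const \<theta> \<alpha> \<beta> a * (covering_sup (\<Psi>1 \<alpha> \<beta> a (trunc m \<phi>)) + covering_sup (\<Psi>2 \<alpha> \<beta> (trunc m \<phi>)))"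
      unfolding hardy_const_def
      by (rule dyadic_hardy_integral_le[OF _ \<alpha> \<beta> a x L])
         (use a0 in \<open>auto intro!: ktail_trunc_less_top sint_trunc_less_top simp: trunc_eq_0\<close>)
    also have "\<dots> \<le> hardy_const \<theta> \<alpha> \<beta> a * (covering_sup (\<Psi>1 \<alpha> \<beta> a \<phi>) + covering_sup (\<Psi>2 \<alpha> \<beta> \<phi>))"
      using \<beta> by (intro mult_left_mono add_mono \<Psi>1_sup_mono_fun \<Psi>2_sup_mono_fun trunc_le) auto
    finally show "sint {0<..<real m} (\<lambda>t. W t powe (\<alpha> - 1) * w t * ktail a (trunc m \<phi>) t powe \<beta>)
      \<le> hardy_const \<theta> \<alpha> \<beta> a * (covering_sup (\<Psi>1 \<alpha> \<beta> a \<phi>) + covering_sup (\<Psi>2 \<alpha> \<beta> \<phi>))" .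
  qed measurable
  then show ?thesis
    unfolding powe_SUP[OF \<beta>, symmetric] ktail_SUP_trunc[OF assms(1)] .
qed

end

subsection \<open>Discretising the supremal integral\<close>

text \<open>The predecessor map on a finite set is injective. It plays the part of the index shift
  when the recursion runs over a set of points rather than over the natural numbers.\<close>

lemma sum_predecessor_le:
  fixes f :: "real \<Rightarrow> ennreal"
  assumes "finite Y"
  shows "(\<Sum>y\<in>{y \<in> Y. \<exists>u\<in>Y. u < y}. f (Max {u \<in> Y. u < y})) \<le> (\<Sum>y\<in>Y. f y)"
proof -
  let ?m = "\<lambda>y. Max {u \<in> Y. u < y}" and ?Y1 = "{y \<in> Y. \<exists>u\<in>Y. u < y}"
  have m: "?m y \<in> Y \<and> ?m y < y" if "y \<in> ?Y1" for y
  proof -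
    have "?m y \<in> {u \<in> Y. u < y}" by (rule Max_in) (use assms that in auto)
    then show ?thesis by simp
  qed
  have less: "?m y < ?m y'" if "y \<in> ?Y1" "y' \<in> ?Y1" "y < y'" for y y'
  proof -
    have "y \<le> ?m y'" by (rule Max_ge) (use assms that in auto)
    then show ?thesis using m[OF that(1)] by simp
  qed
  have inj: "inj_on ?m ?Y1"
  proof (rule inj_onI)
    fix y y' assume yy: "y \<in> ?Y1" "y' \<in> ?Y1" "?m y = ?m y'"
    then show "y = y'" using less[of y y'] less[of y' y] by (cases y y' rule: linorder_cases) auto
  qed
  have "(\<Sum>y\<in>?Y1. f (?m y)) = (\<Sum>u\<in>?m ` ?Y1. f u)"
    by (subst sum.reindex[OF inj]) simp
  also have "\<dots> \<le> (\<Sum>y\<in>Y. f y)"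
    by (rule sum_mono2) (use assms m in auto)
  finally show ?thesis .
qed

lemma powe_add4_le:
  assumes "0 \<le> s"
  shows "((x + y) + (u + v)) powe s \<le> 4 powe s * ((x powe s + y powe s) + (u powe s + v powe s))"
proof -
  have "((x + y) + (u + v)) powe s \<le> 2 powe s * ((x + y) powe s + (u + v) powe s)"
    by (rule powe_add_le[OF assms])
  also have "\<dots> \<le> 2 powe s * (2 powe s * (x powe s + y powe s) + 2 powe s * (u powe s + v powe s))"
    by (intro mult_left_mono add_mono powe_add_le assms) auto
  also have "\<dots> = (2 * 2) powe s * ((x powe s + y powe s) + (u powe s + v powe s))"
    unfolding powe_mult[OF assms] by (simp only: algebra_simps)
  finally show ?thesis by simp
qed

definition level_const :: "real \<Rightarrow> real \<Rightarrow> real \<Rightarrow> ennreal" where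
  "level_const \<theta> q \<alpha> = 4 powe \<alpha> * tri \<theta> q powe \<alpha>"

lemma level_const_ge:
  assumes "0 \<le> \<alpha>"
  shows "(tri \<theta> q * ((x + y) + (u + v))) powe \<alpha>
    \<le> level_const \<theta> q \<alpha> * ((x powe \<alpha> + y powe \<alpha>) + (u powe \<alpha> + v powe \<alpha>))"
  using mult_left_mono[OF powe_add4_le[OF assms, of x y u v], of "tri \<theta> q powe \<alpha>"]
  by (simp add: powe_mult[OF assms] level_const_def mult.assoc mult.left_commute[of "tri \<theta> q powe \<alpha>"])

lemma level_const_less_top: "0 \<le> \<alpha> \<Longrightarrow> 0 \<le> q \<Longrightarrow> level_const \<theta> q \<alpha> < top"
  by (auto simp: level_const_def ennreal_mult_less_top intro!: powe_less_top tri_less_top)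

context weighted_kernel
begin

definition G :: "real \<Rightarrow> ennreal" where "G t = wk {0<..<t} t"

definition Q :: "real \<Rightarrow> (real \<Rightarrow> ennreal) \<Rightarrow> real \<Rightarrow> ennreal" where
  "Q \<beta> \<phi> z = sint {z<..} \<phi> powe \<beta>"

lemma Q_antimono: "0 \<le> \<beta> \<Longrightarrow> y \<le> z \<Longrightarrow> Q \<beta> \<phi> z \<le> Q \<beta> \<phi> y"
  unfolding Q_def by (intro powe_mono sint_mono) auto

lemma G_mono: "s \<le> t \<Longrightarrow> G s \<le> G t"
  unfolding G_def by (rule wk_mono) auto

text \<open>Beyond \<open>z\<close> the kernel \<open>\<kappa> x\<close> is at least
  \<open>\<kappa> x z\<close>, and \<open>a * \<beta> = \<alpha> * q\<close> matches the
  exponents.\<close>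

lemma kernel_Q_le_ktail:
  assumes [measurable]: "\<phi> \<in> borel_measurable lebesgue" and "x \<le> z" "0 < \<alpha>" "0 < \<beta>" "0 < a" "a * \<beta> = \<alpha> * q"
  shows "(\<kappa> x z powe q) powe \<alpha> * Q \<beta> \<phi> z \<le> ktail a \<phi> x powe \<beta>"
proof -
  have "(\<kappa> x z powe q) powe \<alpha> * Q \<beta> \<phi> z = (\<kappa> x z powe a * sint {z<..} \<phi>) powe \<beta>"
    using assms q_pos by (simp add: Q_def powe_mult powe_powe mult.commute)
  also have "\<dots> \<le> ktail a \<phi> x powe \<beta>"
    using assms by (intro powe_mono kernel_tail_le_ktail) auto
  finally show ?thesis .
qed

text \<open>A recursion in the upward direction. The mass below \<open>y\<close> is cut at the
  predecessor \<open>u\<close>: the part below \<open>u\<close> reproduces the quantity at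
  \<open>u\<close> plus a kernel jump, the part between \<open>u\<close> and \<open>y\<close> gives
  a local term plus a jump. The decay of \<open>Q\<close> absorbs the recursive term, the jumps
  times \<open>Q\<close> are bounded by kernel tails, and the local terms are summed by
  \<open>sum_wk_tail_le\<close>.\<close>

lemma sum_level_reps_wk_le:
  assumes [measurable]: "\<phi> \<in> borel_measurable lebesgue" and \<alpha>: "1 \<le> \<alpha>" and \<beta>: "0 < \<beta>" and a: "0 < a" "a * \<beta> = \<alpha> * q"
    and fin: "finite Y" and pos: "\<And>y. y \<in> Y \<Longrightarrow> 0 < y" and z: "\<And>y. y \<in> Y \<Longrightarrow> y \<le> z y"
    and sep: "\<And>x y. x \<in> Y \<Longrightarrow> y \<in> Y \<Longrightarrow> x < y \<Longrightarrow> z x \<le> y"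
    and decay: "\<And>x y. x \<in> Y \<Longrightarrow> y \<in> Y \<Longrightarrow> x < y \<Longrightarrow> 2 * level_const \<theta> q \<alpha> * Q \<beta> \<phi> (z y) \<le> Q \<beta> \<phi> (z x)"
    and tail: "\<And>t. 0 < t \<Longrightarrow> sint {t<..} \<phi> < top"
  shows "(\<Sum>y\<in>Y. Q \<beta> \<phi> (z y) * wk {0<..<y} (z y) powe \<alpha>)
    \<le> 2 * level_const \<theta> q \<alpha> * (2 * (\<Sum>y\<in>Y. W y powe \<alpha> * ktail a \<phi> y powe \<beta>)
         + 2 * 4 powe \<beta> * covering_sup (\<Psi>2 \<alpha> \<beta> \<phi>))"
proof -
  let ?K = "level_const \<theta> q \<alpha>" and ?Q = "Q \<beta> \<phi>"
  define P where "P y = wk {0<..<y} (z y)" for y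
  define b where "b y = W y powe \<alpha> * ktail a \<phi> y powe \<beta>" for y
  define m where "m y = Max {u \<in> Y. u < y}" for y
  define Y1 where "Y1 = {y \<in> Y. \<exists>u\<in>Y. u < y}"
  \<comment> \<open>The first point has no predecessor; its local interval starts at 0.\<close>
  define s where "s y = (if y \<in> Y1 then m y else 0)" for y
  define e where "e y = wk {s y<..<y} y powe \<alpha> * ?Q y" for y
  define f where "f u = ?Q (z u) * P u powe \<alpha> + 2 * ?K * b u" for u
  have m: "m y \<in> Y \<and> m y < y" if "y \<in> Y1" for y
  proof -
    have "m y \<in> {u \<in> Y. u < y}" unfolding m_def by (rule Max_in) (use fin that in \<open>auto simp: Y1_def\<close>)
    then show ?thesis by simp
  qed
  have s0: "0 \<le> s y" if "y \<in> Y" for y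
    using m[of y] pos that by (auto simp: s_def less_imp_le)
  have \<alpha>0: "0 \<le> \<alpha>" and q0: "0 \<le> q" using \<alpha> q_pos by auto
  have point: "(W u * \<kappa> u (z y) powe q) powe \<alpha> * ?Q (z y) \<le> b u" if "u \<le> z y" for u y
    using kernel_Q_le_ktail[OF assms(1) that, of \<alpha> \<beta> a] \<alpha> \<beta> a
    by (simp add: b_def powe_mult mult.assoc mult_left_mono)
  have right: "wk {s y<..<y} (z y) \<le> tri \<theta> q * (wk {s y<..<y} y + W y * \<kappa> y (z y) powe q)" if "y \<in> Y" for y
  proof -
    have "wk {s y<..<y} (z y) \<le> tri \<theta> q * (wk {s y<..<y} y + sint {s y<..<y} w * \<kappa> y (z y) powe q)"
      by (rule wk_triangle) (use z that in auto)
    also have "\<dots> \<le> tri \<theta> q * (wk {s y<..<y} y + W y * \<kappa> y (z y) powe q)"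
      unfolding W_def using s0[OF that]
      by (intro mult_left_mono add_left_mono mult_right_mono sint_mono) auto
    finally show ?thesis .
  qed
  have e_b: "(wk {s y<..<y} y powe \<alpha> + (W y * \<kappa> y (z y) powe q) powe \<alpha>) * ?Q (z y) \<le> e y + b y" if "y \<in> Y" for y
    unfolding distrib_right e_def
    by (intro add_mono mult_left_mono Q_antimono point) (use z that \<beta> in auto)
  have step: "2 * (?Q (z y) * P y powe \<alpha>) \<le> (if y \<in> Y1 then f (m y) else 0) + 2 * ?K * (e y + b y)" if y: "y \<in> Y" for y
  proof (cases "y \<in> Y1")
    case True
    let ?u = "m y"
    have u: "?u \<in> Y" "?u < y" using m[OF True] by auto
    have "P y \<le> wk {0<..?u} (z y) + wk {?u<..<y} (z y)"
      unfolding P_def by (rule wk_Un_le) auto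
    also have "wk {0<..?u} (z y) = wk {0<..<?u} (z y)"
      unfolding wk_def by (rule sint_remove_endpoints)
    finally have "P y \<le> wk {0<..<?u} (z y) + wk {?u<..<y} (z y)" .
    moreover have "wk {0<..<?u} (z y) \<le> tri \<theta> q * (P ?u + W ?u * \<kappa> ?u (z y) powe q)"
    proof -
      have "wk {0<..<?u} (z y) \<le> tri \<theta> q * (wk {0<..<?u} (z ?u) + sint {0<..<?u} w * \<kappa> (z ?u) (z y) powe q)"
        by (rule wk_triangle) (use z[OF u(1)] z[OF y] sep[OF u(1) y u(2)] in auto)
      \<comment> \<open>\<open>\<kappa> (z u) (z y)\<close> is enlarged to
        \<open>\<kappa> u (z y)\<close>, as \<open>u \<le> z u\<close>; in this form the jump is
        controlled by the tail at \<open>u\<close>.\<close>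
      also have "\<dots> \<le> tri \<theta> q * (P ?u + W ?u * \<kappa> ?u (z y) powe q)"
        unfolding P_def W_def using z[OF u(1)] q0
        by (intro mult_left_mono add_left_mono powe_mono antimono) auto
      finally show ?thesis .
    qed
    moreover have "wk {?u<..<y} (z y) \<le> tri \<theta> q * (wk {s y<..<y} y + W y * \<kappa> y (z y) powe q)"
      using right[OF y] True by (simp add: s_def)
    ultimately have "P y \<le> tri \<theta> q * (P ?u + W ?u * \<kappa> ?u (z y) powe q) + tri \<theta> q * (wk {s y<..<y} y + W y * \<kappa> y (z y) powe q)"
      by (meson add_mono order_trans)
    then have "P y powe \<alpha> \<le> (tri \<theta> q * ((P ?u + W ?u * \<kappa> ?u (z y) powe q) + (wk {s y<..<y} y + W y * \<kappa> y (z y) powe q))) powe \<alpha>"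
      unfolding distrib_left[symmetric] by (rule powe_mono) (rule \<alpha>0)
    also have "\<dots> \<le> ?K * ((P ?u powe \<alpha> + (W ?u * \<kappa> ?u (z y) powe q) powe \<alpha>)
        + (wk {s y<..<y} y powe \<alpha> + (W y * \<kappa> y (z y) powe q) powe \<alpha>))"
      by (rule level_const_ge[OF \<alpha>0])
    finally have "2 * (?Q (z y) * P y powe \<alpha>) \<le> 2 * (?Q (z y) * (?K * ((P ?u powe \<alpha> + (W ?u * \<kappa> ?u (z y) powe q) powe \<alpha>)
        + (wk {s y<..<y} y powe \<alpha> + (W y * \<kappa> y (z y) powe q) powe \<alpha>))))"
      by (intro mult_left_mono) auto
    also have "\<dots> = (2 * ?K * ?Q (z y)) * P ?u powe \<alpha> + 2 * ?K * ((W ?u * \<kappa> ?u (z y) powe q) powe \<alpha> * ?Q (z y))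
        + 2 * ?K * ((wk {s y<..<y} y powe \<alpha> + (W y * \<kappa> y (z y) powe q) powe \<alpha>) * ?Q (z y))"
      by (simp only: algebra_simps)
    \<comment> \<open>The decay hypothesis replaces \<open>2 * K * Q (z y)\<close> by
      \<open>Q (z u)\<close>, so the recursive term enters with factor 1 against the factor 2 on the
      left.\<close>
    also have "\<dots> \<le> (?Q (z ?u) * P ?u powe \<alpha> + 2 * ?K * b ?u) + 2 * ?K * (e y + b y)"
      using u y z[OF y] by (intro add_mono mult_left_mono mult_right_mono decay point e_b) auto
    finally show ?thesis using True by (simp add: f_def)
  next
    case False
    have "P y \<le> tri \<theta> q * (wk {s y<..<y} y + W y * \<kappa> y (z y) powe q)"
      using right[OF y] False by (simp add: s_def P_def)
    \<comment> \<open>The zeros stand for the two missing predecessor terms, so that the same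
      four-term bound applies.\<close>
    then have "P y powe \<alpha> \<le> (tri \<theta> q * ((0 + 0) + (wk {s y<..<y} y + W y * \<kappa> y (z y) powe q))) powe \<alpha>"
      by (intro powe_mono) (auto simp: \<alpha>0)
    also have "\<dots> \<le> ?K * ((0 powe \<alpha> + 0 powe \<alpha>) + (wk {s y<..<y} y powe \<alpha> + (W y * \<kappa> y (z y) powe q) powe \<alpha>))"
      by (rule level_const_ge[OF \<alpha>0])
    finally have "2 * (?Q (z y) * P y powe \<alpha>) \<le> 2 * (?Q (z y) * (?K * (wk {s y<..<y} y powe \<alpha> + (W y * \<kappa> y (z y) powe q) powe \<alpha>)))"
      using \<alpha> by (intro mult_left_mono) auto
    also have "\<dots> = 2 * ?K * ((wk {s y<..<y} y powe \<alpha> + (W y * \<kappa> y (z y) powe q) powe \<alpha>) * ?Q (z y))"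
      by (simp only: algebra_simps)
    also have "\<dots> \<le> 2 * ?K * (e y + b y)"
      by (intro mult_left_mono e_b y) auto
    finally show ?thesis using False by simp
  qed
  let ?R = "\<Sum>y\<in>Y. ?Q (z y) * P y powe \<alpha>" and ?B = "\<Sum>y\<in>Y. b y"
  have E: "(\<Sum>y\<in>Y. e y) \<le> 2 * 4 powe \<beta> * covering_sup (\<Psi>2 \<alpha> \<beta> \<phi>)"
    unfolding e_def Q_def
  proof (rule sum_wk_tail_le[OF assms(1) \<alpha> \<beta> fin pos])
    fix x assume "x \<in> Y" then show "0 \<le> s x" by (rule s0)
  next
    fix x y assume xy: "x \<in> Y" "y \<in> Y" "x < y"
    then show "x \<le> s y" using fin by (auto simp: s_def Y1_def m_def intro!: Max_ge)
  qed (use tail pos in auto)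
  have "2 * ?R \<le> (\<Sum>y\<in>Y. (if y \<in> Y1 then f (m y) else 0) + 2 * ?K * (e y + b y))"
    unfolding sum_distrib_left by (intro sum_mono step)
  also have "\<dots> = (\<Sum>y\<in>Y1. f (m y)) + 2 * ?K * ((\<Sum>y\<in>Y. e y) + ?B)"
  proof -
    have "(\<Sum>y\<in>Y. if y \<in> Y1 then f (m y) else 0) = (\<Sum>y\<in>Y1. f (m y))"
      using fin by (simp add: Y1_def sum.inter_filter)
    then show ?thesis by (simp only: sum.distrib sum_distrib_left[symmetric])
  qed
  also have "\<dots> \<le> (\<Sum>y\<in>Y. f y) + 2 * ?K * (2 * 4 powe \<beta> * covering_sup (\<Psi>2 \<alpha> \<beta> \<phi>) + ?B)"
    unfolding Y1_def m_def by (intro add_mono sum_predecessor_le fin mult_left_mono E) auto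
  also have "(\<Sum>y\<in>Y. f y) = ?R + 2 * ?K * ?B"
    by (simp only: f_def sum.distrib sum_distrib_left[symmetric])
  also have "?R + 2 * ?K * ?B + 2 * ?K * (2 * 4 powe \<beta> * covering_sup (\<Psi>2 \<alpha> \<beta> \<phi>) + ?B)
    = 2 * ?K * (2 * ?B + 2 * 4 powe \<beta> * covering_sup (\<Psi>2 \<alpha> \<beta> \<phi>)) + ?R"
    by (simp add: algebra_simps mult_2)
  finally have "2 * ?R \<le> 2 * ?K * (2 * ?B + 2 * 4 powe \<beta> * covering_sup (\<Psi>2 \<alpha> \<beta> \<phi>)) + ?R" .
  moreover have "?R < top"
  proof -
    have "?Q (z y) < top" if "y \<in> Y" for y
      using tail[of "z y"] pos[OF that] z[OF that] \<beta> by (auto simp: Q_def intro!: powe_less_top)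
    moreover have "P y powe \<alpha> < top" for y
      using wk_less_top \<alpha>0 by (auto simp: P_def intro!: powe_less_top)
    ultimately show ?thesis using fin by (auto simp: ennreal_mult_less_top)
  qed
  ultimately show ?thesis
    unfolding P_def b_def by (rule ennreal_absorb[rotated])
qed

text \<open>A discrete form of integrating the power \<open>\<alpha> - 1\<close> of a primitive
  against its density. Within a level of \<open>Q\<close>, the factors
  \<open>W x * \<kappa> x (z x) powe q\<close> are bounded by integrals over disjoint intervals,
  which add up to at most \<open>P = wk {0<..<y} (z y)\<close>, while \<open>G\<close> is at most
  \<open>P\<close>; together they give \<open>P powe \<alpha>\<close> at the representative. The
  ratio of the levels is chosen so that the representatives satisfy the decay hypothesis of
  \<open>sum_level_reps_wk_le\<close>.\<close>

lemma sum_G_kernel_Q_le: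
  assumes [measurable]: "\<phi> \<in> borel_measurable lebesgue" and \<alpha>: "1 \<le> \<alpha>" and \<beta>: "0 < \<beta>" and a: "0 < a" "a * \<beta> = \<alpha> * q"
    and fin: "finite S" and pos: "\<And>y. y \<in> S \<Longrightarrow> 0 < y" and z: "\<And>y. y \<in> S \<Longrightarrow> y \<le> z y"
    and sep: "\<And>x y. x \<in> S \<Longrightarrow> y \<in> S \<Longrightarrow> x < y \<Longrightarrow> z x \<le> y"
      "\<And>x y. x \<in> S \<Longrightarrow> y \<in> S \<Longrightarrow> x < y \<Longrightarrow> x \<le> l y"
    and l: "\<And>y. y \<in> S \<Longrightarrow> 0 \<le> l y" "\<And>y. y \<in> S \<Longrightarrow> W y \<le> 2 * sint {l y<..<y} w"
    and tail: "\<And>t. 0 < t \<Longrightarrow> sint {t<..} \<phi> < top"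
  shows "(\<Sum>y\<in>S. W y * G y powe (\<alpha> - 1) * (\<kappa> y (z y) powe q * Q \<beta> \<phi> (z y)))
    \<le> 4 * ennreal (ratio (level_const \<theta> q \<alpha>)) * (2 * level_const \<theta> q \<alpha> *
         (2 * (\<Sum>y\<in>S. W y powe \<alpha> * ktail a \<phi> y powe \<beta>) + 2 * 4 powe \<beta> * covering_sup (\<Psi>2 \<alpha> \<beta> \<phi>)))"
proof -
  let ?K = "level_const \<theta> q \<alpha>" and ?Q = "Q \<beta> \<phi>"
  let ?\<rho> = "ratio ?K"
  have \<alpha>0: "0 \<le> \<alpha>" and q0: "0 \<le> q" using \<alpha> q_pos by auto
  have rho: "2 \<le> ?\<rho>" "2 * ?K \<le> ennreal ?\<rho>" using \<alpha>0 q0 by (auto intro!: ratio_ge level_const_less_top)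
  define h where "h y = W y * G y powe (\<alpha> - 1) * (\<kappa> y (z y) powe q * ?Q (z y))" for y
  define X where "X = 2 * ?K * (2 * (\<Sum>y\<in>S. W y powe \<alpha> * ktail a \<phi> y powe \<beta>) + 2 * 4 powe \<beta> * covering_sup (\<Psi>2 \<alpha> \<beta> \<phi>))"
  define S' where "S' = {y \<in> S. 0 < ?Q (z y)}"
  have finS': "finite S'" using fin by (simp add: S'_def)
  have z_mono: "z x \<le> z y" if "x \<in> S" "y \<in> S" "x \<le> y" for x y
    using that sep(1)[of x y] z[of y] by (cases "x = y") auto
  obtain A B e where AB: "S' = A \<union> B" "A \<inter> B = {}" "level_reps (\<lambda>y. ?Q (z y)) ?\<rho> A e" "level_reps (\<lambda>y. ?Q (z y)) ?\<rho> B e"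
  proof (rule level_grouping[OF finS', of ?\<rho> "\<lambda>y. ?Q (z y)"])
    show "1 < ?\<rho>" using rho by simp
    fix x assume x: "x \<in> S'"
    then have "0 < z x" using pos[of x] z[of x] by (auto simp: S'_def)
    then show "0 < ?Q (z x) \<and> ?Q (z x) < top"
      using x tail[of "z x"] \<beta> by (auto simp: S'_def Q_def intro!: powe_less_top)
    fix y assume "y \<in> S'" "x \<le> y"
    then show "?Q (z y) \<le> ?Q (z x)" using x \<beta> z_mono by (auto simp: S'_def intro!: Q_antimono)
  qed blast
  have part: "(\<Sum>x\<in>R. h x) \<le> 2 * ennreal ?\<rho> * X" if R: "level_reps (\<lambda>y. ?Q (z y)) ?\<rho> R e" "R \<subseteq> S'" for R
  proof -
    let ?Y = "e ` R"
    have finR: "finite R" and RS: "R \<subseteq> S" using R(2) fin by (auto simp: S'_def intro: finite_subset)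
    have eR: "?Y \<subseteq> R" using R(1) by (auto simp: level_reps_def)
    then have YS: "?Y \<subseteq> S" using RS by blast
    have fibre: "(\<Sum>x\<in>{x \<in> R. e x = y}. h x) \<le> 2 * ennreal ?\<rho> * (?Q (z y) * wk {0<..<y} (z y) powe \<alpha>)"
      if y: "y \<in> ?Y" for y
    proof -
      let ?F = "{x \<in> R. e x = y}" and ?P = "wk {0<..<y} (z y)"
      have yS: "y \<in> S" using y eR RS by auto
      have F: "x \<le> y" "?Q (z x) \<le> ennreal ?\<rho> * ?Q (z y)" "x \<in> S" if "x \<in> ?F" for x
        using that R(1) RS by (auto simp: level_reps_def)
      have bound: "h x \<le> (2 * wk {l x<..<x} (z y)) * ?P powe (\<alpha> - 1) * (ennreal ?\<rho> * ?Q (z y))" if x: "x \<in> ?F" for x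
      proof -
        have "W x * \<kappa> x (z x) powe q \<le> (2 * sint {l x<..<x} w) * \<kappa> x (z y) powe q"
          using F[OF x] l z_mono yS q0 by (intro mult_mono powe_mono mono) auto
        also have "\<dots> \<le> 2 * wk {l x<..<x} (z y)"
          unfolding mult.assoc by (intro mult_left_mono sint_w_kernel_le_wk) auto
        finally have 1: "W x * \<kappa> x (z x) powe q \<le> 2 * wk {l x<..<x} (z y)" .
        have 2: "G x powe (\<alpha> - 1) \<le> ?P powe (\<alpha> - 1)"
          unfolding G_def using \<alpha> F[OF x] z[OF yS] by (intro powe_mono wk_mono) auto
        have "h x = (W x * \<kappa> x (z x) powe q) * G x powe (\<alpha> - 1) * ?Q (z x)"
          by (simp add: h_def mult_ac)
        also have "\<dots> \<le> (2 * wk {l x<..<x} (z y)) * ?P powe (\<alpha> - 1) * (ennreal ?\<rho> * ?Q (z y))"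
          by (rule mult_mono[OF mult_mono[OF 1 2] F(2)[OF x]]) auto
        finally show ?thesis .
      qed
      have "(\<Sum>x\<in>?F. h x) \<le> (\<Sum>x\<in>?F. (2 * wk {l x<..<x} (z y)) * ?P powe (\<alpha> - 1) * (ennreal ?\<rho> * ?Q (z y)))"
        by (intro sum_mono bound)
      also have "\<dots> = 2 * ennreal ?\<rho> * (?Q (z y) * ((\<Sum>x\<in>?F. wk {l x<..<x} (z y)) * ?P powe (\<alpha> - 1)))"
        unfolding sum_distrib_left[symmetric] sum_distrib_right[symmetric] by (simp only: mult_ac)
      also have "\<dots> \<le> 2 * ennreal ?\<rho> * (?Q (z y) * (?P * ?P powe (\<alpha> - 1)))"
      proof (intro mult_left_mono mult_right_mono)
        show "(\<Sum>x\<in>?F. wk {l x<..<x} (z y)) \<le> ?P"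
          unfolding wk_def
        proof (rule sint_sum_disjoint_le)
          show "disjoint_family_on (\<lambda>x. {l x<..<x}) ?F"
            unfolding disjoint_family_on_def
          proof (intro ballI impI)
            fix x x' assume xx: "x \<in> ?F" "x' \<in> ?F" "x \<noteq> x'"
            then have "x \<le> l x' \<or> x' \<le> l x" using sep(2)[of x x'] sep(2)[of x' x] RS by (cases "x < x'") auto
            then show "{l x<..<x} \<inter> {l x'<..<x'} = {}" by auto
          qed
          show "(\<Union>x\<in>?F. {l x<..<x}) \<subseteq> {0<..<y}" using F l(1) by fastforce
        qed (use finR in auto)
      qed auto
      also have "?P * ?P powe (\<alpha> - 1) = ?P powe \<alpha>"
        using powe_add[of 1 "\<alpha> - 1" ?P] \<alpha> by simp
      finally show ?thesis .
    qed
    have "(\<Sum>x\<in>R. h x) = (\<Sum>y\<in>?Y. \<Sum>x\<in>{x \<in> R. e x = y}. h x)"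
      by (rule sum_level_reps[OF finR])
    also have "\<dots> \<le> (\<Sum>y\<in>?Y. 2 * ennreal ?\<rho> * (?Q (z y) * wk {0<..<y} (z y) powe \<alpha>))"
      by (intro sum_mono fibre)
    also have "\<dots> = 2 * ennreal ?\<rho> * (\<Sum>y\<in>?Y. ?Q (z y) * wk {0<..<y} (z y) powe \<alpha>)"
      by (simp add: sum_distrib_left)
    also have "\<dots> \<le> 2 * ennreal ?\<rho> * (2 * ?K * (2 * (\<Sum>y\<in>?Y. W y powe \<alpha> * ktail a \<phi> y powe \<beta>)
         + 2 * 4 powe \<beta> * covering_sup (\<Psi>2 \<alpha> \<beta> \<phi>)))"
    proof (intro mult_left_mono sum_level_reps_wk_le[OF assms(1) \<alpha> \<beta> a])
      fix x y assume xy: "x \<in> ?Y" "y \<in> ?Y" "x < y"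
      then obtain x0 y0 where "x0 \<in> R" "y0 \<in> R" "x = e x0" "y = e y0" by auto
      then have "ennreal ?\<rho> * ?Q (z y) \<le> ?Q (z x)" using R(1) xy(3) unfolding level_reps_def by auto
      then show "2 * ?K * ?Q (z y) \<le> ?Q (z x)"
        by (rule order_trans[rotated]) (intro mult_right_mono rho; simp)
    qed (use finR YS pos z sep(1) tail in \<open>(simp; fail | blast)+\<close>)
    also have "\<dots> \<le> 2 * ennreal ?\<rho> * X"
      unfolding X_def using eR RS fin
      by (intro mult_left_mono add_right_mono sum_mono2) auto
    finally show ?thesis .
  qed
  have "(\<Sum>x\<in>S. h x) = (\<Sum>x\<in>S'. h x)"
    by (rule sum.mono_neutral_right[OF fin]) (auto simp: S'_def h_def)
  also have "\<dots> = (\<Sum>x\<in>A. h x) + (\<Sum>x\<in>B. h x)"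
    unfolding AB(1) using finS' AB by (intro sum.union_disjoint) auto
  also have "\<dots> \<le> 2 * ennreal ?\<rho> * X + 2 * ennreal ?\<rho> * X"
    by (intro add_mono part AB) (use AB in auto)
  also have "\<dots> = 4 * ennreal ?\<rho> * X"
    by (simp add: distrib_right[symmetric])
  finally show ?thesis
    unfolding h_def X_def .
qed

end

text \<open>A point of near-maximum: the supremum need not be attained, but when finite and
  positive, half of it is exceeded somewhere.\<close>

lemma SUP_le_twice:
  fixes f :: "'a \<Rightarrow> ennreal"
  assumes "A \<noteq> {}" "(SUP z\<in>A. f z) < top"
  shows "\<exists>z\<in>A. (SUP z\<in>A. f z) \<le> 2 * f z"
proof (cases "(SUP z\<in>A. f z) = 0")
  case True
  then show ?thesis using assms(1) by auto
next
  case False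
  then obtain r where r: "(SUP z\<in>A. f z) = ennreal r" "0 < r"
    using assms(2) by (cases "SUP z\<in>A. f z") auto
  then have "ennreal (r / 2) < (SUP z\<in>A. f z)" by (simp add: ennreal_less_iff)
  then obtain z where z: "z \<in> A" "ennreal (r / 2) < f z" by (auto simp: less_SUP_iff)
  have "ennreal r = 2 * ennreal (r / 2)" using r by (simp add: ennreal_mult[symmetric] flip: ennreal_numeral)
  also have "\<dots> \<le> 2 * f z" using z by (intro mult_left_mono) auto
  finally show ?thesis using r z by auto
qed

text \<open>\<open>2 * tri \<theta> q\<close> comes from absorption, the next 2 from
  near-maximisers; the rest is the constant of \<open>sum_G_kernel_Q_le\<close>, with its sum of
  tails bounded through \<open>hardy_sum_const\<close>.\<close>

definition sup_sum_const :: "real \<Rightarrow> real \<Rightarrow> real \<Rightarrow> real \<Rightarrow> real \<Rightarrow> ennreal" where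
  "sup_sum_const \<theta> q \<alpha> \<beta> a = 2 * tri \<theta> q * (2 * (4 * ennreal (ratio (level_const \<theta> q \<alpha>)) *
     (2 * level_const \<theta> q \<alpha> * (2 * hardy_sum_const \<theta> \<alpha> \<beta> a + 2 * 4 powe \<beta>))))"

definition sup_dyadic_const :: "real \<Rightarrow> real \<Rightarrow> real \<Rightarrow> real \<Rightarrow> real \<Rightarrow> real \<Rightarrow> ennreal" where
  "sup_dyadic_const \<theta> q \<Lambda> \<alpha> \<beta> a = (2 * ennreal \<Lambda>) powe (\<alpha> - 1) * 2 powe (\<alpha> - 1) * ennreal \<Lambda> *
     (sup_sum_const \<theta> q \<alpha> \<beta> a + hardy_sum_const \<theta> \<alpha> \<beta> a)"

text \<open>Two recursions use the same sequence of points, so its ratio is built from the sum of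
  their constants and dominates each.\<close>

definition sup_const :: "real \<Rightarrow> real \<Rightarrow> real \<Rightarrow> real \<Rightarrow> real \<Rightarrow> ennreal" where
  "sup_const \<theta> q \<alpha> \<beta> a = sup_dyadic_const \<theta> q (ratio (split_const \<theta> a \<beta> + tri \<theta> q)) \<alpha> \<beta> a"

section \<open>The supremal term along the dyadic points\<close>

context weighted_kernel
begin

definition M :: "real \<Rightarrow> (real \<Rightarrow> ennreal) \<Rightarrow> real \<Rightarrow> ennreal" where
  "M \<beta> \<phi> t = (SUP z\<in>{t..}. \<kappa> t z powe q * Q \<beta> \<phi> z)"

lemma M_antimono:
  assumes "s \<le> t"
  shows "M \<beta> \<phi> t \<le> M \<beta> \<phi> s"
  unfolding M_def
proof (rule SUP_mono)
  fix z assume "z \<in> {t..}"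
  then show "\<exists>z'\<in>{s..}. \<kappa> t z powe q * Q \<beta> \<phi> z \<le> \<kappa> s z' powe q * Q \<beta> \<phi> z'"
    using assms q_pos by (intro bexI[of _ z]) (auto intro!: mult_right_mono powe_mono antimono)
qed

lemma M_measurable [measurable]: "M \<beta> \<phi> \<in> borel_measurable lebesgue"
  by (intro borel_lebesgue_measurable antimono_measurable_ennreal M_antimono)

lemma G_measurable [measurable]: "G \<in> borel_measurable lebesgue"
  by (intro borel_lebesgue_measurable mono_measurable_ennreal G_mono)

lemma M_SUP_trunc:
  assumes [measurable]: "\<phi> \<in> borel_measurable lebesgue" and "0 < \<beta>"
  shows "(SUP m. M \<beta> (trunc m \<phi>) t) = M \<beta> \<phi> t"
proof -
  have "(SUP m. Q \<beta> (trunc m \<phi>) z) = Q \<beta> \<phi> z" for z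
    using ktail_SUP_trunc[OF assms(1), of 0 z] by (simp add: Q_def ktail_def powe_SUP[OF assms(2), symmetric])
  then show ?thesis
    unfolding M_def by (subst SUP_commute) (simp add: SUP_mult_left_ennreal[symmetric])
qed

lemma M_mono_fun: "(\<And>y. \<phi> y \<le> \<psi> y) \<Longrightarrow> 0 \<le> \<beta> \<Longrightarrow> M \<beta> \<phi> t \<le> M \<beta> \<psi> t"
  unfolding M_def Q_def
  by (intro SUP_mono', intro mult_left_mono powe_mono sint_mono) auto

text \<open>The supremum over all \<open>z\<close> beyond \<open>x (Suc k)\<close> is reduced to
  \<open>z\<close> in the adjacent dyadic interval: for larger \<open>z\<close> the kernel is split
  at \<open>x k\<close>, which leads to the supremum at \<open>x k\<close> and is absorbed. The
  local suprema are then replaced by values at near-maximisers.\<close>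

lemma dyadic_sum_M_le:
  assumes [measurable]: "\<phi> \<in> borel_measurable lebesgue" and \<alpha>: "1 \<le> \<alpha>" and \<beta>: "0 < \<beta>" and a: "0 < a" "a * \<beta> = \<alpha> * q"
    and x: "dyadic \<Lambda> n x" and L2: "2 \<le> \<Lambda>" and L: "2 * split_const \<theta> a \<beta> \<le> ennreal \<Lambda> powe \<alpha>"
    and Lq: "2 * tri \<theta> q \<le> ennreal \<Lambda>"
    and supp: "\<And>y. n < y \<Longrightarrow> \<phi> y = 0" and fin: "\<And>t. ktail a \<phi> t < top" "\<And>t. 0 < t \<Longrightarrow> sint {t<..} \<phi> < top"
  shows "(\<Sum>k<N. W (x (Suc k)) * G (x (Suc k)) powe (\<alpha> - 1) * M \<beta> \<phi> (x (Suc k)))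
           \<le> sup_sum_const \<theta> q \<alpha> \<beta> a * (covering_sup (\<Psi>1 \<alpha> \<beta> a \<phi>) + covering_sup (\<Psi>2 \<alpha> \<beta> \<phi>))"
proof -
  let ?D1 = "covering_sup (\<Psi>1 \<alpha> \<beta> a \<phi>)" and ?D2 = "covering_sup (\<Psi>2 \<alpha> \<beta> \<phi>)"
  let ?Q = "Q \<beta> \<phi>" and ?K = "level_const \<theta> q \<alpha>" and ?\<rho> = "ennreal (ratio (level_const \<theta> q \<alpha>))"
  define u where "u k = W (x k) * G (x k) powe (\<alpha> - 1)" for k
  define L where "L k = (SUP z\<in>{x (Suc k)..x k}. \<kappa> (x (Suc k)) z powe q * ?Q z)" for k
  have xpos: "0 < x k" and xs: "x (Suc k) < x k" and x0: "x 0 = n" for k using dyadicD(1-3)[OF x] by auto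
  have q0: "0 \<le> q" using q_pos by simp
  \<comment> \<open>This gives both the zero start of the recursion and, since only \<open>z\<close>
    up to \<open>n\<close> count, the finiteness of \<open>M\<close>.\<close>
  have Q0: "?Q z = 0" if "n \<le> z" for z
  proof -
    have "sint {z<..} \<phi> = sint {z<..} (\<lambda>_. 0)" by (rule sint_cong) (use supp that in auto)
    then show ?thesis using \<beta> by (simp add: Q_def)
  qed
  have Mfin: "M \<beta> \<phi> y < top" if "0 < y" for y
  proof -
    have "M \<beta> \<phi> y \<le> \<kappa> y n powe q * ?Q y"
      unfolding M_def
    proof (rule SUP_least)
      fix z assume z: "z \<in> {y..}"
      show "\<kappa> y z powe q * ?Q z \<le> \<kappa> y n powe q * ?Q y"
      proof (cases "z \<le> n")
        case True
        then show ?thesis using z q0 \<beta> by (intro mult_mono powe_mono mono Q_antimono) auto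
      qed (use Q0[of z] in auto)
    qed
    also have "\<dots> < top"
      using finite fin(2)[OF that] q0 \<beta> by (auto simp: ennreal_mult_less_top Q_def intro!: powe_less_top)
    finally show ?thesis .
  qed
  have LM: "L k \<le> M \<beta> \<phi> (x (Suc k))" for k
    unfolding L_def M_def by (rule SUP_subset_mono) auto
  have Lfin: "L k < top" for k
    using LM Mfin[OF xpos] by (rule le_less_trans)
  have absorbed: "(\<Sum>k<N. u (Suc k) * M \<beta> \<phi> (x (Suc k))) \<le> 2 * tri \<theta> q * (\<Sum>k<N. u (Suc k) * L k)"
  proof (rule sum_absorb)
    fix k
    have t1: "1 \<le> tri \<theta> q" by (rule one_le_tri[OF theta q0])
    show "M \<beta> \<phi> (x (Suc k)) \<le> tri \<theta> q * (L k + M \<beta> \<phi> (x k))"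
      unfolding M_def[of _ _ "x (Suc k)"]
    proof (rule SUP_least)
      fix z assume z: "z \<in> {x (Suc k)..}"
      show "\<kappa> (x (Suc k)) z powe q * ?Q z \<le> tri \<theta> q * (L k + M \<beta> \<phi> (x k))"
      proof (cases "z \<le> x k")
        case True
        have "\<kappa> (x (Suc k)) z powe q * ?Q z \<le> L k"
          unfolding L_def using True z by (intro SUP_upper) auto
        also have "\<dots> \<le> 1 * (L k + M \<beta> \<phi> (x k))" by simp
        also have "\<dots> \<le> tri \<theta> q * (L k + M \<beta> \<phi> (x k))" by (intro mult_right_mono t1) simp
        finally show ?thesis .
      next
        case False
        have "\<kappa> (x (Suc k)) z powe q * ?Q z
            \<le> (tri \<theta> q * (\<kappa> (x (Suc k)) (x k) powe q + \<kappa> (x k) z powe q)) * ?Q z"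
          using False xs[of k] q0 by (intro mult_right_mono triangle_powe) auto
        also have "\<dots> = tri \<theta> q * (\<kappa> (x (Suc k)) (x k) powe q * ?Q z + \<kappa> (x k) z powe q * ?Q z)"
          by (simp only: algebra_simps)
        also have "\<dots> \<le> tri \<theta> q * (\<kappa> (x (Suc k)) (x k) powe q * ?Q (x k) + \<kappa> (x k) z powe q * ?Q z)"
          using False \<beta> by (intro mult_left_mono add_right_mono Q_antimono) auto
        also have "\<dots> \<le> tri \<theta> q * (L k + M \<beta> \<phi> (x k))"
          unfolding L_def M_def using False xs[of k] less_imp_le
          by (intro mult_left_mono add_mono SUP_upper) auto
        finally show ?thesis .
      qed
    qed
    \<comment> \<open>The decay comes from \<open>W\<close> alone, which gains the factor \<Lambda>;
      of \<open>G\<close> only monotonicity is used.\<close>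
    have "2 * tri \<theta> q * u (Suc k) \<le> (ennreal \<Lambda> * W (x (Suc k))) * G (x (Suc k)) powe (\<alpha> - 1)"
      unfolding u_def mult.assoc[symmetric] by (intro mult_right_mono Lq) auto
    also have "\<dots> \<le> u k"
      unfolding u_def using dyadicD(4)[OF x, of k] \<alpha> xs[of k]
      by (intro mult_mono powe_mono G_mono) auto
    finally show "2 * tri \<theta> q * u (Suc k) \<le> u k" .
    show "u k * M \<beta> \<phi> (x k) < top"
      using W_less_top Mfin[OF xpos] wk_less_top \<alpha>
      by (auto simp: u_def G_def ennreal_mult_less_top intro!: powe_less_top)
  next
    show "M \<beta> \<phi> (x 0) = 0"
      unfolding M_def x0 by (rule antisym) (auto intro!: SUP_least simp: Q0)
  qed
  have "\<exists>z\<in>{x (Suc k)..x k}. L k \<le> 2 * (\<kappa> (x (Suc k)) z powe q * ?Q z)" for k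
    unfolding L_def by (rule SUP_le_twice) (use xs[of k] Lfin[of k] in \<open>auto simp: L_def\<close>)
  \<comment> \<open>The near-maximisers lie between consecutive dyadic points, which is the
    separation required by \<open>sum_G_kernel_Q_le\<close>.\<close>
  then obtain \<zeta> where \<zeta>: "x (Suc k) \<le> \<zeta> k" "\<zeta> k \<le> x k" "L k \<le> 2 * (\<kappa> (x (Suc k)) (\<zeta> k) powe q * ?Q (\<zeta> k))" for k
    by (metis atLeastAtMost_iff)
  define s where "s k = x (Suc k)" for k
  have inj: "inj_on s {..<N}" using dyadic_inj[OF x] by (auto simp: s_def inj_def inj_on_def)
  define f where "f = the_inv_into {..<N} s"
  have f: "f (s k) = k" if "k < N" for k using inj that by (simp add: f_def the_inv_into_f_f)
  have B: "(\<Sum>y\<in>s ` {..<N}. W y powe \<alpha> * ktail a \<phi> y powe \<beta>) \<le> hardy_sum_const \<theta> \<alpha> \<beta> a * (?D1 + ?D2)"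
    unfolding sum.reindex[OF inj] comp_def unfolding s_def
    by (rule dyadic_sum_ktail_le[OF assms(1) \<alpha> \<beta> a x L2 L supp fin])
  have "(\<Sum>k<N. u (Suc k) * L k) \<le> (\<Sum>k<N. 2 * (u (Suc k) * (\<kappa> (s k) (\<zeta> k) powe q * ?Q (\<zeta> k))))"
  proof (rule sum_mono)
    fix k
    show "u (Suc k) * L k \<le> 2 * (u (Suc k) * (\<kappa> (s k) (\<zeta> k) powe q * ?Q (\<zeta> k)))"
      using mult_left_mono[OF \<zeta>(3)[of k], of "u (Suc k)"] by (simp add: s_def mult_ac)
  qed
  also have "\<dots> = 2 * (\<Sum>k<N. u (Suc k) * (\<kappa> (s k) (\<zeta> k) powe q * ?Q (\<zeta> k)))"
    by (simp only: sum_distrib_left)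
  also have "(\<Sum>k<N. u (Suc k) * (\<kappa> (s k) (\<zeta> k) powe q * ?Q (\<zeta> k)))
     = (\<Sum>y\<in>s ` {..<N}. W y * G y powe (\<alpha> - 1) * (\<kappa> y ((\<zeta> \<circ> f) y) powe q * ?Q ((\<zeta> \<circ> f) y)))"
    by (subst sum.reindex[OF inj]) (auto simp: f u_def s_def[symmetric])
  also have "2 * \<dots> \<le> 2 * (4 * ?\<rho> * (2 * ?K * (2 * (\<Sum>y\<in>s ` {..<N}. W y powe \<alpha> * ktail a \<phi> y powe \<beta>)
      + 2 * 4 powe \<beta> * ?D2)))"
  proof (intro mult_left_mono sum_G_kernel_Q_le[OF assms(1) \<alpha> \<beta> a, where l = "\<lambda>y. x (Suc (Suc (f y)))"])
    fix y assume "y \<in> s ` {..<N}"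
    then obtain i where i: "i < N" "y = s i" by auto
    show "0 < y" using xpos i by (simp add: s_def)
    show "y \<le> (\<zeta> \<circ> f) y" using \<zeta>(1)[of i] i by (simp add: f) (simp add: s_def)
    show "0 \<le> x (Suc (Suc (f y)))" using xpos by (simp add: less_imp_le)
    show "W y \<le> 2 * sint {x (Suc (Suc (f y)))<..<y} w"
      using dyadic_W_le[OF x L2, of "Suc i"] i by (simp add: f) (simp add: s_def)
  next
    fix y y' assume "y \<in> s ` {..<N}" "y' \<in> s ` {..<N}" "y < y'"
    then obtain i j where ij: "i < N" "y = s i" "j < N" "y' = s j" by auto
    then have "j < i" using \<open>y < y'\<close> by (simp add: s_def dyadic_less_iff[OF x])
    then have "x i \<le> x (Suc j)" "x (Suc i) \<le> x (Suc (Suc j))" by (auto intro!: dyadic_antimono[OF x])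
    then show "(\<zeta> \<circ> f) y \<le> y'" "y \<le> x (Suc (Suc (f y')))"
      using \<zeta>(2)[of i] ij by (simp_all add: f) (simp_all add: s_def)
  qed (use fin in auto)
  also have "\<dots> \<le> 2 * (4 * ?\<rho> * (2 * ?K * (2 * (hardy_sum_const \<theta> \<alpha> \<beta> a * (?D1 + ?D2)) + 2 * 4 powe \<beta> * (?D1 + ?D2))))"
    by (intro mult_left_mono add_mono B) auto
  also have "\<dots> = 2 * (4 * ?\<rho> * (2 * ?K * (2 * hardy_sum_const \<theta> \<alpha> \<beta> a + 2 * 4 powe \<beta>))) * (?D1 + ?D2)"
    by (simp only: distrib_right mult.assoc)
  finally have "2 * tri \<theta> q * (\<Sum>k<N. u (Suc k) * L k) \<le> sup_sum_const \<theta> q \<alpha> \<beta> a * (?D1 + ?D2)"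
    unfolding sup_sum_const_def mult.assoc by (intro mult_left_mono) auto
  with absorbed show ?thesis
    unfolding u_def by (rule order_trans)
qed

text \<open>\<open>G\<close> can increase by an uncontrolled factor over a dyadic interval, so its
  value at the right end is of no use. Instead \<open>G t\<close> is compared with its value at the
  left end plus a kernel jump; the first part leads to the sum with \<open>M\<close>, the jump part
  to the sum with kernel tails.\<close>

lemma dyadic_sup_integral_le:
  assumes [measurable]: "\<phi> \<in> borel_measurable lebesgue" and \<alpha>: "1 \<le> \<alpha>" and \<beta>: "0 < \<beta>" and a: "0 < a" "a * \<beta> = \<alpha> * q"
    and x: "dyadic \<Lambda> n x" and L2: "2 \<le> \<Lambda>" and L: "2 * split_const \<theta> a \<beta> \<le> ennreal \<Lambda> powe \<alpha>"
    and Lq: "2 * tri \<theta> q \<le> ennreal \<Lambda>"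
    and supp: "\<And>y. n < y \<Longrightarrow> \<phi> y = 0" and fin: "\<And>t. ktail a \<phi> t < top" "\<And>t. 0 < t \<Longrightarrow> sint {t<..} \<phi> < top"
  shows "sint {0<..<n} (\<lambda>t. G t powe (\<alpha> - 1) * w t * M \<beta> \<phi> t)
           \<le> sup_dyadic_const \<theta> q \<Lambda> \<alpha> \<beta> a * (covering_sup (\<Psi>1 \<alpha> \<beta> a \<phi>) + covering_sup (\<Psi>2 \<alpha> \<beta> \<phi>))"
proof (rule dyadic_integral_le[OF x])
  let ?c = "(2 * ennreal \<Lambda>) powe (\<alpha> - 1) * 2 powe (\<alpha> - 1)"
  let ?D = "covering_sup (\<Psi>1 \<alpha> \<beta> a \<phi>) + covering_sup (\<Psi>2 \<alpha> \<beta> \<phi>)"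
  define g where "g y = W y * G y powe (\<alpha> - 1) * M \<beta> \<phi> y + W y powe \<alpha> * ktail a \<phi> y powe \<beta>" for y
  have \<alpha>1: "0 \<le> \<alpha> - 1" and q0: "0 \<le> q" using \<alpha> q_pos by auto
  show "(\<lambda>t. G t powe (\<alpha> - 1) * w t * M \<beta> \<phi> t) \<in> borel_measurable lebesgue" by measurable
  show "(\<Sum>k<N. ?c * ennreal \<Lambda> * g (x (Suc k))) \<le> sup_dyadic_const \<theta> q \<Lambda> \<alpha> \<beta> a * ?D" for N
  proof -
    have "(\<Sum>k<N. g (x (Suc k))) \<le> sup_sum_const \<theta> q \<alpha> \<beta> a * ?D + hardy_sum_const \<theta> \<alpha> \<beta> a * ?D"
      unfolding g_def sum.distrib
      by (intro add_mono dyadic_sum_M_le[OF assms(1) \<alpha> \<beta> a x L2 L Lq supp fin]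
          dyadic_sum_ktail_le[OF assms(1) \<alpha> \<beta> a x L2 L supp fin])
    then show ?thesis
      unfolding sup_dyadic_const_def sum_distrib_left[symmetric] mult.assoc distrib_right
      by (intro mult_left_mono) auto
  qed
  fix k
  let ?y = "x (Suc k)"
  have xs: "?y < x k" "0 < ?y" using dyadicD[OF x] by auto
  have point: "G t powe (\<alpha> - 1) * w t * M \<beta> \<phi> t
      \<le> ?c * (G ?y powe (\<alpha> - 1) * M \<beta> \<phi> ?y + W ?y powe (\<alpha> - 1) * ktail a \<phi> ?y powe \<beta>) * w t"
    if t: "?y < t" "t < x k" for t
  proof -
    let ?v = "\<kappa> ?y t powe q"
    have "G t \<le> wk {0<..?y} t + wk {?y<..<t} t"
      unfolding G_def by (rule wk_Un_le) auto
    also have "wk {0<..?y} t = wk {0<..<?y} t"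
      unfolding wk_def by (rule sint_remove_endpoints)
    finally have "G t \<le> wk {0<..<?y} t + wk {?y<..<t} t" .
    moreover have "wk {0<..<?y} t \<le> ennreal \<Lambda> * (G ?y + W ?y * ?v)"
    proof -
      have "tri \<theta> q \<le> 2 * tri \<theta> q" by (simp add: mult_2)
      then have tl: "tri \<theta> q \<le> ennreal \<Lambda>" using Lq by (rule order_trans)
      have "wk {0<..<?y} t \<le> tri \<theta> q * (wk {0<..<?y} ?y + sint {0<..<?y} w * ?v)"
        by (rule wk_triangle) (use t in auto)
      also have "\<dots> \<le> ennreal \<Lambda> * (G ?y + W ?y * ?v)"
        unfolding G_def W_def by (rule mult_right_mono[OF tl]) simp
      finally show ?thesis .
    qed
    \<comment> \<open>Here the kernel is at most \<open>\<kappa> y t\<close> and the mass at most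
      \<open>W (x k)\<close>, which is \<Lambda> times \<open>W y\<close>; this piece is again a
      jump term.\<close>
    moreover have "wk {?y<..<t} t \<le> ennreal \<Lambda> * (G ?y + W ?y * ?v)"
    proof -
      have "wk {?y<..<t} t \<le> sint {?y<..<t} (\<lambda>s. ?v * w s)"
        unfolding wk_def using q0
        by (intro sint_mono) (auto simp: mult.commute[of "w _"] intro!: mult_right_mono powe_mono antimono)
      also have "\<dots> = ?v * sint {?y<..<t} w" by (rule sint_cmult) auto
      also have "\<dots> \<le> ?v * W (x k)"
        unfolding W_def using t xs by (intro mult_left_mono sint_mono) auto
      also have "\<dots> = ennreal \<Lambda> * (W ?y * ?v)"
        using dyadicD(4)[OF x, of k] by (simp add: mult_ac)
      also have "\<dots> \<le> ennreal \<Lambda> * (G ?y + W ?y * ?v)"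
        by (intro mult_left_mono) auto
      finally show ?thesis .
    qed
    ultimately have "G t \<le> ennreal \<Lambda> * (G ?y + W ?y * ?v) + ennreal \<Lambda> * (G ?y + W ?y * ?v)"
      by (meson add_mono order_trans)
    then have "G t \<le> (2 * ennreal \<Lambda>) * (G ?y + W ?y * ?v)"
      by (simp add: mult_2 distrib_right)
    then have "G t powe (\<alpha> - 1) \<le> (2 * ennreal \<Lambda>) powe (\<alpha> - 1) * (G ?y + W ?y * ?v) powe (\<alpha> - 1)"
      unfolding powe_mult[OF \<alpha>1, symmetric] by (rule powe_mono) (rule \<alpha>1)
    also have "\<dots> \<le> (2 * ennreal \<Lambda>) powe (\<alpha> - 1) * (2 powe (\<alpha> - 1) * (G ?y powe (\<alpha> - 1) + (W ?y * ?v) powe (\<alpha> - 1)))"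
      by (intro mult_left_mono powe_add_le \<alpha>1) simp
    finally have Gt: "G t powe (\<alpha> - 1) \<le> ?c * (G ?y powe (\<alpha> - 1) + W ?y powe (\<alpha> - 1) * ?v powe (\<alpha> - 1))"
      by (simp add: powe_mult[OF \<alpha>1] mult.assoc)
    \<comment> \<open>Both \<open>\<kappa> y t\<close> and \<open>\<kappa> t z\<close> are at most
      \<open>\<kappa> y z\<close>, so the powers \<open>\<alpha> - 1\<close> and 1 combine into the
      \<alpha>th power, which a tail at \<open>y\<close> controls.\<close>
    have vM: "?v powe (\<alpha> - 1) * M \<beta> \<phi> t \<le> ktail a \<phi> ?y powe \<beta>"
      unfolding M_def SUP_mult_left_ennreal
    proof (rule SUP_least)
      fix z assume z: "z \<in> {t..}"
      have "?v powe (\<alpha> - 1) * (\<kappa> t z powe q * Q \<beta> \<phi> z)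
          \<le> (\<kappa> ?y z powe q) powe (\<alpha> - 1) * (\<kappa> ?y z powe q * Q \<beta> \<phi> z)"
        using z t \<alpha>1 q0 by (intro mult_mono powe_mono mono antimono) auto
      also have "\<dots> = (\<kappa> ?y z powe q) powe \<alpha> * Q \<beta> \<phi> z"
        using powe_add[of "\<alpha> - 1" 1 "\<kappa> ?y z powe q"] \<alpha> by (simp add: mult.assoc)
      also have "\<dots> \<le> ktail a \<phi> ?y powe \<beta>"
        using z t \<alpha> \<beta> a by (intro kernel_Q_le_ktail) auto
      finally show "?v powe (\<alpha> - 1) * (\<kappa> t z powe q * Q \<beta> \<phi> z) \<le> ktail a \<phi> ?y powe \<beta>" .
    qed
    have "G t powe (\<alpha> - 1) * M \<beta> \<phi> t \<le> ?c * (G ?y powe (\<alpha> - 1) + W ?y powe (\<alpha> - 1) * ?v powe (\<alpha> - 1)) * M \<beta> \<phi> t"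
      by (rule mult_right_mono[OF Gt]) simp
    also have "\<dots> = ?c * (G ?y powe (\<alpha> - 1) * M \<beta> \<phi> t + W ?y powe (\<alpha> - 1) * (?v powe (\<alpha> - 1) * M \<beta> \<phi> t))"
      by (simp only: algebra_simps)
    also have "\<dots> \<le> ?c * (G ?y powe (\<alpha> - 1) * M \<beta> \<phi> ?y + W ?y powe (\<alpha> - 1) * ktail a \<phi> ?y powe \<beta>)"
      using t by (intro mult_left_mono add_mono vM M_antimono) auto
    finally have "G t powe (\<alpha> - 1) * M \<beta> \<phi> t * w t
      \<le> ?c * (G ?y powe (\<alpha> - 1) * M \<beta> \<phi> ?y + W ?y powe (\<alpha> - 1) * ktail a \<phi> ?y powe \<beta>) * w t"
      by (rule mult_right_mono) simp
    then show ?thesis by (simp only: mult_ac)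
  qed
  have "sint {?y<..<x k} (\<lambda>t. G t powe (\<alpha> - 1) * w t * M \<beta> \<phi> t)
    \<le> sint {?y<..<x k} (\<lambda>t. ?c * (G ?y powe (\<alpha> - 1) * M \<beta> \<phi> ?y + W ?y powe (\<alpha> - 1) * ktail a \<phi> ?y powe \<beta>) * w t)"
    by (rule sint_mono) (auto intro: point)
  also have "\<dots> = ?c * (G ?y powe (\<alpha> - 1) * M \<beta> \<phi> ?y + W ?y powe (\<alpha> - 1) * ktail a \<phi> ?y powe \<beta>) * sint {?y<..<x k} w"
    by (rule sint_cmult) auto
  also have "\<dots> \<le> ?c * (G ?y powe (\<alpha> - 1) * M \<beta> \<phi> ?y + W ?y powe (\<alpha> - 1) * ktail a \<phi> ?y powe \<beta>) * W (x k)"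
    unfolding W_def[of "x k"] using xs by (intro mult_left_mono sint_mono) auto
  also have "\<dots> = ?c * ennreal \<Lambda> * (W ?y * G ?y powe (\<alpha> - 1) * M \<beta> \<phi> ?y + (W ?y powe (\<alpha> - 1) * W ?y) * ktail a \<phi> ?y powe \<beta>)"
    unfolding dyadicD(4)[OF x, of k] by (simp only: algebra_simps)
  also have "W ?y powe (\<alpha> - 1) * W ?y = W ?y powe \<alpha>"
    using powe_add[of "\<alpha> - 1" 1 "W ?y"] \<alpha> by simp
  finally show "sint {?y<..<x k} (\<lambda>t. G t powe (\<alpha> - 1) * w t * M \<beta> \<phi> t) \<le> ?c * ennreal \<Lambda> * g ?y"
    unfolding g_def .
qed

lemma sup_integral_le:
  assumes [measurable]: "\<phi> \<in> borel_measurable lebesgue" and \<alpha>: "1 \<le> \<alpha>" and \<beta>: "0 < \<beta>" and a: "0 < a" "a * \<beta> = \<alpha> * q"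
  shows "sint {0<..} (\<lambda>t. G t powe (\<alpha> - 1) * w t * M \<beta> \<phi> t)
           \<le> sup_const \<theta> q \<alpha> \<beta> a * (covering_sup (\<Psi>1 \<alpha> \<beta> a \<phi>) + covering_sup (\<Psi>2 \<alpha> \<beta> \<phi>))"
proof -
  let ?c = "split_const \<theta> a \<beta> + tri \<theta> q"
  let ?L = "ratio ?c"
  have q0: "0 \<le> q" and a0: "0 \<le> a" and \<beta>0: "0 \<le> \<beta>" using q_pos a \<beta> by auto
  have c: "2 * ?c \<le> ennreal ?L"
    using split_const_less_top[OF a0 \<beta>0, of \<theta>] tri_less_top[OF q0, of \<theta>] by (intro ratio_ge) simp
  have L2: "2 \<le> ?L" by (rule ratio_ge)
  have Lq: "2 * tri \<theta> q \<le> ennreal ?L" by (rule order_trans[OF _ c]) (auto intro!: mult_left_mono)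
  have L: "2 * split_const \<theta> a \<beta> \<le> ennreal ?L powe \<alpha>"
  proof -
    have "1 \<le> ennreal ?L" using ennreal_leI[of 1 ?L] L2 by simp
    then have "ennreal ?L \<le> ennreal ?L powe \<alpha>" by (rule le_powe[OF _ \<alpha>])
    moreover have "2 * split_const \<theta> a \<beta> \<le> ennreal ?L" by (rule order_trans[OF _ c]) (auto intro!: mult_left_mono)
    ultimately show ?thesis by (rule order_trans[rotated])
  qed
  have "sint {0<..} (\<lambda>t. (G t powe (\<alpha> - 1) * w t) * (SUP m. M \<beta> (trunc m \<phi>) t))
    \<le> sup_const \<theta> q \<alpha> \<beta> a * (covering_sup (\<Psi>1 \<alpha> \<beta> a \<phi>) + covering_sup (\<Psi>2 \<alpha> \<beta> \<phi>))"
  proof (rule trunc_limit_integral_le)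
    show "incseq (\<lambda>m. M \<beta> (trunc m \<phi>) t)" for t
      using incseq_trunc[of \<phi>] \<beta> by (auto simp: incseq_def intro!: M_mono_fun)
    fix m :: nat assume "0 < m"
    obtain x where x: "dyadic ?L (real m) x"
      by (rule dyadic_exists[of ?L "real m"]) (use L2 \<open>0 < m\<close> in auto)
    have "sint {0<..<real m} (\<lambda>t. G t powe (\<alpha> - 1) * w t * M \<beta> (trunc m \<phi>) t)
      \<le> sup_const \<theta> q \<alpha> \<beta> a * (covering_sup (\<Psi>1 \<alpha> \<beta> a (trunc m \<phi>)) + covering_sup (\<Psi>2 \<alpha> \<beta> (trunc m \<phi>)))"
      unfolding sup_const_def
      by (rule dyadic_sup_integral_le[OF _ \<alpha> \<beta> a x L2 L Lq])
         (use a0 in \<open>auto intro!: ktail_trunc_less_top sint_trunc_less_top simp: trunc_eq_0\<close>)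
    also have "\<dots> \<le> sup_const \<theta> q \<alpha> \<beta> a * (covering_sup (\<Psi>1 \<alpha> \<beta> a \<phi>) + covering_sup (\<Psi>2 \<alpha> \<beta> \<phi>))"
      using \<beta> by (intro mult_left_mono add_mono \<Psi>1_sup_mono_fun \<Psi>2_sup_mono_fun trunc_le) auto
    finally show "sint {0<..<real m} (\<lambda>t. G t powe (\<alpha> - 1) * w t * M \<beta> (trunc m \<phi>) t)
      \<le> sup_const \<theta> q \<alpha> \<beta> a * (covering_sup (\<Psi>1 \<alpha> \<beta> a \<phi>) + covering_sup (\<Psi>2 \<alpha> \<beta> \<phi>))" .
  qed measurable
  then show ?thesis
    unfolding M_SUP_trunc[OF assms(1) \<beta>] .
qed

end

subsection \<open>Hoelder's inequality\<close>

lemma Young_ennreal: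
  fixes x y :: ennreal
  assumes s: "1 < s" "1 < s'" "1 / s + 1 / s' = 1"
  shows "x * y \<le> ennreal (1 / s) * x powe s + ennreal (1 / s') * y powe s'"
proof (cases "x = top \<or> y = top")
  case True
  then show ?thesis
    using s by (cases "x = 0 \<or> y = 0") (auto simp: ennreal_mult_top ennreal_top_mult)
next
  case False
  then obtain a b where ab: "x = ennreal a" "y = ennreal b" "0 \<le> a" "0 \<le> b"
    by (cases x; cases y) auto
  have "a * b \<le> a powr s / s + b powr s' / s'"
    by (rule Youngs_inequality) (use s ab in auto)
  then have "ennreal (a * b) \<le> ennreal (1 / s * a powr s + 1 / s' * b powr s')"
    by (intro ennreal_leI) simp
  also have "\<dots> = ennreal (1 / s) * x powe s + ennreal (1 / s') * y powe s'"
    using ab s by (simp add: ennreal_plus ennreal_powe ennreal_mult[symmetric])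
  finally show ?thesis using ab by (simp add: ennreal_mult)
qed

lemma Holder_nn_integral:
  assumes [measurable]: "f \<in> borel_measurable N" "g \<in> borel_measurable N"
    and s: "1 < s" "1 < s'" "1 / s + 1 / s' = 1"
  shows "(\<integral>\<^sup>+x. f x * g x \<partial>N) \<le> (\<integral>\<^sup>+x. f x powe s \<partial>N) powe (1 / s) * (\<integral>\<^sup>+x. g x powe s' \<partial>N) powe (1 / s')"
proof -
  define A where "A = (\<integral>\<^sup>+x. f x powe s \<partial>N)"
  define B where "B = (\<integral>\<^sup>+x. g x powe s' \<partial>N)"
  consider "A = 0" | "B = 0" | "A \<noteq> 0" "B \<noteq> 0" "A = top \<or> B = top" | "A \<noteq> 0" "B \<noteq> 0" "A \<noteq> top" "B \<noteq> top" by blast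
  then have "(\<integral>\<^sup>+x. f x * g x \<partial>N) \<le> A powe (1 / s) * B powe (1 / s')"
  proof cases
    case 1
    then have "AE x in N. f x powe s = 0" unfolding A_def by (subst (asm) nn_integral_0_iff_AE) auto
    then have "(\<integral>\<^sup>+x. f x * g x \<partial>N) = (\<integral>\<^sup>+x. 0 \<partial>N)"
      by (intro nn_integral_cong_AE) (use s in \<open>auto simp: powe_eq_0_iff elim: eventually_mono\<close>)
    then show ?thesis by simp
  next
    case 2
    then have "AE x in N. g x powe s' = 0" unfolding B_def by (subst (asm) nn_integral_0_iff_AE) auto
    then have "(\<integral>\<^sup>+x. f x * g x \<partial>N) = (\<integral>\<^sup>+x. 0 \<partial>N)"
      by (intro nn_integral_cong_AE) (use s in \<open>auto simp: powe_eq_0_iff elim: eventually_mono\<close>)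
    then show ?thesis by simp
  next
    case 3
    then have "A powe (1 / s) * B powe (1 / s') = top"
      using s powe_eq_0_iff[of "1 / s" A] powe_eq_0_iff[of "1 / s'" B] by (auto simp: ennreal_mult_top ennreal_top_mult)
    then show ?thesis by simp
  next
    case 4
    then obtain a b where ab: "A = ennreal a" "B = ennreal b" "0 < a" "0 < b"
      by (cases A; cases B) auto
    define u where "u = a powr (1 / s)"
    define v where "v = b powr (1 / s')"
    have uv: "0 < u" "0 < v" "u powr s = a" "v powr s' = b"
      using ab s by (auto simp: u_def v_def powr_powr)
    define x where "x t = ennreal (1 / u) * f t" for t
    define y where "y t = ennreal (1 / v) * g t" for t
    have [measurable]: "x \<in> borel_measurable N" "y \<in> borel_measurable N"
      unfolding x_def y_def by measurable
    have ix: "(\<integral>\<^sup>+t. x t powe s \<partial>N) = 1"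
    proof -
      have "(\<integral>\<^sup>+t. x t powe s \<partial>N) = ennreal (1 / u) powe s * A"
        unfolding x_def A_def using s by (simp add: powe_mult nn_integral_cmult)
      also have "\<dots> = ennreal ((1 / u) powr s * a)"
        using uv s ab by (simp add: ennreal_powe ennreal_mult)
      also have "(1 / u) powr s * a = 1" using uv ab by (simp add: powr_divide)
      finally show ?thesis by simp
    qed
    have iy: "(\<integral>\<^sup>+t. y t powe s' \<partial>N) = 1"
    proof -
      have "(\<integral>\<^sup>+t. y t powe s' \<partial>N) = ennreal (1 / v) powe s' * B"
        unfolding y_def B_def using s by (simp add: powe_mult nn_integral_cmult)
      also have "\<dots> = ennreal ((1 / v) powr s' * b)"
        using uv s ab by (simp add: ennreal_powe ennreal_mult)
      also have "(1 / v) powr s' * b = 1" using uv ab by (simp add: powr_divide)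
      finally show ?thesis by simp
    qed
    have fx: "f t = ennreal u * x t" "g t = ennreal v * y t" for t
      unfolding x_def y_def mult.assoc[symmetric] using uv by (simp_all add: ennreal_mult[symmetric])
    have "(\<integral>\<^sup>+t. f t * g t \<partial>N) = (\<integral>\<^sup>+t. (ennreal u * ennreal v) * (x t * y t) \<partial>N)"
      unfolding fx by (simp only: mult_ac)
    also have "\<dots> = (ennreal u * ennreal v) * (\<integral>\<^sup>+t. x t * y t \<partial>N)"
      by (rule nn_integral_cmult) measurable
    also have "(\<integral>\<^sup>+t. x t * y t \<partial>N) \<le> (\<integral>\<^sup>+t. ennreal (1 / s) * x t powe s + ennreal (1 / s') * y t powe s' \<partial>N)"
      by (intro nn_integral_mono Young_ennreal s)
    also have "\<dots> = ennreal (1 / s) + ennreal (1 / s')"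
      by (simp add: nn_integral_add nn_integral_cmult ix iy)
    also have "\<dots> = ennreal (1 / s + 1 / s')" using s by (intro ennreal_plus[symmetric]) auto
    also have "\<dots> = 1" using s by simp
    finally have "(\<integral>\<^sup>+t. f t * g t \<partial>N) \<le> ennreal u * ennreal v"
      by (simp add: mult_left_mono)
    also have "\<dots> = A powe (1 / s) * B powe (1 / s')"
      using ab s by (simp add: u_def v_def ennreal_powe)
    finally show ?thesis .
  qed
  then show ?thesis unfolding A_def B_def .
qed

lemma Holder_sum:
  fixes f g :: "'i \<Rightarrow> ennreal"
  assumes "finite I" and s: "1 < s" "1 < s'" "1 / s + 1 / s' = 1"
  shows "(\<Sum>i\<in>I. f i * g i) \<le> (\<Sum>i\<in>I. f i powe s) powe (1 / s) * (\<Sum>i\<in>I. g i powe s') powe (1 / s')"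
  using Holder_nn_integral[of f "count_space I" g s s'] assms by (simp add: nn_integral_count_space_finite)

subsection \<open>Dual weights\<close>

lemma conjugate_exponent:
  fixes p p' :: real
  assumes "1 < p" "p' = p / (p - 1)"
  shows "1 < p'" "1 / p' + 1 / p = 1" "1 - p' = - (1 / (p - 1))" "(1 - p') * (1 / p') = - (1 / p)" "(p' - 1) * p = p'"
  unfolding assms(2) using assms(1) by (simp_all add: field_simps)

lemma gap_exponent:
  fixes p q r :: real
  assumes "0 < q" "q < p" "r = p * q / (p - q)"
  shows "0 < r" "1 < r / q" "1 / (r / q) + 1 / (p / q) = 1" "1 / q = 1 / r + 1 / p" "q / r + q / p = 1"
    "r / q = 1 + r / p" "r / q * ((p - q) / q) = p / q" "r * ((p - q) / q) = p"
  unfolding assms(3) using assms(1,2) by (simp_all add: field_simps)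

text \<open>\<open>p - 1\<close> and \<open>1 - p'\<close> multiply to -1, so
  \<open>(x powe (1 - p')) powe (p - 1)\<close> is the reciprocal of \<open>x\<close>. Where
  \<open>x\<close> is 0 or \<infinity> the product is 0 by convention, hence an inequality rather
  than an identity.\<close>

lemma dual_weight_bound:
  fixes x :: ennreal
  assumes "1 < p" "p' = p / (p - 1)" "\<phi> \<le> x powe (1 - p')"
  shows "\<phi> powe p * x \<le> \<phi>"
proof -
  note p' = conjugate_exponent[OF assms(1,2)]
  have "(x powe (1 - p')) powe (p - 1) * x \<le> 1"
  proof (cases "x = 0 \<or> x = top")
    case True
    then show ?thesis using assms(1) p'(1,3) by (auto simp: ennreal_powr_def)
  next
    case False
    then obtain r where r: "x = ennreal r" "0 < r" by (cases x) auto
    have "x powe (1 - p') = ennreal (r powr (1 - p'))" using r assms(1) p' by (simp add: ennreal_powr_def)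
    moreover have "(r powr (1 - p')) powr (p - 1) = r powr (- 1)"
      unfolding powr_powr p'(3) using assms(1) by simp
    ultimately show ?thesis
      using r assms(1) by (simp add: ennreal_powe ennreal_mult[symmetric] powr_minus_divide)
  qed
  moreover have "\<phi> powe (p - 1) * x \<le> (x powe (1 - p')) powe (p - 1) * x"
    using assms by (intro mult_right_mono powe_mono) auto
  ultimately have "\<phi> powe (p - 1) * x \<le> 1" by (rule order_trans[rotated])
  then have "\<phi> * (\<phi> powe (p - 1) * x) \<le> \<phi> * 1" by (intro mult_left_mono) auto
  then show ?thesis
    using powe_add[of 1 "p - 1" \<phi>] assms by (simp add: mult.assoc)
qed

lemma dual_weight_prod:
  fixes x :: ennreal
  assumes "1 < p" "p' = p / (p - 1)" "x \<noteq> 0" "x \<noteq> top"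
  shows "x powe (1 / p) * (x powe (1 - p')) powe (1 / p') = 1"
proof -
  have p': "1 - p' < 0" "0 < p'" "(1 - p') * (1 / p') = - (1 / p)"
    using conjugate_exponent(1)[OF assms(1,2)] conjugate_exponent(4)[OF assms(1,2)] by linarith+
  obtain r where r: "x = ennreal r" "0 < r" using assms by (cases x) auto
  have "x powe (1 - p') = ennreal (r powr (1 - p'))" using r p' by (simp add: ennreal_powr_def)
  moreover have "(r powr (1 - p')) powr (1 / p') = r powr (- (1 / p))"
    unfolding powr_powr p'(3) ..
  ultimately have "(x powe (1 - p')) powe (1 / p') = ennreal (r powr (- (1 / p)))"
    using p' by (simp add: ennreal_powe)
  then have "x powe (1 / p) * (x powe (1 - p')) powe (1 / p') = ennreal (r powr (1 / p) * r powr (- (1 / p)))"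
    using r assms by (simp add: ennreal_powe ennreal_mult)
  also have "r powr (1 / p) * r powr (- (1 / p)) = 1" using r by (simp flip: powr_add)
  finally show ?thesis by simp
qed

text \<open>Finiteness of the first factor excludes a product \<infinity> times 0 on the right,
  which would count as 0. Concretely, where \<open>v\<close> vanishes the dual weight is infinite,
  so \<open>g\<close> must vanish there almost everywhere.\<close>

lemma weighted_Holder:
  assumes p: "1 < p" "p' = p / (p - 1)"
    and [measurable]: "v \<in> borel_measurable lebesgue" "f \<in> borel_measurable lebesgue" "g \<in> borel_measurable lebesgue" "B \<in> sets lebesgue"
    and v: "AE x in lebesgue. x \<in> B \<longrightarrow> v x \<noteq> top"
    and fin: "sint B (\<lambda>x. g x powe p' * v x powe (1 - p')) < top"
  shows "sint B (\<lambda>x. g x * f x) \<le> sint B (\<lambda>x. g x powe p' * v x powe (1 - p')) powe (1 / p')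
           * sint B (\<lambda>x. f x powe p * v x) powe (1 / p)"
proof -
  have p': "1 < p'" "1 / p' + 1 / p = 1" "1 - p' < 0"
    using conjugate_exponent(1,2)[OF p] by linarith+
  define g1 where "g1 x = g x * (v x powe (1 - p')) powe (1 / p') * indicator B x" for x
  define f1 where "f1 x = f x * v x powe (1 / p) * indicator B x" for x
  have [measurable]: "g1 \<in> borel_measurable lebesgue" "f1 \<in> borel_measurable lebesgue"
    unfolding g1_def f1_def by measurable
  have ae: "AE x in lebesgue. g x powe p' * v x powe (1 - p') * indicator B x \<noteq> top"
    using nn_integral_PInf_AE[of "\<lambda>x. g x powe p' * v x powe (1 - p') * indicator B x" lebesgue] fin by auto
  have "sint B (\<lambda>x. g x * f x) = (\<integral>\<^sup>+x. g1 x * f1 x \<partial>lebesgue)"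
  proof (rule nn_integral_cong_AE, use ae v in eventually_elim)
    fix x assume x: "g x powe p' * v x powe (1 - p') * indicator B x \<noteq> top" "x \<in> B \<longrightarrow> v x \<noteq> top"
    show "g x * f x * indicator B x = g1 x * f1 x"
    proof (cases "x \<in> B")
      case True
      show ?thesis
      proof (cases "v x = 0")
        case v0: True
        have "g x = 0"
        proof (rule ccontr)
          assume "g x \<noteq> 0"
          then have "g x powe p' \<noteq> 0" using p' by (simp add: powe_eq_0_iff)
          moreover have "v x powe (1 - p') = top" using v0 p' by (simp add: ennreal_powr_def)
          ultimately show False using x(1) True by (simp add: ennreal_mult_top)
        qed
        then show ?thesis by (simp add: g1_def)
      next
        case False
        have "g1 x * f1 x = g x * f x * (v x powe (1 / p) * (v x powe (1 - p')) powe (1 / p'))"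
          using True by (simp add: g1_def f1_def mult_ac)
        then show ?thesis using dual_weight_prod[OF p False] x True by simp
      qed
    qed (simp add: g1_def)
  qed
  also have "\<dots> \<le> (\<integral>\<^sup>+x. g1 x powe p' \<partial>lebesgue) powe (1 / p') * (\<integral>\<^sup>+x. f1 x powe p \<partial>lebesgue) powe (1 / p)"
    by (rule Holder_nn_integral) (use p p' in auto)
  also have "(\<integral>\<^sup>+x. g1 x powe p' \<partial>lebesgue) = sint B (\<lambda>x. g x powe p' * v x powe (1 - p'))"
    using p' by (intro nn_integral_cong) (auto simp: g1_def powe_mult powe_powe split: split_indicator)
  also have "(\<integral>\<^sup>+x. f1 x powe p \<partial>lebesgue) = sint B (\<lambda>x. f x powe p * v x)"
    using p by (intro nn_integral_cong) (auto simp: f1_def powe_mult powe_powe split: split_indicator)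
  finally show ?thesis .
qed

text \<open>Hoelder's inequality on each \<open>B i\<close> with exponents \<open>p'\<close> and
  \<open>p\<close>, then for the sum with exponents \<open>r / q\<close> and
  \<open>p / q\<close>.\<close>

lemma sum_Holder_weighted:
  assumes p: "0 < q" "q < p" "1 < p" "p' = p / (p - 1)" "r = p * q / (p - q)"
    and [measurable]: "v \<in> borel_measurable lebesgue" "f \<in> borel_measurable lebesgue" "\<And>i. g i \<in> borel_measurable lebesgue"
    and v: "AE x in lebesgue. 0 < x \<longrightarrow> v x \<noteq> top"
    and I: "finite I" and B: "\<And>i. i \<in> I \<Longrightarrow> B i \<in> sets lebesgue" "disjoint_family_on B I" "(\<Union>i\<in>I. B i) \<subseteq> {0<..}"
    and fin: "(\<Sum>i\<in>I. \<omega> i powe (r / q) * sint (B i) (\<lambda>x. g i x powe p' * v x powe (1 - p')) powe (r / p')) < top"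
  shows "(\<Sum>i\<in>I. \<omega> i * sint (B i) (\<lambda>x. g i x * f x) powe q)
     \<le> (\<Sum>i\<in>I. \<omega> i powe (r / q) * sint (B i) (\<lambda>x. g i x powe p' * v x powe (1 - p')) powe (r / p')) powe (q / r)
        * sint {0<..} (\<lambda>x. f x powe p * v x) powe (q / p)"
proof -
  define X where "X i = sint (B i) (\<lambda>x. g i x powe p' * v x powe (1 - p'))" for i
  define Y where "Y i = sint (B i) (\<lambda>x. f x powe p * v x)" for i
  have p': "1 < p'" using conjugate_exponent[OF p(3,4)] by auto
  have r: "0 < r" "1 < r / q" "1 < p / q" "1 / (r / q) + 1 / (p / q) = 1"
    by (fact gap_exponent[OF p(1,2,5)] | (use p in simp))+
  have le: "\<omega> i * sint (B i) (\<lambda>x. g i x * f x) powe q \<le> (\<omega> i * X i powe (q / p')) * Y i powe (q / p)" if i: "i \<in> I" for i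
  \<comment> \<open>A nonzero coefficient together with the finite sum forces a finite dual
    integral, as the weighted inequality requires; a zero coefficient kills the term.\<close>
  proof (cases "\<omega> i = 0")
    case False
    have "X i < top"
    proof (rule ccontr)
      assume "\<not> X i < top"
      then have "X i = top" by (simp add: less_top[symmetric])
      then have "\<omega> i powe (r / q) * X i powe (r / p') = top"
        using False r p' p by (simp add: ennreal_mult_top powe_eq_0_iff)
      moreover have "\<omega> i powe (r / q) * X i powe (r / p') < top"
        using fin I i unfolding X_def by simp
      ultimately show False by simp
    qed
    then have "sint (B i) (\<lambda>x. g i x * f x) \<le> X i powe (1 / p') * Y i powe (1 / p)"
      unfolding X_def Y_def
      by (intro weighted_Holder p) (use B i v in \<open>auto elim!: eventually_mono\<close>)
    then have "sint (B i) (\<lambda>x. g i x * f x) powe q \<le> (X i powe (1 / p') * Y i powe (1 / p)) powe q"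
      using p by (intro powe_mono) auto
    also have "\<dots> = X i powe (q / p') * Y i powe (q / p)"
      using p(1-3) p' by (simp add: powe_mult powe_powe)
    finally show ?thesis by (simp add: mult_left_mono mult.assoc)
  qed simp
  have "(\<Sum>i\<in>I. \<omega> i * sint (B i) (\<lambda>x. g i x * f x) powe q) \<le> (\<Sum>i\<in>I. (\<omega> i * X i powe (q / p')) * Y i powe (q / p))"
    by (intro sum_mono le)
  also have "\<dots> \<le> (\<Sum>i\<in>I. (\<omega> i * X i powe (q / p')) powe (r / q)) powe (1 / (r / q))
      * (\<Sum>i\<in>I. (Y i powe (q / p)) powe (p / q)) powe (1 / (p / q))"
    by (rule Holder_sum[OF I r(2-4)])
  also have "(\<Sum>i\<in>I. (\<omega> i * X i powe (q / p')) powe (r / q)) = (\<Sum>i\<in>I. \<omega> i powe (r / q) * X i powe (r / p'))"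
    using p p' r by (intro sum.cong) (auto simp: powe_mult powe_powe)
  also have "(\<Sum>i\<in>I. (Y i powe (q / p)) powe (p / q)) = (\<Sum>i\<in>I. Y i)"
    using p by (intro sum.cong) (auto simp: powe_powe)
  also have "(\<Sum>i\<in>I. \<omega> i powe (r / q) * X i powe (r / p')) powe (1 / (r / q)) * (\<Sum>i\<in>I. Y i) powe (1 / (p / q))
     \<le> (\<Sum>i\<in>I. \<omega> i powe (r / q) * X i powe (r / p')) powe (q / r) * sint {0<..} (\<lambda>x. f x powe p * v x) powe (q / p)"
  proof -
    have "(\<Sum>i\<in>I. Y i) \<le> sint {0<..} (\<lambda>x. f x powe p * v x)"
      unfolding Y_def by (rule sint_sum_disjoint_le) (use I B in auto)
    then show ?thesis
      using p by (auto intro!: mult_left_mono powe_mono)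
  qed
  finally show ?thesis unfolding X_def .
qed

section \<open>Test functions for the converse direction\<close>

lemma ennreal_mult_right_cancel_le:
  fixes x y z :: ennreal
  assumes "x * z \<le> y * z" "z \<noteq> 0" "z < top"
  shows "x \<le> y"
proof -
  have "x * z / z \<le> y * z / z" using assms(1) by (rule divide_right_mono_ennreal)
  then show ?thesis using assms by (simp add: mult_divide_eq_ennreal)
qed

text \<open>It suffices to compare the powers \<open>p / q\<close>. The left one is
  \<open>c powe p * X\<close> times \<open>X powe (p - 1) * \<omega> powe (p / q)\<close>, and the
  latter product is \<open>\<tau> powe ((p - q) / q)\<close> by the choice of
  \<open>r\<close>.\<close>

lemma powe_test_exponent:
  assumes p: "0 < q" "q < p" "1 < p" "p' = p / (p - 1)" "r = p * q / (p - q)"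
    and X: "0 < X" "X < top" and \<tau>: "\<tau> = \<omega> powe (r / q) * X powe (r / p')" and c: "c powe p * X = \<tau>"
  shows "(c * X) powe q * \<omega> = \<tau>"
proof -
  note p' = conjugate_exponent[OF p(3,4)] and r = gap_exponent[OF p(1,2,5)]
  have pos: "0 < r" "0 < p'" "0 < p / q" "0 < p - 1" "0 < (p - q) / q" "0 < r / q" "0 < r / p'"
    using p(1-3) p'(1) r(1) by auto
  note e1 = r(7)
  have "r / p' * ((p - q) / q) = r * ((p - q) / q) * (1 / p')" by simp
  also have "1 / p' = 1 - 1 / p" using p'(2) by linarith
  also have "r * ((p - q) / q) * (1 - 1 / p) = p * (1 - 1 / p)" unfolding r(8) ..
  also have "\<dots> = p - 1" using p by (simp add: right_diff_distrib)
  finally have e2: "r / p' * ((p - q) / q) = p - 1" .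
  have e3: "1 + (p - q) / q = p / q" using p(1) by (simp add: field_simps)
  have "((c * X) powe q * \<omega>) powe (p / q) = (c powe p * X powe p) * \<omega> powe (p / q)"
    using p pos by (simp add: powe_mult powe_powe)
  also have "X powe p = X * X powe (p - 1)" using powe_add[of 1 "p - 1" X] p by simp
  also have "c powe p * (X * X powe (p - 1)) * \<omega> powe (p / q) = \<tau> * (\<omega> powe (p / q) * X powe (p - 1))"
    unfolding c[symmetric] by (simp only: mult_ac)
  also have "\<omega> powe (p / q) * X powe (p - 1) = \<tau> powe ((p - q) / q)"
    unfolding \<tau> using pos by (simp only: powe_mult[OF less_imp_le] powe_powe e1 e2)
  also have "\<tau> * \<tau> powe ((p - q) / q) = \<tau> powe (p / q)"
    using powe_add[of 1 "(p - q) / q" \<tau>] pos e3 by simp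
  finally show ?thesis
    using pos(3) by (metis powe_inverse(2))
qed

text \<open>The test function equalises the two sides: its coefficient on \<open>J i\<close> is chosen so that both
  \<open>\<integral> f powe p * v\<close> over \<open>J i\<close> and the contribution of \<open>A i\<close> to the left-hand side equal the \<open>i\<close>th term.\<close>

lemma hardy_test_sum_le:
  assumes p: "0 < q" "q < p" "1 < p" "p' = p / (p - 1)" "r = p * q / (p - q)"
    and [measurable]: "v \<in> borel_measurable lebesgue" "w \<in> borel_measurable lebesgue" "\<phi> \<in> borel_measurable lebesgue"
      "\<And>i. g i \<in> borel_measurable lebesgue" "\<And>i. u i \<in> borel_measurable lebesgue"
    and F [measurable]: "\<And>f. f \<in> borel_measurable lebesgue \<Longrightarrow> (\<lambda>t. sint {t<..} (\<lambda>y. f y * k t y)) \<in> borel_measurable lebesgue"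
    and hardy: "\<And>f. f \<in> borel_measurable lebesgue \<Longrightarrow>
       sint {0<..} (\<lambda>t. sint {t<..} (\<lambda>y. f y * k t y) powe q * w t) powe (1 / q)
         \<le> C * sint {0<..} (\<lambda>y. f y powe p * v y) powe (1 / p)"
    and \<phi>: "\<And>x. \<phi> x \<le> v x powe (1 - p')"
    and I: "finite I" and A: "\<And>i. i \<in> I \<Longrightarrow> A i \<in> sets lebesgue" "disjoint_family_on A I" "(\<Union>i\<in>I. A i) \<subseteq> {0<..}"
    and J: "\<And>i. i \<in> I \<Longrightarrow> J i \<in> sets lebesgue" "disjoint_family_on J I" "(\<Union>i\<in>I. J i) \<subseteq> {0<..}"
    and k: "\<And>i t y. i \<in> I \<Longrightarrow> t \<in> A i \<Longrightarrow> y \<in> J i \<Longrightarrow> t < y \<and> u i t * g i y \<le> k t y"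
    and fin: "\<And>i. i \<in> I \<Longrightarrow> sint (A i) (\<lambda>t. w t * u i t powe q) < top"
      "\<And>i. i \<in> I \<Longrightarrow> sint (J i) (\<lambda>y. g i y powe p' * \<phi> y) < top"
  shows "(\<Sum>i\<in>I. sint (A i) (\<lambda>t. w t * u i t powe q) powe (r / q) * sint (J i) (\<lambda>y. g i y powe p' * \<phi> y) powe (r / p')) \<le> C powe r"
proof -
  define \<omega> where "\<omega> i = sint (A i) (\<lambda>t. w t * u i t powe q)" for i
  define X where "X i = sint (J i) (\<lambda>y. g i y powe p' * \<phi> y)" for i
  define \<tau> where "\<tau> i = \<omega> i powe (r / q) * X i powe (r / p')" for i
  define c where "c i = (\<tau> i / X i) powe (1 / p)" for i
  \<comment> \<open>On each piece \<open>f\<close> is a multiple of the extremal of Hoelder's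
    inequality: \<open>(p' - 1) * p = p'\<close> and \<open>(p' - 1) + 1 = p'\<close> make its
    energy and its pairing with \<open>g i\<close> both expressible through
    \<open>X i\<close>.\<close>
  define f where "f y = (\<Sum>i\<in>I. c i * (g i y powe (p' - 1) * \<phi> y) * indicator (J i) y)" for y
  have p': "1 < p'" "(p' - 1) * p = p'" using conjugate_exponent[OF p(3,4)] by auto
  have r: "0 < r" "1 / q = 1 / r + 1 / p" by (fact gap_exponent[OF p(1,2,5)])+
  note [measurable] = A(1) J(1)
  have fm [measurable]: "f \<in> borel_measurable lebesgue"
    unfolding f_def using J(1) by (intro borel_measurable_sum) auto
  have f_on: "f y = c i * (g i y powe (p' - 1) * \<phi> y)" if "i \<in> I" "y \<in> J i" for i y
  proof -
    have "c j * (g j y powe (p' - 1) * \<phi> y) * indicator (J j) y = (if j = i then c i * (g i y powe (p' - 1) * \<phi> y) else 0)"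
      if "j \<in> I" for j
      using J(2) \<open>i \<in> I\<close> \<open>y \<in> J i\<close> that by (auto simp: disjoint_family_on_def split: split_indicator)
    then have "f y = (\<Sum>j\<in>I. if j = i then c i * (g i y powe (p' - 1) * \<phi> y) else 0)"
      unfolding f_def by (intro sum.cong) auto
    then show ?thesis using I that by simp
  qed
  have f_off: "f y = 0" if "\<And>i. i \<in> I \<Longrightarrow> y \<notin> J i" for y
    unfolding f_def using that by simp
  have \<tau>fin: "\<tau> i < top" if "i \<in> I" for i
    using fin[OF that] r p p' unfolding \<tau>_def \<omega>_def X_def by (auto simp: ennreal_mult_less_top intro!: powe_less_top)
  have cX: "c i powe p * X i = \<tau> i" if "i \<in> I" for i
  proof (cases "X i = 0")
    case True
    then show ?thesis using r p' by (simp add: \<tau>_def)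
  next
    case False
    have "c i powe p = \<tau> i / X i" unfolding c_def using p by (simp add: powe_powe)
    then show ?thesis
      using False fin(2)[OF that] unfolding X_def[symmetric] by (simp add: ennreal_divide_times ennreal_divide_self less_top mult_divide_eq_ennreal)
  qed
  have c\<tau>: "(c i * X i) powe q * \<omega> i = \<tau> i" if "i \<in> I" for i
  proof (cases "X i = 0")
    case True
    then show ?thesis using r p p' by (simp add: \<tau>_def)
  next
    case False
    then show ?thesis
      using powe_test_exponent[OF p _ _ \<tau>_def cX[OF that]] fin(2)[OF that] unfolding X_def[symmetric]
      by (simp add: zero_less_iff_neq_zero)
  qed
  have rhs: "sint {0<..} (\<lambda>y. f y powe p * v y) \<le> (\<Sum>i\<in>I. \<tau> i)"
  proof -
    have "sint {0<..} (\<lambda>y. f y powe p * v y) \<le> (\<integral>\<^sup>+y. (\<Sum>i\<in>I. c i powe p * (g i y powe p' * \<phi> y * indicator (J i) y)) \<partial>lebesgue)"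
    proof (rule nn_integral_mono)
      fix y
      show "f y powe p * v y * indicator {0<..} y \<le> (\<Sum>i\<in>I. c i powe p * (g i y powe p' * \<phi> y * indicator (J i) y))"
      proof (cases "\<exists>i\<in>I. y \<in> J i")
        case True
        then obtain i where i: "i \<in> I" "y \<in> J i" by auto
        have "f y powe p * v y * indicator {0<..} y \<le> f y powe p * v y" by (auto split: split_indicator)
        also have "\<dots> = c i powe p * (g i y powe p' * (\<phi> y powe p * v y))"
          using p p' by (simp add: f_on[OF i] powe_mult powe_powe mult.assoc)
        also have "\<dots> \<le> c i powe p * (g i y powe p' * \<phi> y)"
          by (intro mult_left_mono dual_weight_bound[OF p(3,4) \<phi>]) auto
        also have "\<dots> = c i powe p * (g i y powe p' * \<phi> y * indicator (J i) y)" using i by simp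
        also have "\<dots> \<le> (\<Sum>i\<in>I. c i powe p * (g i y powe p' * \<phi> y * indicator (J i) y))"
          using I i by (intro member_le_sum) auto
        finally show ?thesis .
      next
        case False
        then show ?thesis using f_off[of y] p by auto
      qed
    qed
    also have "\<dots> = (\<Sum>i\<in>I. c i powe p * X i)"
      unfolding X_def by (subst nn_integral_sum) (auto intro!: sum.cong nn_integral_cmult)
    also have "\<dots> = (\<Sum>i\<in>I. \<tau> i)" using cX by simp
    finally show ?thesis .
  qed
  have lhs: "(\<Sum>i\<in>I. \<tau> i) \<le> sint {0<..} (\<lambda>t. sint {t<..} (\<lambda>y. f y * k t y) powe q * w t)"
  proof -
    have "(\<Sum>i\<in>I. \<tau> i) \<le> (\<Sum>i\<in>I. sint (A i) (\<lambda>t. sint {t<..} (\<lambda>y. f y * k t y) powe q * w t))"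
    proof (rule sum_mono)
      fix i assume i: "i \<in> I"
      have inner: "u i t * (c i * X i) \<le> sint {t<..} (\<lambda>y. f y * k t y)" if t: "t \<in> A i" for t
      proof -
        have "u i t * (c i * X i) = sint (J i) (\<lambda>y. (u i t * c i) * (g i y powe p' * \<phi> y))"
          unfolding X_def using J(1)[OF i] by (subst sint_cmult) (auto simp: mult.assoc)
        also have "\<dots> \<le> sint {t<..} (\<lambda>y. f y * k t y)"
        proof (rule sint_mono)
          show "J i \<subseteq> {t<..}" using k[OF i t] by auto
          fix y assume y: "y \<in> J i"
          have "g i y powe p' = g i y powe (p' - 1) * g i y" using powe_add[of "p' - 1" 1 "g i y"] p' by simp
          then have "u i t * c i * (g i y powe p' * \<phi> y) = f y * (u i t * g i y)"
            by (simp add: f_on[OF i y] mult_ac)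
          also have "\<dots> \<le> f y * k t y" using k[OF i t y] by (intro mult_left_mono) auto
          finally show "u i t * c i * (g i y powe p' * \<phi> y) \<le> f y * k t y" .
        qed
        finally show ?thesis .
      qed
      have "\<tau> i = sint (A i) (\<lambda>t. (c i * X i) powe q * (w t * u i t powe q))"
        unfolding c\<tau>[OF i, symmetric] \<omega>_def using A(1)[OF i] by (intro sint_cmult[symmetric]) auto
      also have "\<dots> \<le> sint (A i) (\<lambda>t. sint {t<..} (\<lambda>y. f y * k t y) powe q * w t)"
      proof (rule sint_mono)
        fix t assume t: "t \<in> A i"
        have "(c i * X i) powe q * (w t * u i t powe q) = (u i t * (c i * X i)) powe q * w t"
          using p by (simp add: powe_mult mult_ac)
        also have "\<dots> \<le> sint {t<..} (\<lambda>y. f y * k t y) powe q * w t"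
          using inner[OF t] p by (intro mult_right_mono powe_mono) auto
        finally show "(c i * X i) powe q * (w t * u i t powe q) \<le> sint {t<..} (\<lambda>y. f y * k t y) powe q * w t" .
      qed simp
      finally show "\<tau> i \<le> sint (A i) (\<lambda>t. sint {t<..} (\<lambda>y. f y * k t y) powe q * w t)" .
    qed
    also have "\<dots> \<le> sint {0<..} (\<lambda>t. sint {t<..} (\<lambda>y. f y * k t y) powe q * w t)"
      using F[OF fm] by (intro sint_sum_disjoint_le) (use I A in auto)
    finally show ?thesis .
  qed
  let ?S = "\<Sum>i\<in>I. \<tau> i"
  have "?S powe (1 / q) \<le> C * ?S powe (1 / p)"
  proof -
    have "?S powe (1 / q) \<le> sint {0<..} (\<lambda>t. sint {t<..} (\<lambda>y. f y * k t y) powe q * w t) powe (1 / q)"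
      using p by (intro powe_mono lhs) auto
    also have "\<dots> \<le> C * sint {0<..} (\<lambda>y. f y powe p * v y) powe (1 / p)" by (rule hardy[OF fm])
    also have "\<dots> \<le> C * ?S powe (1 / p)" using p by (intro mult_left_mono powe_mono rhs) auto
    finally show ?thesis .
  qed
  \<comment> \<open>Cancelling \<open>S powe (1 / p)\<close> leaves the claim; it requires
    \<open>S\<close> to be positive and finite, and finiteness is what the hypotheses
    \<open>fin\<close> provide.\<close>
  moreover have "?S powe (1 / q) = ?S powe (1 / r) * ?S powe (1 / p)"
  proof -
    show ?thesis unfolding r(2) using powe_add[of "1 / r" "1 / p" ?S] r p by simp
  qed
  ultimately have main: "?S powe (1 / r) * ?S powe (1 / p) \<le> C * ?S powe (1 / p)" by simp
  have Sfin: "?S < top" using \<tau>fin I by simp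
  have "?S \<le> C powe r"
  proof (cases "?S = 0")
    case False
    have "?S powe (1 / r) \<le> C"
      by (rule ennreal_mult_right_cancel_le[OF main]) (use False Sfin p in \<open>auto simp: powe_eq_0_iff intro!: powe_less_top simp del: sum_eq_0_iff\<close>)
    then have "(?S powe (1 / r)) powe r \<le> C powe r" using r by (intro powe_mono) auto
    then show ?thesis using r by (simp add: powe_inverse)
  qed (simp only: zero_le)
  then show ?thesis unfolding \<tau>_def \<omega>_def X_def .
qed

subsection \<open>Discrete and integral conditions\<close>

lemma covering_mono:
  "covering_sequence kmin kmax t \<Longrightarrow> kmin \<le> i \<Longrightarrow> i \<le> j \<Longrightarrow> j \<le> kmax \<Longrightarrow> t i \<le> t j"
  using covering_sequence_strict[of kmin kmax t i j] by (cases "i = j") auto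

lemma covering_left:
  assumes "covering_sequence kmin kmax t" "kmin < k" "k < kmax"
  obtains y where "0 \<le> y" "y < real_of_ereal (t k)" "einterval (t (k - 1)) (t k) = {y<..<real_of_ereal (t k)}"
proof -
  have t0: "t kmin = 0" using assms(1) by (simp add: covering_sequence_def)
  have "0 \<le> t (k - 1)" using covering_mono[OF assms(1), of kmin "k - 1"] assms t0 by simp
  moreover have less: "t (k - 1) < t k" using covering_sequence_strict[OF assms(1), of "k - 1" k] assms by simp
  ultimately obtain y where y: "t (k - 1) = ereal y" "0 \<le> y"
    by (cases "t (k - 1)") auto
  obtain x where x: "t k = ereal x" using covering_sequence_real(1)[OF assms] by blast
  show thesis
    by (rule that[of y]) (use y x less in \<open>auto simp: einterval_def\<close>)
qed

lemma covering_right: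
  assumes "covering_sequence kmin kmax t" "kmin < k" "k < kmax"
  shows "einterval (t k) (t (k + 1)) \<subseteq> {real_of_ereal (t k)<..}"
  by (subst covering_sequence_real(1)[OF assms]) (auto simp: einterval_def)

lemma covering_disjoint:
  assumes "covering_sequence kmin kmax t"
  shows "disjoint_family_on (\<lambda>k. einterval (t (k - 1)) (t k)) {kmin<..<kmax}"
    "disjoint_family_on (\<lambda>k. einterval (t k) (t (k + 1))) {kmin<..<kmax}"
proof -
  have A: "einterval (t (i - 1)) (t i) \<inter> einterval (t (j - 1)) (t j) = {}" if "kmin < i" "i < j" "j < kmax" for i j
    using covering_mono[OF assms, of i "j - 1"] that by (auto simp: einterval_def dest: less_le_trans less_trans)
  have B: "einterval (t i) (t (i + 1)) \<inter> einterval (t j) (t (j + 1)) = {}" if "kmin < i" "i < j" "j < kmax" for i j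
    using covering_mono[OF assms, of "i + 1" j] that by (auto simp: einterval_def dest: less_le_trans less_trans)
  show "disjoint_family_on (\<lambda>k. einterval (t (k - 1)) (t k)) {kmin<..<kmax}"
    unfolding disjoint_family_on_def
  proof (intro ballI impI)
    fix i j assume ij: "i \<in> {kmin<..<kmax}" "j \<in> {kmin<..<kmax}" "i \<noteq> j"
    then show "einterval (t (i - 1)) (t i) \<inter> einterval (t (j - 1)) (t j) = {}"
      using A[of i j] A[of j i] by (cases "i < j") (auto simp: Int_commute)
  qed
  show "disjoint_family_on (\<lambda>k. einterval (t k) (t (k + 1))) {kmin<..<kmax}"
    unfolding disjoint_family_on_def
  proof (intro ballI impI)
    fix i j assume ij: "i \<in> {kmin<..<kmax}" "j \<in> {kmin<..<kmax}" "i \<noteq> j"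
    then show "einterval (t i) (t (i + 1)) \<inter> einterval (t j) (t (j + 1)) = {}"
      using B[of i j] B[of j i] by (cases "i < j") (auto simp: Int_commute)
  qed
qed

lemma covering_left_pos:
  assumes "covering_sequence kmin kmax t" "kmin < k" "k < kmax"
  shows "einterval (t (k - 1)) (t k) \<subseteq> {0<..<real_of_ereal (t k)}"
  using covering_left[OF assms] by (metis greaterThanLessThan_subseteq_greaterThanLessThan order_refl)

lemma covering_right_pos:
  assumes "covering_sequence kmin kmax t" "kmin < k" "k < kmax"
  shows "einterval (t k) (t (k + 1)) \<subseteq> {0<..}"
  using covering_right[OF assms] covering_sequence_real(2)[OF assms] by force

lemma einterval_sets_lebesgue [measurable, simp]: "einterval a b \<in> sets lebesgue"
  by (simp add: borel_einterval[THEN sets_completionI_sets])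

text \<open>The left-hand intervals of a covering sequence are disjoint, so a bound of each term by
  an integral over its left-hand interval can be summed.\<close>

lemma covering_sup_le_integral:
  assumes [measurable]: "F \<in> borel_measurable lebesgue"
    and le: "\<And>y x B. 0 \<le> y \<Longrightarrow> y < x \<Longrightarrow> B \<subseteq> {x<..} \<Longrightarrow> \<Psi> {y<..<x} x B \<le> sint {y<..<x} F"
  shows "covering_sup \<Psi> \<le> sint {0<..} F"
proof (rule covering_sup_least)
  fix kmin kmax t assume cov: "covering_sequence kmin kmax t"
  have "(\<Sum>k\<in>{kmin<..<kmax}. \<Psi> (einterval (t (k - 1)) (t k)) (real_of_ereal (t k)) (einterval (t k) (t (k + 1))))
    \<le> (\<Sum>k\<in>{kmin<..<kmax}. sint (einterval (t (k - 1)) (t k)) F)"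
  proof (rule sum_mono)
    fix k assume "k \<in> {kmin<..<kmax}"
    then have k: "kmin < k" "k < kmax" by auto
    obtain y where y: "0 \<le> y" "y < real_of_ereal (t k)" "einterval (t (k - 1)) (t k) = {y<..<real_of_ereal (t k)}"
      by (rule covering_left[OF cov k])
    show "\<Psi> (einterval (t (k - 1)) (t k)) (real_of_ereal (t k)) (einterval (t k) (t (k + 1)))
      \<le> sint (einterval (t (k - 1)) (t k)) F"
      unfolding y(3) by (rule le[OF y(1,2) covering_right[OF cov k]])
  qed
  also have "\<dots> \<le> sint {0<..} F"
  proof (rule sint_sum_disjoint_le)
    show "(\<Union>k\<in>{kmin<..<kmax}. einterval (t (k - 1)) (t k)) \<subseteq> {0<..}"
      using covering_left_pos[OF cov] by fastforce
  qed (use covering_disjoint[OF cov] in auto)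
  finally show "(\<Sum>k\<in>{kmin<..<kmax}. \<Psi> (einterval (t (k - 1)) (t k)) (real_of_ereal (t k)) (einterval (t k) (t (k + 1))))
    \<le> sint {0<..} F" .
qed

lemma sint_SUP_trunc:
  assumes [measurable]: "\<phi> \<in> borel_measurable lebesgue" "h \<in> borel_measurable lebesgue" "B \<in> sets lebesgue"
  shows "(SUP m. sint B (\<lambda>y. h y * trunc m \<phi> y)) = sint B (\<lambda>y. h y * \<phi> y)"
proof -
  have "(SUP m. sint B (\<lambda>y. h y * trunc m \<phi> y)) = (\<integral>\<^sup>+y. (SUP m. h y * trunc m \<phi> y * indicator B y) \<partial>lebesgue)"
  proof (rule nn_integral_monotone_convergence_SUP[symmetric])
    show "incseq (\<lambda>m y. h y * trunc m \<phi> y * indicator B y)"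
      using incseq_trunc by (auto simp: incseq_def le_fun_def intro!: mult_left_mono mult_right_mono)
  qed measurable
  then show ?thesis
    unfolding SUP_mult_right_ennreal[symmetric] SUP_mult_left_ennreal[symmetric] SUP_trunc .
qed

text \<open>Truncating \<open>\<phi>\<close> makes all integrals over the right-hand intervals finite.\<close>

lemma covering_sup_le_trunc:
  assumes [measurable]: "\<phi> \<in> borel_measurable lebesgue" "\<And>x. h x \<in> borel_measurable lebesgue" and \<beta>: "0 < \<beta>"
    and \<Psi>: "\<And>A x B. \<Psi> A x B = c A x * sint B (\<lambda>y. h x y * \<phi> y) powe \<beta>"
    and le: "\<And>m. covering_sup (\<lambda>A x B. c A x * sint B (\<lambda>y. h x y * trunc m \<phi> y) powe \<beta>) \<le> X"
  shows "covering_sup \<Psi> \<le> X"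
proof (rule covering_sup_least)
  fix kmin kmax t assume cov: "covering_sequence kmin kmax t"
  define A where "A k = einterval (t (k - 1)) (t k)" for k
  define x where "x k = real_of_ereal (t k)" for k
  define B where "B k = einterval (t k) (t (k + 1))" for k
  have [measurable]: "B k \<in> sets lebesgue" for k by (simp add: B_def)
  have inc: "incseq (\<lambda>m. c (A k) (x k) * sint (B k) (\<lambda>y. h (x k) y * trunc m \<phi> y) powe \<beta>)" for k
    using \<beta> incseq_trunc[of \<phi>]
    by (auto simp: incseq_def intro!: mult_left_mono powe_mono sint_mono)
  have "(\<Sum>k\<in>{kmin<..<kmax}. \<Psi> (A k) (x k) (B k))
    = (\<Sum>k\<in>{kmin<..<kmax}. SUP m. c (A k) (x k) * sint (B k) (\<lambda>y. h (x k) y * trunc m \<phi> y) powe \<beta>)"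
    unfolding \<Psi> SUP_mult_left_ennreal[symmetric] powe_SUP[OF \<beta>, symmetric]
    by (subst sint_SUP_trunc) auto
  \<comment> \<open>For a fixed covering sequence the sum is finite, so increasing limits may be
    taken out of it; the supremum over covering sequences comes only afterwards.\<close>
  also have "\<dots> = (SUP m. \<Sum>k\<in>{kmin<..<kmax}. c (A k) (x k) * sint (B k) (\<lambda>y. h (x k) y * trunc m \<phi> y) powe \<beta>)"
    by (rule ennreal_SUP_sum[symmetric]) (rule inc)
  also have "\<dots> \<le> X"
    unfolding A_def x_def B_def
    by (rule SUP_least, rule order_trans[OF covering_sup_upper[OF cov] le])
  finally show "(\<Sum>k\<in>{kmin<..<kmax}. \<Psi> (einterval (t (k - 1)) (t k)) (real_of_ereal (t k)) (einterval (t k) (t (k + 1)))) \<le> X"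
    unfolding A_def x_def B_def .
qed

context weighted_kernel
begin

text \<open>The power of the mass becomes an integral by \<open>sint_powe_le\<close>. At every
  \<open>t\<close> of the left-hand interval the kernel is at least its value at \<open>x\<close>,
  so the tail at \<open>t\<close> dominates the integral over the right-hand interval.\<close>

lemma \<Psi>1_sup_le_integral:
  assumes [measurable]: "\<phi> \<in> borel_measurable lebesgue" and \<alpha>: "1 \<le> \<alpha>" and \<beta>: "0 < \<beta>" and a: "0 < a"
  shows "covering_sup (\<Psi>1 \<alpha> \<beta> a \<phi>) \<le> 2 powe \<alpha> * sint {0<..} (\<lambda>t. W t powe (\<alpha> - 1) * w t * ktail a \<phi> t powe \<beta>)"
proof -
  let ?F = "\<lambda>t. W t powe (\<alpha> - 1) * w t * ktail a \<phi> t powe \<beta>"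
  have [measurable]: "ktail a \<phi> \<in> borel_measurable lebesgue" using a by (intro ktail_measurable) simp
  have "covering_sup (\<Psi>1 \<alpha> \<beta> a \<phi>) \<le> sint {0<..} (\<lambda>t. 2 powe \<alpha> * ?F t)"
  proof (rule covering_sup_le_integral)
    fix y x :: real and B :: "real set" assume yx: "0 \<le> y" "y < x" "B \<subseteq> {x<..}"
    let ?X = "sint B (\<lambda>z. \<kappa> x z powe a * \<phi> z)"
    have fin: "sint {y<..<x} w < top"
      by (rule le_less_trans[OF sint_mono W_finite[of x]]) (use yx in auto)
    have "sint {y<..<x} w powe \<alpha> \<le> 2 powe \<alpha> * sint {y<..<x} (\<lambda>t. sint {y<..<t} w powe (\<alpha> - 1) * w t)"
      by (rule sint_powe_le) (use yx fin \<alpha> in auto)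
    also have "\<dots> \<le> 2 powe \<alpha> * sint {y<..<x} (\<lambda>t. W t powe (\<alpha> - 1) * w t)"
      unfolding W_def using yx \<alpha>
      by (intro mult_left_mono sint_mono[of _ _ "\<lambda>t. sint {y<..<t} w powe (\<alpha> - 1) * w t"] mult_right_mono powe_mono)
         (auto intro!: sint_mono)
    finally have "\<Psi>1 \<alpha> \<beta> a \<phi> {y<..<x} x B \<le> 2 powe \<alpha> * sint {y<..<x} (\<lambda>t. W t powe (\<alpha> - 1) * w t) * ?X powe \<beta>"
      unfolding \<Psi>1_def by (rule mult_right_mono) simp
    also have "\<dots> = sint {y<..<x} (\<lambda>t. (2 powe \<alpha> * ?X powe \<beta>) * (W t powe (\<alpha> - 1) * w t))"
      by (subst sint_cmult) (auto simp: mult_ac)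
    also have "\<dots> \<le> sint {y<..<x} (\<lambda>t. 2 powe \<alpha> * ?F t)"
    proof (rule sint_mono)
      fix t assume t: "t \<in> {y<..<x}"
      have "?X \<le> ktail a \<phi> t"
        unfolding ktail_def using t yx a
        by (intro sint_mono) (auto intro!: mult_right_mono powe_mono antimono)
      then have "?X powe \<beta> \<le> ktail a \<phi> t powe \<beta>" using \<beta> by (intro powe_mono) auto
      then have "2 powe \<alpha> * (W t powe (\<alpha> - 1) * w t) * ?X powe \<beta> \<le> 2 powe \<alpha> * (W t powe (\<alpha> - 1) * w t) * ktail a \<phi> t powe \<beta>"
        by (rule mult_left_mono) simp
      then show "2 powe \<alpha> * ?X powe \<beta> * (W t powe (\<alpha> - 1) * w t) \<le> 2 powe \<alpha> * ?F t"
        by (simp only: mult_ac)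
    qed simp
    finally show "\<Psi>1 \<alpha> \<beta> a \<phi> {y<..<x} x B \<le> sint {y<..<x} (\<lambda>t. 2 powe \<alpha> * ?F t)" .
  qed measurable
  then show ?thesis by (simp add: sint_cmult)
qed

text \<open>Here the primitive depends on the endpoint \<open>x\<close> through the kernel.
  Splitting the kernel at \<open>t\<close> gives \<open>G t\<close>, which leads to the supremal
  integrand since \<open>z = x\<close> is admissible in \<open>M\<close>, and a jump, whose powers
  \<open>\<alpha> - 1\<close> and 1 combine into a quantity controlled by the tail.\<close>

lemma \<Psi>2_sup_le_integral:
  assumes [measurable]: "\<phi> \<in> borel_measurable lebesgue" and \<alpha>: "1 \<le> \<alpha>" and \<beta>: "0 < \<beta>" and a: "0 < a" "a * \<beta> = \<alpha> * q"
  shows "covering_sup (\<Psi>2 \<alpha> \<beta> \<phi>) \<le> 2 powe \<alpha> * (tri \<theta> q powe (\<alpha> - 1) * 2 powe (\<alpha> - 1)) *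
    (sint {0<..} (\<lambda>t. W t powe (\<alpha> - 1) * w t * ktail a \<phi> t powe \<beta>)
     + sint {0<..} (\<lambda>t. G t powe (\<alpha> - 1) * w t * M \<beta> \<phi> t))"
proof -
  let ?c = "2 powe \<alpha> * (tri \<theta> q powe (\<alpha> - 1) * 2 powe (\<alpha> - 1))"
  let ?F = "\<lambda>t. W t powe (\<alpha> - 1) * w t * ktail a \<phi> t powe \<beta>" and ?H = "\<lambda>t. G t powe (\<alpha> - 1) * w t * M \<beta> \<phi> t"
  have \<alpha>1: "0 \<le> \<alpha> - 1" using \<alpha> by simp
  have [measurable]: "ktail a \<phi> \<in> borel_measurable lebesgue" using a by (intro ktail_measurable) simp
  have "covering_sup (\<Psi>2 \<alpha> \<beta> \<phi>) \<le> sint {0<..} (\<lambda>t. ?c * (?F t + ?H t))"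
  proof (rule covering_sup_le_integral)
    fix y x :: real and B :: "real set" assume yx: "0 \<le> y" "y < x" "B \<subseteq> {x<..}"
    let ?X = "sint B \<phi> powe \<beta>"
    have X: "?X \<le> Q \<beta> \<phi> x" unfolding Q_def using \<beta> yx by (intro powe_mono sint_mono) auto
    let ?g = "\<lambda>t. w t * \<kappa> t x powe q"
    have "sint {y<..<x} ?g \<le> wk {0<..<x} x" unfolding wk_def using yx by (intro sint_mono) auto
    then have fin: "sint {y<..<x} ?g < top" using wk_less_top by (rule le_less_trans)
    have "sint {y<..<x} ?g powe \<alpha> \<le> 2 powe \<alpha> * sint {y<..<x} (\<lambda>t. sint {y<..<t} ?g powe (\<alpha> - 1) * ?g t)"
      by (rule sint_powe_le) (use yx fin \<alpha> in auto)
    then have "\<Psi>2 \<alpha> \<beta> \<phi> {y<..<x} x B \<le> 2 powe \<alpha> * sint {y<..<x} (\<lambda>t. wk {y<..<t} x powe (\<alpha> - 1) * ?g t) * ?X"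
      unfolding \<Psi>2_def wk_def by (rule mult_right_mono) simp
    also have "\<dots> = sint {y<..<x} (\<lambda>t. (2 powe \<alpha> * ?X) * (wk {y<..<t} x powe (\<alpha> - 1) * ?g t))"
    proof -
      have [measurable]: "(\<lambda>t. wk {y<..<t} x) \<in> borel_measurable lebesgue"
        by (intro borel_lebesgue_measurable mono_measurable_ennreal wk_mono) auto
      show ?thesis by (subst sint_cmult) (auto simp: mult_ac)
    qed
    also have "\<dots> \<le> sint {y<..<x} (\<lambda>t. ?c * (?F t + ?H t))"
    proof (rule sint_mono)
      fix t assume t: "t \<in> {y<..<x}"
      let ?v = "\<kappa> t x powe q"
      have "wk {y<..<t} x \<le> wk {0<..<t} x" using yx by (intro wk_mono) auto
      also have "\<dots> \<le> tri \<theta> q * (wk {0<..<t} t + sint {0<..<t} w * ?v)"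
        by (rule wk_triangle) (use t in auto)
      finally have "wk {y<..<t} x powe (\<alpha> - 1) \<le> (tri \<theta> q * (G t + W t * ?v)) powe (\<alpha> - 1)"
        unfolding G_def W_def by (rule powe_mono) (rule \<alpha>1)
      also have "\<dots> \<le> tri \<theta> q powe (\<alpha> - 1) * (2 powe (\<alpha> - 1) * (G t powe (\<alpha> - 1) + (W t * ?v) powe (\<alpha> - 1)))"
        unfolding powe_mult[OF \<alpha>1, of "tri \<theta> q"] by (intro mult_left_mono powe_add_le \<alpha>1) simp
      finally have "(2 powe \<alpha> * ?X) * (wk {y<..<t} x powe (\<alpha> - 1) * ?g t)
        \<le> (2 powe \<alpha> * ?X) * (tri \<theta> q powe (\<alpha> - 1) * (2 powe (\<alpha> - 1) * (G t powe (\<alpha> - 1) + (W t * ?v) powe (\<alpha> - 1))) * ?g t)"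
        by (intro mult_left_mono mult_right_mono) auto
      also have "\<dots> = ?c * (W t powe (\<alpha> - 1) * w t * ((?v powe (\<alpha> - 1) * ?v) * ?X) + G t powe (\<alpha> - 1) * w t * (?v * ?X))"
        by (simp only: powe_mult[OF \<alpha>1] algebra_simps)
      also have "?v powe (\<alpha> - 1) * ?v = ?v powe \<alpha>"
        using powe_add[of "\<alpha> - 1" 1 ?v] \<alpha> by simp
      also have "?c * (W t powe (\<alpha> - 1) * w t * (?v powe \<alpha> * ?X) + G t powe (\<alpha> - 1) * w t * (?v * ?X)) \<le> ?c * (?F t + ?H t)"
      proof (intro mult_left_mono add_mono)
        have "?v powe \<alpha> * ?X \<le> ?v powe \<alpha> * Q \<beta> \<phi> x" by (rule mult_left_mono[OF X]) simp
        also have "\<dots> \<le> ktail a \<phi> t powe \<beta>"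
          using t \<alpha> \<beta> a by (intro kernel_Q_le_ktail) auto
        finally show "?v powe \<alpha> * ?X \<le> ktail a \<phi> t powe \<beta>" .
        have "?v * ?X \<le> ?v * Q \<beta> \<phi> x" by (rule mult_left_mono[OF X]) simp
        also have "\<dots> \<le> M \<beta> \<phi> t" unfolding M_def using t by (intro SUP_upper) auto
        finally show "?v * ?X \<le> M \<beta> \<phi> t" .
      qed auto
      finally show "(2 powe \<alpha> * ?X) * (wk {y<..<t} x powe (\<alpha> - 1) * ?g t) \<le> ?c * (?F t + ?H t)" .
    qed simp
    finally show "\<Psi>2 \<alpha> \<beta> \<phi> {y<..<x} x B \<le> sint {y<..<x} (\<lambda>t. ?c * (?F t + ?H t))" .
  qed measurable
  then show ?thesis by (simp add: sint_cmult sint_add)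
qed

end

subsection \<open>The Hardy inequality and the discrete conditions\<close>

locale hardy_kernel = weighted_kernel +
  fixes p p' r :: real and v :: "real \<Rightarrow> ennreal"
  assumes exponents: "q < p" "1 < p" "p' = p / (p - 1)" "r = p * q / (p - q)"
    and v_measurable [measurable]: "v \<in> borel_measurable lebesgue"
    and v_finite: "AE x in lebesgue. 0 < x \<longrightarrow> v x \<noteq> top"
begin

lemmas p_facts = q_pos exponents

definition \<sigma> :: "real \<Rightarrow> ennreal" where "\<sigma> x = v x powe (1 - p')"

definition \<Delta>1 :: ennreal where "\<Delta>1 = covering_sup (\<Psi>1 (r / q) (r / p') p' \<sigma>)"

definition \<Delta>2 :: ennreal where "\<Delta>2 = covering_sup (\<Psi>2 (r / q) (r / p') \<sigma>)"

definition energy :: "(real \<Rightarrow> ennreal) \<Rightarrow> ennreal" where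
  "energy f = sint {0<..} (\<lambda>x. f x powe p * v x)"

definition hardy :: "ennreal \<Rightarrow> bool" where
  "hardy C \<longleftrightarrow> (\<forall>f\<in>borel_measurable lebesgue.
     sint {0<..} (\<lambda>t. ktail 1 f t powe q * w t) powe (1 / q) \<le> C * energy f powe (1 / p))"

lemma p'_gt_1: "1 < p'" using conjugate_exponent[OF exponents(2,3)] by simp

lemma r_pos: "0 < r" using gap_exponent[OF q_pos exponents(1,4)] by simp

lemma \<sigma>_measurable [measurable]: "\<sigma> \<in> borel_measurable lebesgue"
  unfolding \<sigma>_def by measurable

text \<open>For \<open>s < x < y\<close> the kernel has two lower bounds of product form,
  \<open>\<kappa> x y\<close> and \<open>\<kappa> s x\<close>. The choices \<open>u = 1\<close> and
  \<open>h = 1\<close> yield the first and the second discrete condition.\<close>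

lemma hardy_test:
  assumes "hardy C" and cov: "covering_sequence kmin kmax t"
    and meas: "\<And>x. h x \<in> borel_measurable lebesgue" "\<And>x. u x \<in> borel_measurable lebesgue"
    and k: "\<And>s x y. s < x \<Longrightarrow> x < y \<Longrightarrow> u x s * h x y \<le> \<kappa> s y"
    and fin: "\<And>x. 0 < x \<Longrightarrow> sint {0<..<x} (\<lambda>s. w s * u x s powe q) < top"
      "\<And>x. sint {x<..} (\<lambda>y. h x y powe p' * trunc m \<sigma> y) < top"
  shows "(\<Sum>k\<in>{kmin<..<kmax}. sint (einterval (t (k - 1)) (t k)) (\<lambda>s. w s * u (real_of_ereal (t k)) s powe q) powe (r / q)
      * sint (einterval (t k) (t (k + 1))) (\<lambda>y. h (real_of_ereal (t k)) y powe p' * trunc m \<sigma> y) powe (r / p')) \<le> C powe r"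
proof (rule hardy_test_sum_le[OF p_facts, where k = \<kappa> and v = v and \<phi> = "trunc m \<sigma>"
      and g = "\<lambda>k. h (real_of_ereal (t k))" and u = "\<lambda>k. u (real_of_ereal (t k))"])
  show "(\<lambda>t. sint {t<..} (\<lambda>y. f y * \<kappa> t y)) \<in> borel_measurable lebesgue" for f
    using ktail_measurable[of 1 f] by (simp add: ktail_def[abs_def] mult.commute)
  show "sint {0<..} (\<lambda>t. sint {t<..} (\<lambda>y. f y * \<kappa> t y) powe q * w t) powe (1 / q)
      \<le> C * sint {0<..} (\<lambda>y. f y powe p * v y) powe (1 / p)" if "f \<in> borel_measurable lebesgue" for f
    using assms(1) that by (simp add: hardy_def energy_def ktail_def mult.commute[of "f _" "\<kappa> _ _"])
  show "trunc m \<sigma> x \<le> v x powe (1 - p')" for x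
    using trunc_le[of m \<sigma> x] by (simp add: \<sigma>_def)
  show "(\<Union>i\<in>{kmin<..<kmax}. einterval (t (i - 1)) (t i)) \<subseteq> {0<..}"
    using covering_left_pos[OF cov] by fastforce
  show "(\<Union>i\<in>{kmin<..<kmax}. einterval (t i) (t (i + 1))) \<subseteq> {0<..}"
    using covering_right_pos[OF cov] by fastforce
  fix i assume "i \<in> {kmin<..<kmax}"
  then have i: "kmin < i" "i < kmax" by auto
  note L = covering_left_pos[OF cov i] and R = covering_right[OF cov i]
  show "s < y \<and> u (real_of_ereal (t i)) s * h (real_of_ereal (t i)) y \<le> \<kappa> s y"
    if "s \<in> einterval (t (i - 1)) (t i)" "y \<in> einterval (t i) (t (i + 1))" for s y
  proof -
    have "s < real_of_ereal (t i)" "real_of_ereal (t i) < y" using that L R by auto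
    then show ?thesis by (auto intro: k)
  qed
  show "sint (einterval (t (i - 1)) (t i)) (\<lambda>s. w s * u (real_of_ereal (t i)) s powe q) < top"
    by (rule le_less_trans[OF sint_mono fin(1)[OF covering_sequence_real(2)[OF cov i]]]) (use L in auto)
  show "sint (einterval (t i) (t (i + 1))) (\<lambda>y. h (real_of_ereal (t i)) y powe p' * trunc m \<sigma> y) < top"
    by (rule le_less_trans[OF sint_mono fin(2)[of "real_of_ereal (t i)"]]) (use R in auto)
qed (use covering_disjoint[OF cov] meas in auto)

lemma \<Delta>1_le:
  assumes "hardy C"
  shows "\<Delta>1 \<le> C powe r"
  unfolding \<Delta>1_def
proof (rule covering_sup_le_trunc[where h = "\<lambda>x y. \<kappa> x y powe p'" and \<phi> = \<sigma> and \<beta> = "r / p'" and c = "\<lambda>A x. sint A w powe (r / q)"])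
  show "covering_sup (\<lambda>A x B. sint A w powe (r / q) * sint B (\<lambda>y. \<kappa> x y powe p' * trunc m \<sigma> y) powe (r / p')) \<le> C powe r" for m
  proof (rule covering_sup_least)
    fix kmin kmax t assume "covering_sequence kmin kmax t"
    from hardy_test[OF assms this, of \<kappa> "\<lambda>_ _. 1" m]
    show "(\<Sum>k\<in>{kmin<..<kmax}. sint (einterval (t (k - 1)) (t k)) w powe (r / q)
       * sint (einterval (t k) (t (k + 1))) (\<lambda>y. \<kappa> (real_of_ereal (t k)) y powe p' * trunc m \<sigma> y) powe (r / p')) \<le> C powe r"
      using W_finite ktail_trunc_less_top[of \<sigma> p' m] p'_gt_1 by (simp add: ktail_def antimono)
  qed
qed (use p'_gt_1 r_pos in \<open>auto simp: \<Psi>1_def\<close>)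

lemma \<Delta>2_le:
  assumes "hardy C"
  shows "\<Delta>2 \<le> C powe r"
  unfolding \<Delta>2_def
proof (rule covering_sup_le_trunc[where h = "\<lambda>x y. 1" and \<phi> = \<sigma> and \<beta> = "r / p'" and c = "\<lambda>A x. wk A x powe (r / q)"])
  show "covering_sup (\<lambda>A x B. wk A x powe (r / q) * sint B (\<lambda>y. 1 * trunc m \<sigma> y) powe (r / p')) \<le> C powe r" for m
  proof (rule covering_sup_least)
    fix kmin kmax t assume "covering_sequence kmin kmax t"
    from hardy_test[OF assms this, of "\<lambda>_ _. 1" "\<lambda>x s. \<kappa> s x" m]
    show "(\<Sum>k\<in>{kmin<..<kmax}. wk (einterval (t (k - 1)) (t k)) (real_of_ereal (t k)) powe (r / q)
       * sint (einterval (t k) (t (k + 1))) (\<lambda>y. 1 * trunc m \<sigma> y) powe (r / p')) \<le> C powe r"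
      using wk_less_top sint_trunc_less_top by (simp add: wk_def mono)
  qed
qed (use p'_gt_1 r_pos in \<open>auto simp: \<Psi>2_def\<close>)

text \<open>Finiteness of \<open>\<Delta>1\<close> passes to the sum over each covering sequence and
  so supplies the hypothesis of the summed Hoelder inequality.\<close>

lemma \<Psi>1_Holder:
  assumes [measurable]: "f \<in> borel_measurable lebesgue" and fin: "\<Delta>1 < top"
  shows "covering_sup (\<Psi>1 1 q 1 f) \<le> \<Delta>1 powe (q / r) * energy f powe (q / p)"
proof (rule covering_sup_least)
  fix kmin kmax t assume cov: "covering_sequence kmin kmax t"
  let ?I = "{kmin<..<kmax}" and ?x = "\<lambda>k. real_of_ereal (t k)"
  let ?A = "\<lambda>k. einterval (t (k - 1)) (t k)" and ?B = "\<lambda>k. einterval (t k) (t (k + 1))"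
  let ?S = "\<Sum>k\<in>?I. sint (?A k) w powe (r / q) * sint (?B k) (\<lambda>y. \<kappa> (?x k) y powe p' * v y powe (1 - p')) powe (r / p')"
  have S: "?S \<le> \<Delta>1"
    using covering_sup_upper[OF cov, of "\<Psi>1 (r / q) (r / p') p' \<sigma>"] by (simp add: \<Psi>1_def \<Delta>1_def \<sigma>_def)
  have "(\<Sum>k\<in>?I. \<Psi>1 1 q 1 f (?A k) (?x k) (?B k)) = (\<Sum>k\<in>?I. sint (?A k) w * sint (?B k) (\<lambda>y. \<kappa> (?x k) y * f y) powe q)"
    by (simp add: \<Psi>1_def)
  also have "\<dots> \<le> ?S powe (q / r) * energy f powe (q / p)"
    unfolding energy_def
  proof (rule sum_Holder_weighted[OF p_facts])
    show "(\<Union>i\<in>?I. ?B i) \<subseteq> {0<..}" using covering_right_pos[OF cov] by fastforce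
  qed (use v_finite covering_disjoint[OF cov] le_less_trans[OF S fin] in auto)
  also have "\<dots> \<le> \<Delta>1 powe (q / r) * energy f powe (q / p)"
    using r_pos q_pos by (intro mult_right_mono powe_mono S) auto
  finally show "(\<Sum>k\<in>?I. \<Psi>1 1 q 1 f (?A k) (?x k) (?B k)) \<le> \<Delta>1 powe (q / r) * energy f powe (q / p)" .
qed

lemma \<Psi>2_Holder:
  assumes [measurable]: "f \<in> borel_measurable lebesgue" and fin: "\<Delta>2 < top"
  shows "covering_sup (\<Psi>2 1 q f) \<le> \<Delta>2 powe (q / r) * energy f powe (q / p)"
proof (rule covering_sup_least)
  fix kmin kmax t assume cov: "covering_sequence kmin kmax t"
  let ?I = "{kmin<..<kmax}" and ?x = "\<lambda>k. real_of_ereal (t k)"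
  let ?A = "\<lambda>k. einterval (t (k - 1)) (t k)" and ?B = "\<lambda>k. einterval (t k) (t (k + 1))"
  let ?S = "\<Sum>k\<in>?I. wk (?A k) (?x k) powe (r / q) * sint (?B k) (\<lambda>y. 1 powe p' * v y powe (1 - p')) powe (r / p')"
  have S: "?S \<le> \<Delta>2"
    using covering_sup_upper[OF cov, of "\<Psi>2 (r / q) (r / p') \<sigma>"] by (simp add: \<Psi>2_def \<Delta>2_def \<sigma>_def)
  have "(\<Sum>k\<in>?I. \<Psi>2 1 q f (?A k) (?x k) (?B k)) = (\<Sum>k\<in>?I. wk (?A k) (?x k) * sint (?B k) (\<lambda>y. 1 * f y) powe q)"
    by (simp add: \<Psi>2_def)
  also have "\<dots> \<le> ?S powe (q / r) * energy f powe (q / p)"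
    unfolding energy_def
  proof (rule sum_Holder_weighted[OF p_facts, where g = "\<lambda>_ _. 1"])
    show "(\<Union>i\<in>?I. ?B i) \<subseteq> {0<..}" using covering_right_pos[OF cov] by fastforce
  qed (use v_finite covering_disjoint[OF cov] le_less_trans[OF S fin] in auto)
  also have "\<dots> \<le> \<Delta>2 powe (q / r) * energy f powe (q / p)"
    using r_pos q_pos by (intro mult_right_mono powe_mono S) auto
  finally show "(\<Sum>k\<in>?I. \<Psi>2 1 q f (?A k) (?x k) (?B k)) \<le> \<Delta>2 powe (q / r) * energy f powe (q / p)" .
qed

lemma hardy_of_discrete:
  assumes "\<Delta>1 + \<Delta>2 < top"
  shows "hardy ((2 * hardy_const \<theta> 1 q 1) powe (1 / q) * (\<Delta>1 + \<Delta>2) powe (1 / r))"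
  unfolding hardy_def
proof
  fix f :: "real \<Rightarrow> ennreal" assume f: "f \<in> borel_measurable lebesgue"
  let ?D = "\<Delta>1 + \<Delta>2" and ?h = "hardy_const \<theta> 1 q 1" and ?E = "energy f powe (q / p)"
  have fin: "\<Delta>1 < top" "\<Delta>2 < top" using assms by auto
  \<comment> \<open>At \<open>\<alpha> = 1\<close> the factor \<open>W powe (\<alpha> - 1)\<close>
    equals 1, so the general estimate bounds the left-hand side of the Hardy inequality
    itself.\<close>
  have "sint {0<..} (\<lambda>t. ktail 1 f t powe q * w t) = sint {0<..} (\<lambda>t. W t powe (1 - 1) * w t * ktail 1 f t powe q)"
    by (simp add: mult.commute)
  also have "\<dots> \<le> ?h * (covering_sup (\<Psi>1 1 q 1 f) + covering_sup (\<Psi>2 1 q f))"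
    by (rule hardy_integral_le) (use f q_pos in auto)
  also have "\<dots> \<le> ?h * (\<Delta>1 powe (q / r) * ?E + \<Delta>2 powe (q / r) * ?E)"
    by (intro mult_left_mono add_mono \<Psi>1_Holder \<Psi>2_Holder f fin) simp
  also have "\<dots> \<le> ?h * (?D powe (q / r) * ?E + ?D powe (q / r) * ?E)"
    using q_pos r_pos by (intro mult_left_mono add_mono mult_right_mono powe_mono) auto
  also have "\<dots> = 2 * ?h * (?D powe (q / r) * ?E)"
    by (simp only: mult_2 distrib_left distrib_right mult_ac)
  finally have "sint {0<..} (\<lambda>t. ktail 1 f t powe q * w t) powe (1 / q) \<le> (2 * ?h * (?D powe (q / r) * ?E)) powe (1 / q)"
    using q_pos by (intro powe_mono) auto
  also have "\<dots> = (2 * ?h) powe (1 / q) * ?D powe (1 / r) * energy f powe (1 / p)"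
  proof -
    have q1: "0 \<le> 1 / q" using q_pos by simp
    have e: "(X powe (q / s)) powe (1 / q) = X powe (1 / s)" if "0 < s" for X s
      using powe_powe[of "q / s" "1 / q" X] q_pos that by simp
    have "(?D powe (q / r) * ?E) powe (1 / q) = ?D powe (1 / r) * energy f powe (1 / p)"
      using r_pos exponents(2) by (simp add: powe_mult[OF q1] e)
    then show ?thesis
      using powe_mult[OF q1, of "2 * ?h" "?D powe (q / r) * ?E"] by (simp only: mult.assoc)
  qed
  finally show "sint {0<..} (\<lambda>t. ktail 1 f t powe q * w t) powe (1 / q)
      \<le> (2 * ?h) powe (1 / q) * ?D powe (1 / r) * energy f powe (1 / p)" .
qed

end

section \<open>Comparison of the integral and the discrete conditions\<close>

definition discrete_const :: "real \<Rightarrow> real \<Rightarrow> real \<Rightarrow> ennreal" where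
  "discrete_const \<theta> q \<alpha> = 2 powe \<alpha> + 2 powe \<alpha> * (tri \<theta> q powe (\<alpha> - 1) * 2 powe (\<alpha> - 1))"

lemma discrete_const_less_top: "1 \<le> \<alpha> \<Longrightarrow> 0 \<le> q \<Longrightarrow> discrete_const \<theta> q \<alpha> < top"
  by (auto simp: discrete_const_def ennreal_mult_less_top intro!: powe_less_top tri_less_top)

lemma hardy_sum_const_less_top: "0 \<le> \<alpha> \<Longrightarrow> 0 \<le> \<beta> \<Longrightarrow> 0 \<le> a \<Longrightarrow> hardy_sum_const \<theta> \<alpha> \<beta> a < top"
  by (auto simp: hardy_sum_const_def ennreal_mult_less_top intro!: powe_less_top split_const_less_top)

lemma hardy_const_less_top: "0 \<le> \<alpha> \<Longrightarrow> 0 \<le> \<beta> \<Longrightarrow> 0 \<le> a \<Longrightarrow> hardy_const \<theta> \<alpha> \<beta> a < top"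
  by (auto simp: hardy_const_def ennreal_mult_less_top intro!: powe_less_top hardy_sum_const_less_top)

lemma sup_const_less_top: "1 \<le> \<alpha> \<Longrightarrow> 0 \<le> \<beta> \<Longrightarrow> 0 \<le> a \<Longrightarrow> 0 \<le> q \<Longrightarrow> sup_const \<theta> q \<alpha> \<beta> a < top"
  by (auto simp: sup_const_def sup_dyadic_const_def sup_sum_const_def ennreal_mult_less_top
      intro!: powe_less_top hardy_sum_const_less_top level_const_less_top tri_less_top)

context hardy_kernel
begin

definition I1 :: ennreal where
  "I1 = sint {0<..} (\<lambda>t. W t powe (r / p) * w t * ktail p' \<sigma> t powe (r / p'))"

definition I2 :: ennreal where
  "I2 = sint {0<..} (\<lambda>t. G t powe (r / p) * w t * M (r / p') \<sigma> t)"

text \<open>The hypotheses of the general estimates at \<open>\<alpha> = r / q\<close>,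
  \<open>\<beta> = r / p'\<close>, \<open>a = p'\<close>. The fourth is
  \<open>a * \<beta> = \<alpha> * q\<close>; the last identifies \<open>\<alpha> - 1\<close> with
  the exponent \<open>r / p\<close> of \<open>A1\<close> and \<open>A2\<close>.\<close>

lemma exponent_facts: "1 \<le> r / q" "0 < r / p'" "0 < p'" "p' * (r / p') = r / q * q" "r / q - 1 = r / p"
proof -
  note gap = gap_exponent(2,6)[OF q_pos exponents(1,4)]
  show "1 \<le> r / q" "0 < r / p'" "0 < p'" using gap(1) p'_gt_1 r_pos by auto
  show "p' * (r / p') = r / q * q" using p'_gt_1 q_pos by simp
  show "r / q - 1 = r / p" using gap(2) by simp
qed

lemma integral_le_discrete:
  "I1 + I2 \<le> (hardy_const \<theta> (r / q) (r / p') p' + sup_const \<theta> q (r / q) (r / p') p') * (\<Delta>1 + \<Delta>2)"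
  using add_mono[OF hardy_integral_le[OF \<sigma>_measurable exponent_facts(1-4)] sup_integral_le[OF \<sigma>_measurable exponent_facts(1-4)]]
  unfolding exponent_facts(5) by (simp only: I1_def I2_def \<Delta>1_def \<Delta>2_def distrib_right)

lemma discrete_le_integral: "\<Delta>1 + \<Delta>2 \<le> discrete_const \<theta> q (r / q) * (I1 + I2)"
proof -
  have "\<Delta>1 \<le> 2 powe (r / q) * I1"
    using \<Psi>1_sup_le_integral[OF \<sigma>_measurable exponent_facts(1-3)]
    unfolding exponent_facts(5) by (simp only: I1_def \<Delta>1_def)
  also have "\<dots> \<le> 2 powe (r / q) * (I1 + I2)" by (intro mult_left_mono) auto
  finally have "\<Delta>1 \<le> 2 powe (r / q) * (I1 + I2)" .
  moreover have "\<Delta>2 \<le> 2 powe (r / q) * (tri \<theta> q powe (r / q - 1) * 2 powe (r / q - 1)) * (I1 + I2)"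
    using \<Psi>2_sup_le_integral[OF \<sigma>_measurable exponent_facts(1-4)]
    unfolding exponent_facts(5) by (simp only: I1_def I2_def \<Delta>2_def)
  ultimately show ?thesis
    unfolding discrete_const_def by (subst distrib_right) (rule add_mono)
qed

lemma discrete_le_hardy: "hardy C \<Longrightarrow> \<Delta>1 + \<Delta>2 \<le> 2 * C powe r"
  using add_mono[OF \<Delta>1_le \<Delta>2_le] by (simp add: mult_2)

end

subsection \<open>Transfer to functions on the half-line\<close>

text \<open>Clamping negative arguments at 0 keeps monotonicity and the triangle inequality on the
  whole line.\<close>

definition half_kernel :: "(real \<Rightarrow> real \<Rightarrow> real) \<Rightarrow> real \<Rightarrow> real \<Rightarrow> ennreal" where
  "half_kernel U x y = ennreal (U (max x 0) (max y 0))"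

definition half :: "(real \<Rightarrow> ennreal) \<Rightarrow> real \<Rightarrow> ennreal" where
  "half f x = f x * indicator {0<..} x"

lemma half_kernel_pos: "0 \<le> x \<Longrightarrow> 0 \<le> y \<Longrightarrow> half_kernel U x y = ennreal (U x y)"
  by (simp add: half_kernel_def)

lemma half_pos: "0 < x \<Longrightarrow> half f x = f x"
  by (simp add: half_def)

lemma half_measurable: "f \<in> nonneg_measurable \<longleftrightarrow> half f \<in> borel_measurable lebesgue"
  unfolding nonneg_measurable_def half_def
  by (rule borel_measurable_restrict_space_iff_ennreal) auto

lemma regular_kernel_half:
  assumes "regular_kernel \<theta> U"
  shows "kernel (half_kernel U) (max \<theta> 1)"
proof
  have anti: "U x' y \<le> U x y" if "0 \<le> x" "x \<le> x'" "0 \<le> y" for x x' y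
    using assms that by (auto simp: regular_kernel_def monotone_on_def)
  have mono: "U x y \<le> U x y'" if "0 \<le> x" "0 \<le> y" "y \<le> y'" for x y y'
    using assms that by (auto simp: regular_kernel_def monotone_on_def)
  have nonneg: "0 \<le> U x y" if "0 \<le> x" "0 \<le> y" for x y
    using assms that by (auto simp: regular_kernel_def)
  have tri: "U x z \<le> \<theta> * (U x y + U y z)" if "0 \<le> x" "x < y" "y < z" for x y z
    using assms that by (auto simp: regular_kernel_def)
  show "1 \<le> max \<theta> 1" by simp
  show "half_kernel U y z \<le> half_kernel U x z" if "x \<le> y" for x y z
    unfolding half_kernel_def using that by (intro ennreal_leI anti) auto
  show "half_kernel U x y \<le> half_kernel U x z" if "y \<le> z" for x y z
    unfolding half_kernel_def using that by (intro ennreal_leI mono) auto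
  show "half_kernel U x y < top" for x y by (simp add: half_kernel_def)
  show "half_kernel U x z \<le> ennreal (max \<theta> 1) * (half_kernel U x y + half_kernel U y z)"
    if "x \<le> y" "y \<le> z" for x y z
  proof -
    define a b c where "a = max x 0" and "b = max y 0" and "c = max z 0"
    have abc: "0 \<le> a" "a \<le> b" "b \<le> c" using that by (auto simp: a_def b_def c_def)
    have nn: "0 \<le> U a b" "0 \<le> U b c" using abc by (auto intro: nonneg)
    have "U a c \<le> max \<theta> 1 * (U a b + U b c)"
    proof (cases "a < b \<and> b < c")
      case True
      then have "U a c \<le> \<theta> * (U a b + U b c)" using abc by (intro tri) auto
      also have "\<dots> \<le> max \<theta> 1 * (U a b + U b c)" using nn by (intro mult_right_mono) auto
      finally show ?thesis .
    next
      case False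
      \<comment> \<open>If two of the points coincide, the left-hand side is one of the two
        summands; this is why the constant is raised to at least 1.\<close>
      then have "U a c \<le> 1 * (U a b + U b c)" using abc nn by (cases "a = b") auto
      also have "\<dots> \<le> max \<theta> 1 * (U a b + U b c)" using nn by (intro mult_right_mono) auto
      finally show ?thesis .
    qed
    then have "ennreal (U a c) \<le> ennreal (max \<theta> 1 * (U a b + U b c))" by (rule ennreal_leI)
    also have "\<dots> = ennreal (max \<theta> 1) * (ennreal (U a b) + ennreal (U b c))"
      using nn by (simp add: ennreal_mult)
    finally show ?thesis unfolding half_kernel_def a_def b_def c_def .
  qed
qed

text \<open>Local integrability gives finiteness almost everywhere on each bounded interval, and
  countably many of these cover the half-line.\<close>

lemma weight_AE_finite:
  assumes "weight v"
  shows "AE x in lebesgue. 0 < x \<longrightarrow> v x \<noteq> top"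
proof -
  have m: "half v \<in> borel_measurable lebesgue" using assms by (simp add: weight_def half_measurable[symmetric])
  have "AE x in lebesgue. half v x * indicator {0<..<real (Suc n)} x \<noteq> top" for n
  proof -
    have [measurable]: "half v \<in> borel_measurable lebesgue" "{0<..<real (Suc n)} \<in> sets lebesgue" using m by auto
    have "sint {0<..<real (Suc n)} (half v) = sint {0<..<real (Suc n)} v"
      by (rule sint_cong) (simp add: half_pos)
    moreover have "sint {0<..<real (Suc n)} v < \<infinity>"
      using assms unfolding weight_def by (meson of_nat_0_less_iff zero_less_Suc)
    ultimately have "sint {0<..<real (Suc n)} (half v) \<noteq> \<infinity>" by simp
    moreover have "(\<lambda>x. half v x * indicator {0<..<real (Suc n)} x) \<in> borel_measurable lebesgue" by measurable
    ultimately show ?thesis using nn_integral_PInf_AE by force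
  qed
  then have "AE x in lebesgue. \<forall>n. half v x * indicator {0<..<real (Suc n)} x \<noteq> top"
    by (simp add: AE_all_countable)
  then show ?thesis
  proof (rule eventually_mono, intro impI)
    fix x :: real assume x: "\<forall>n. half v x * indicator {0<..<real (Suc n)} x \<noteq> top" "0 < x"
    obtain n where "x < real n" using reals_Archimedean2 by blast
    then have "x \<in> {0<..<real (Suc n)}" using x by auto
    then show "v x \<noteq> top" using x(1)[rule_format, of n] by (simp add: half_pos x(2))
  qed
qed

lemma hardy_kernel_half:
  assumes "0 < q" "q < 1" "1 < p" "r = p * q / (p - q)" "p' = p / (p - 1)"
    and v: "weight v" and w: "weight w" and U: "regular_kernel \<theta> U"
  shows "hardy_kernel (half_kernel U) (max \<theta> 1) (half w) q p p' r (half v)"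
proof -
  interpret kernel "half_kernel U" "max \<theta> 1" by (rule regular_kernel_half[OF U])
  have half: "sint {0<..<t} (half w) = sint {0<..<t} w" for t
    by (rule sint_cong) (simp add: half_pos)
  have fin: "sint {0<..<t} w < top" for t
    using w by (cases "0 < t") (auto simp: weight_def)
  show ?thesis
  proof (unfold_locales, goal_cases)
    case 1
    then show ?case using w by (simp add: weight_def half_measurable)
  next
    case (2 t)
    then show ?case using fin by (simp add: half)
  next
    case (3 t)
    then show ?case using w by (simp add: half weight_def)
  next
    case 9
    then show ?case using v by (simp add: weight_def half_measurable)
  next
    case 10
    show ?case
      by (rule eventually_mono[OF weight_AE_finite[OF v]]) (simp add: half_pos)
  qed (use assms in auto)
qed

context
  fixes p q r p' \<theta> :: real and v w :: "real \<Rightarrow> ennreal" and U :: "real \<Rightarrow> real \<Rightarrow> real"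
  assumes pq: "0 < q" "q < 1" "1 < p" "r = p * q / (p - q)" "p' = p / (p - 1)"
    and v: "weight v" and w: "weight w" and U: "regular_kernel \<theta> U"
begin

interpretation H: hardy_kernel "half_kernel U" "max \<theta> 1" "half w" q p p' r "half v"
  by (rule hardy_kernel_half[OF pq v w U])

text \<open>Extension by zero and restriction pass between the two classes of functions, and neither
  side of the inequality sees values at nonpositive arguments.\<close>

lemma hardy_inequality_half: "hardy_inequality p q v w U C \<longleftrightarrow> H.hardy C"
proof -
  have lhs: "sint {0<..} (\<lambda>t. sint {t<..} (\<lambda>x. f x * ennreal (U t x)) powe q * w t)
      = sint {0<..} (\<lambda>t. H.ktail 1 (half f) t powe q * half w t)" for f
  proof (rule sint_cong)
    fix t :: real assume t: "t \<in> {0<..}"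
    have "sint {t<..} (\<lambda>x. f x * ennreal (U t x)) = H.ktail 1 (half f) t"
      unfolding H.ktail_def by (rule sint_cong) (use t in \<open>auto simp: half_pos half_kernel_pos mult.commute\<close>)
    then show "sint {t<..} (\<lambda>x. f x * ennreal (U t x)) powe q * w t = H.ktail 1 (half f) t powe q * half w t"
      using t by (simp add: half_pos)
  qed
  have rhs: "sint {0<..} (\<lambda>t. f t powe p * v t) = H.energy (half f)" for f
    unfolding H.energy_def by (rule sint_cong) (auto simp: half_pos)
  have half_idem: "H.ktail 1 (half f) t = H.ktail 1 f t" if "0 < t" for f t
    unfolding H.ktail_def by (rule sint_cong) (use that in \<open>auto simp: half_pos\<close>)
  have half_idem2: "H.energy (half f) = H.energy f" for f
    unfolding H.energy_def by (rule sint_cong) (auto simp: half_pos)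
  have half_idem3: "sint {0<..} (\<lambda>t. H.ktail 1 (half f) t powe q * half w t)
      = sint {0<..} (\<lambda>t. H.ktail 1 f t powe q * half w t)" for f
    by (rule sint_cong) (auto simp: half_idem)
  have meas: "f \<in> nonneg_measurable" if "f \<in> borel_measurable lebesgue" for f
    using that unfolding nonneg_measurable_def by (rule measurable_restrict_space1)
  show ?thesis
    unfolding hardy_inequality_def H.hardy_def lhs rhs
  proof (intro iffI ballI)
    fix f :: "real \<Rightarrow> ennreal"
    assume "\<forall>f\<in>nonneg_measurable. sint {0<..} (\<lambda>t. H.ktail 1 (half f) t powe q * half w t) powe (1 / q)
        \<le> C * H.energy (half f) powe (1 / p)" and "f \<in> borel_measurable lebesgue"
    then show "sint {0<..} (\<lambda>t. H.ktail 1 f t powe q * half w t) powe (1 / q) \<le> C * H.energy f powe (1 / p)"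
      using meas by (auto simp: half_idem2 half_idem3)
  next
    fix f :: "real \<Rightarrow> ennreal"
    assume "\<forall>f\<in>borel_measurable lebesgue. sint {0<..} (\<lambda>t. H.ktail 1 f t powe q * half w t) powe (1 / q)
        \<le> C * H.energy f powe (1 / p)" and "f \<in> nonneg_measurable"
    then show "sint {0<..} (\<lambda>t. H.ktail 1 (half f) t powe q * half w t) powe (1 / q) \<le> C * H.energy (half f) powe (1 / p)"
      using half_measurable by auto
  qed
qed

lemma D1_half: "D1 q r p' v w U = H.\<Delta>1"
  unfolding D1_def H.\<Delta>1_def covering_sup_def
proof (intro SUP_cong refl, clarify, rule sum.cong[OF refl])
  fix kmin kmax t k assume cov: "covering_sequence kmin kmax t" and "k \<in> {kmin<..<kmax}"
  then have k: "kmin < k" "k < kmax" by auto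
  have "sint (einterval (t (k - 1)) (t k)) w = sint (einterval (t (k - 1)) (t k)) (half w)"
    by (rule sint_cong) (use covering_left_pos[OF cov k] in \<open>auto simp: half_pos\<close>)
  moreover have "sint (einterval (t k) (t (k + 1))) (\<lambda>x. ennreal (U (real_of_ereal (t k)) x) powe p' * v x powe (1 - p'))
     = sint (einterval (t k) (t (k + 1))) (\<lambda>x. half_kernel U (real_of_ereal (t k)) x powe p' * H.\<sigma> x)"
    using covering_right_pos[OF cov k] covering_sequence_real(2)[OF cov k]
    by (intro sint_cong) (auto simp: half_pos half_kernel_pos H.\<sigma>_def subset_eq)
  ultimately show "sint (einterval (t (k - 1)) (t k)) w powe (r / q) *
       sint (einterval (t k) (t (k + 1))) (\<lambda>x. ennreal (U (real_of_ereal (t k)) x) powe p' * v x powe (1 - p')) powe (r / p')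
     = H.\<Psi>1 (r / q) (r / p') p' H.\<sigma> (einterval (t (k - 1)) (t k)) (real_of_ereal (t k)) (einterval (t k) (t (k + 1)))"
    by (simp add: H.\<Psi>1_def)
qed

lemma D2_half: "D2 q r p' v w U = H.\<Delta>2"
  unfolding D2_def H.\<Delta>2_def covering_sup_def
proof (intro SUP_cong refl, clarify, rule sum.cong[OF refl])
  fix kmin kmax t k assume cov: "covering_sequence kmin kmax t" and "k \<in> {kmin<..<kmax}"
  then have k: "kmin < k" "k < kmax" by auto
  have "sint (einterval (t (k - 1)) (t k)) (\<lambda>s. w s * ennreal (U s (real_of_ereal (t k))) powe q)
     = H.wk (einterval (t (k - 1)) (t k)) (real_of_ereal (t k))"
    unfolding H.wk_def using covering_left_pos[OF cov k] covering_sequence_real(2)[OF cov k]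
    by (intro sint_cong) (auto simp: half_pos half_kernel_pos subset_eq)
  moreover have "sint (einterval (t k) (t (k + 1))) (\<lambda>x. v x powe (1 - p')) = sint (einterval (t k) (t (k + 1))) H.\<sigma>"
    using covering_right_pos[OF cov k] by (intro sint_cong) (auto simp: half_pos H.\<sigma>_def subset_eq)
  ultimately show "sint (einterval (t (k - 1)) (t k)) (\<lambda>s. w s * ennreal (U s (real_of_ereal (t k))) powe q) powe (r / q) *
       sint (einterval (t k) (t (k + 1))) (\<lambda>x. v x powe (1 - p')) powe (r / p')
     = H.\<Psi>2 (r / q) (r / p') H.\<sigma> (einterval (t (k - 1)) (t k)) (real_of_ereal (t k)) (einterval (t k) (t (k + 1)))"
    by (simp add: H.\<Psi>2_def)
qed

lemma A1_half: "A1 p r p' v w U = H.I1"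
  unfolding A1_def H.I1_def
proof (rule sint_cong)
  fix t :: real assume t: "t \<in> {0<..}"
  have "sint {0<..<t} w = H.W t"
    unfolding H.W_def by (rule sint_cong) (auto simp: half_pos)
  moreover have "sint {t<..} (\<lambda>z. ennreal (U t z) powe p' * v z powe (1 - p')) = H.ktail p' H.\<sigma> t"
    unfolding H.ktail_def by (rule sint_cong) (use t in \<open>auto simp: half_pos half_kernel_pos H.\<sigma>_def\<close>)
  ultimately show "sint {0<..<t} w powe (r / p) * w t * sint {t<..} (\<lambda>z. ennreal (U t z) powe p' * v z powe (1 - p')) powe (r / p')
     = H.W t powe (r / p) * half w t * H.ktail p' H.\<sigma> t powe (r / p')"
    using t by (simp add: half_pos)
qed

lemma A2_half: "A2 p q r p' v w U = H.I2"
  unfolding A2_def H.I2_def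
proof (rule sint_cong)
  fix t :: real assume t: "t \<in> {0<..}"
  have "sint {0<..<t} (\<lambda>x. w x * ennreal (U x t) powe q) = H.G t"
    unfolding H.G_def H.wk_def by (rule sint_cong) (use t in \<open>auto simp: half_pos half_kernel_pos\<close>)
  moreover have "(SUP z\<in>{t..}. ennreal (U t z) powe q * sint {z<..} (\<lambda>s. v s powe (1 - p')) powe (r / p')) = H.M (r / p') H.\<sigma> t"
    unfolding H.M_def
  proof (rule SUP_cong[OF refl])
    fix z assume z: "z \<in> {t..}"
    have "sint {z<..} (\<lambda>s. v s powe (1 - p')) = sint {z<..} H.\<sigma>"
      by (rule sint_cong) (use t z in \<open>auto simp: half_pos H.\<sigma>_def\<close>)
    then show "ennreal (U t z) powe q * sint {z<..} (\<lambda>s. v s powe (1 - p')) powe (r / p') = half_kernel U t z powe q * H.Q (r / p') H.\<sigma> z"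
      using t z by (simp add: half_kernel_pos H.Q_def)
  qed
  ultimately show "sint {0<..<t} (\<lambda>x. w x * ennreal (U x t) powe q) powe (r / p) * w t *
      (SUP z\<in>{t..}. ennreal (U t z) powe q * sint {z<..} (\<lambda>s. v s powe (1 - p')) powe (r / p'))
    = H.G t powe (r / p) * half w t * H.M (r / p') H.\<sigma> t"
    using t by (simp add: half_pos)
qed

lemma A_le_D:
  "A1 p r p' v w U + A2 p q r p' v w U
    \<le> (hardy_const (max \<theta> 1) (r / q) (r / p') p' + sup_const (max \<theta> 1) q (r / q) (r / p') p') *
       (D1 q r p' v w U + D2 q r p' v w U)"
  unfolding A1_half A2_half D1_half D2_half by (rule H.integral_le_discrete)

lemma D_le_A:
  "D1 q r p' v w U + D2 q r p' v w U
    \<le> discrete_const (max \<theta> 1) q (r / q) * (A1 p r p' v w U + A2 p q r p' v w U)"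
  unfolding A1_half A2_half D1_half D2_half by (rule H.discrete_le_integral)

lemma D_le_hardy:
  "hardy_inequality p q v w U C \<Longrightarrow> D1 q r p' v w U + D2 q r p' v w U \<le> 2 * C powe r"
  unfolding hardy_inequality_half D1_half D2_half by (rule H.discrete_le_hardy)

lemma hardy_of_D:
  assumes "D1 q r p' v w U + D2 q r p' v w U < top"
  shows "hardy_inequality p q v w U ((2 * hardy_const (max \<theta> 1) 1 q 1) powe (1 / q) *
    (D1 q r p' v w U + D2 q r p' v w U) powe (1 / r))"
  using assms unfolding hardy_inequality_half D1_half D2_half by (rule H.hardy_of_discrete)

end

section \<open>Equivalence of the conditions with uniform constants\<close>

lemma hardy_inequality_mono:
  "hardy_inequality p q v w U C \<Longrightarrow> C \<le> C' \<Longrightarrow> hardy_inequality p q v w U C'"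
  unfolding hardy_inequality_def by (meson mult_right_mono order_trans zero_le)

theorem theorem7:
  fixes p q r p' \<theta> :: real
  assumes "0 < q" and "q < 1" and "1 < p"
    and "r = p * q / (p - q)" and "p' = p / (p - 1)"
    and "0 < \<theta>"
  shows
    "(\<forall>v w U. weight v \<longrightarrow> weight w \<longrightarrow> regular_kernel \<theta> U \<longrightarrow>
        ((\<exists>C. 0 < C \<and> C < \<infinity> \<and> hardy_inequality p q v w U C) \<longleftrightarrow>
           D1 q r p' v w U < \<infinity> \<and> D2 q r p' v w U < \<infinity>) \<and>
        (D1 q r p' v w U < \<infinity> \<and> D2 q r p' v w U < \<infinity> \<longleftrightarrow>
           A1 p r p' v w U < \<infinity> \<and> A2 p q r p' v w U < \<infinity>)) \<and>
     (\<exists>c::real. 0 < c \<and>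
       (\<forall>v w U. weight v \<longrightarrow> weight w \<longrightarrow> regular_kernel \<theta> U \<longrightarrow>
          best_constant p q v w U powe r \<le> ennreal c * (D1 q r p' v w U + D2 q r p' v w U) \<and>
          D1 q r p' v w U + D2 q r p' v w U \<le> ennreal c * best_constant p q v w U powe r \<and>
          D1 q r p' v w U + D2 q r p' v w U \<le> ennreal c * (A1 p r p' v w U + A2 p q r p' v w U) \<and>
          A1 p r p' v w U + A2 p q r p' v w U \<le> ennreal c * (D1 q r p' v w U + D2 q r p' v w U)))"
proof -
  note pq = assms(1-5)
  have p': "1 < p'" by (rule conjugate_exponent[OF assms(3,5)])
  have qp: "q < p" using assms by simp
  have r: "0 < r" "1 < r / q" using gap_exponent(1,2)[OF assms(1) qp assms(4)] by auto
  \<comment> \<open>The constants are fixed before the weights and the kernel are introduced, which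
    is the required uniformity. \<open>max \<theta> 1\<close> is the constant of the extended
    kernel.\<close>
  define K1 where "K1 = hardy_const (max \<theta> 1) (r / q) (r / p') p' + sup_const (max \<theta> 1) q (r / q) (r / p') p'"
  define K2 where "K2 = discrete_const (max \<theta> 1) q (r / q)"
  define K3 where "K3 = (2 * hardy_const (max \<theta> 1) 1 q 1) powe (1 / q)"
  define K where "K = K1 + K2 + K3 powe r + 2"
  have fin1: "K1 < top" "K2 < top" "K3 < top"
    unfolding K1_def K2_def K3_def using p' r assms(1)
    by (auto simp: ennreal_mult_less_top intro!: hardy_const_less_top sup_const_less_top discrete_const_less_top powe_less_top)
  have Kfin: "K < top" unfolding K_def using fin1 r by (auto intro!: powe_less_top)
  define c where "c = enn2real K"
  have c: "ennreal c = K" using Kfin by (simp add: c_def)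
  have Kge: "K1 \<le> K" "K2 \<le> K" "K3 powe r \<le> K" "2 \<le> K"
    unfolding K_def by (auto simp: add_increasing add_increasing2)
  have "0 < c" using Kge(4) c by (metis ennreal_eq_0_iff leD le_zero_eq not_le zero_neq_numeral)
  have pw: "((\<exists>C. 0 < C \<and> C < \<infinity> \<and> hardy_inequality p q v w U C) \<longleftrightarrow>
           D1 q r p' v w U < \<infinity> \<and> D2 q r p' v w U < \<infinity>) \<and>
        (D1 q r p' v w U < \<infinity> \<and> D2 q r p' v w U < \<infinity> \<longleftrightarrow>
           A1 p r p' v w U < \<infinity> \<and> A2 p q r p' v w U < \<infinity>)"
    and cw: "best_constant p q v w U powe r \<le> ennreal c * (D1 q r p' v w U + D2 q r p' v w U) \<and>
          D1 q r p' v w U + D2 q r p' v w U \<le> ennreal c * best_constant p q v w U powe r \<and>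
          D1 q r p' v w U + D2 q r p' v w U \<le> ennreal c * (A1 p r p' v w U + A2 p q r p' v w U) \<and>
          A1 p r p' v w U + A2 p q r p' v w U \<le> ennreal c * (D1 q r p' v w U + D2 q r p' v w U)"
    if vwU: "weight v" "weight w" "regular_kernel \<theta> U" for v w U
  proof -
    define D where "D = D1 q r p' v w U + D2 q r p' v w U"
    define A where "A = A1 p r p' v w U + A2 p q r p' v w U"
    define b where "b = best_constant p q v w U"
    have AD: "A \<le> K1 * D" unfolding A_def D_def K1_def by (rule A_le_D[OF pq vwU])
    have DA: "D \<le> K2 * A" unfolding A_def D_def K2_def by (rule D_le_A[OF pq vwU])
    have Dfin: "D < top \<longleftrightarrow> D1 q r p' v w U < \<infinity> \<and> D2 q r p' v w U < \<infinity>" by (simp add: D_def)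
    have Afin: "A < top \<longleftrightarrow> A1 p r p' v w U < \<infinity> \<and> A2 p q r p' v w U < \<infinity>" by (simp add: A_def)
    have DC: "D \<le> 2 * C powe r" if "hardy_inequality p q v w U C" for C
      unfolding D_def using that by (rule D_le_hardy[OF pq vwU])
    have CD: "hardy_inequality p q v w U (K3 * D powe (1 / r))" if "D < top"
      using hardy_of_D[OF pq vwU] that unfolding D_def K3_def by blast
    have C0fin: "K3 * D powe (1 / r) < top" if "D < top"
      using that fin1 r by (auto simp: ennreal_mult_less_top intro!: powe_less_top)
    have AD_fin: "A < top" if "D < top"
      by (rule le_less_trans[OF AD]) (use that fin1 in \<open>simp add: ennreal_mult_less_top\<close>)
    have DA_fin: "D < top" if "A < top"
      by (rule le_less_trans[OF DA]) (use that fin1 in \<open>simp add: ennreal_mult_less_top\<close>)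
    show "((\<exists>C. 0 < C \<and> C < \<infinity> \<and> hardy_inequality p q v w U C) \<longleftrightarrow>
           D1 q r p' v w U < \<infinity> \<and> D2 q r p' v w U < \<infinity>) \<and>
        (D1 q r p' v w U < \<infinity> \<and> D2 q r p' v w U < \<infinity> \<longleftrightarrow>
           A1 p r p' v w U < \<infinity> \<and> A2 p q r p' v w U < \<infinity>)"
      unfolding Dfin[symmetric] Afin[symmetric]
    proof (intro conjI iffI)
      assume "\<exists>C. 0 < C \<and> C < \<infinity> \<and> hardy_inequality p q v w U C"
      then obtain C where C: "C < top" "hardy_inequality p q v w U C" by auto
      have "2 * C powe r < top" using C r by (auto simp: ennreal_mult_less_top intro!: powe_less_top)
      then show "D < top" using DC[OF C(2)] by (rule le_less_trans[rotated])
    next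
      assume D: "D < top"
      \<comment> \<open>The constant obtained from \<open>D\<close> may be 0, whereas a positive one
        is asked for.\<close>
      have "hardy_inequality p q v w U (K3 * D powe (1 / r) + 1)"
        by (rule hardy_inequality_mono[OF CD[OF D]]) simp
      moreover have "K3 * D powe (1 / r) + 1 < \<infinity>" using C0fin[OF D] by simp
      moreover have "0 < K3 * D powe (1 / r) + 1" by (simp add: zero_less_iff_neq_zero)
      ultimately show "\<exists>C. 0 < C \<and> C < \<infinity> \<and> hardy_inequality p q v w U C" by blast
    qed (fact AD_fin DA_fin)+
    have bD: "b powe r \<le> K3 powe r * D" if "D < top"
    proof -
      have "b \<le> K3 * D powe (1 / r)"
      \<comment> \<open>Adding \<open>e\<close> makes the constant positive and hence admissible in
        the infimum; letting \<open>e\<close> tend to 0 covers the case of a vanishing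
        constant.\<close>
      proof (rule ennreal_le_epsilon)
        fix e :: real assume "0 < e"
        have "hardy_inequality p q v w U (K3 * D powe (1 / r) + ennreal e)"
          by (rule hardy_inequality_mono[OF CD[OF that]]) simp
        then show "b \<le> K3 * D powe (1 / r) + ennreal e"
          unfolding b_def best_constant_def using C0fin[OF that] \<open>0 < e\<close>
          by (intro Inf_lower) (auto simp: zero_less_iff_neq_zero)
      qed
      then have "b powe r \<le> (K3 * D powe (1 / r)) powe r" using r by (intro powe_mono) auto
      also have "\<dots> = K3 powe r * D" using r by (simp add: powe_mult powe_inverse)
      finally show ?thesis .
    qed
    have "D / 2 \<le> b powe r"
    proof -
      \<comment> \<open>Every admissible constant is bounded below by this root, so the infimum is
        as well; when no constant is admissible it is \<infinity> and the bound is trivial.\<close>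
      have "(D / 2) powe (1 / r) \<le> b"
        unfolding b_def best_constant_def
      proof (rule Inf_greatest)
        fix C assume "C \<in> {C. 0 < C \<and> C < \<infinity> \<and> hardy_inequality p q v w U C}"
        then have "D \<le> 2 * C powe r" using DC by auto
        then have "D / 2 \<le> 2 * C powe r / 2" by (rule divide_right_mono_ennreal)
        also have "\<dots> = C powe r" by (simp add: mult_divide_eq_ennreal mult.commute)
        finally show "(D / 2) powe (1 / r) \<le> C"
          using r powe_le_cancel[of r "(D / 2) powe (1 / r)" C] by (simp add: powe_inverse)
      qed
      then have "((D / 2) powe (1 / r)) powe r \<le> b powe r" using r by (intro powe_mono) auto
      then show ?thesis using r by (simp add: powe_inverse)
    qed
    then have "2 * (D / 2) \<le> 2 * b powe r" by (rule mult_left_mono) simp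
    moreover have "2 * (D / 2) = D"
      by (cases D) (auto simp: divide_ennreal ennreal_top_divide ennreal_mult_top ennreal_mult[symmetric] simp flip: ennreal_numeral)
    ultimately have Db: "D \<le> 2 * b powe r" by simp
    have bD': "b powe r \<le> K * D"
    \<comment> \<open>The construction of a constant needs finite \<open>D\<close>. For infinite
      \<open>D\<close> the right-hand side is infinite, as \<open>K\<close> is nonzero.\<close>
    proof (cases "D < top")
      case True
      then show ?thesis using bD mult_right_mono[OF Kge(3), of D] by (auto intro: order_trans)
    next
      case False
      then have "D = top" by (simp add: less_top[symmetric])
      moreover have "K \<noteq> 0" using Kge(4) by auto
      ultimately show ?thesis by (simp add: ennreal_mult_top)
    qed
    have scale: "X \<le> K * Y" if "X \<le> k * Y" "k \<le> K" for X Y k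
      using that(1) mult_right_mono[OF that(2), of Y] by (auto intro: order_trans)
    show "best_constant p q v w U powe r \<le> ennreal c * (D1 q r p' v w U + D2 q r p' v w U) \<and>
          D1 q r p' v w U + D2 q r p' v w U \<le> ennreal c * best_constant p q v w U powe r \<and>
          D1 q r p' v w U + D2 q r p' v w U \<le> ennreal c * (A1 p r p' v w U + A2 p q r p' v w U) \<and>
          A1 p r p' v w U + A2 p q r p' v w U \<le> ennreal c * (D1 q r p' v w U + D2 q r p' v w U)"
      unfolding c D_def[symmetric] A_def[symmetric] b_def[symmetric]
      using bD' scale[OF Db Kge(4)] scale[OF DA Kge(2)] scale[OF AD Kge(1)] by blast
  qed
  show ?thesis
    using pw cw \<open>0 < c\<close> by blast
qed

end
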